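(* Let $\mathcal{Y}$ be a nonempty measurable space and let $\mathcal{H}$ be a nonempty set of measurable functions $\mathbb{R}\to\mathcal{Y}$ satisfying the zero-measure crossings property and having graph dimension $d$ with $0<d<\infty$. Let $k\in\mathbb{N}$. For any $\varepsilon\in(0,1/2)$, there exists an $s$-sample $q$-query $\varepsilon$-tester for $\mathcal{F}_k(\mathcal{H})$ under the distribution $\mathrm{Uniform}(0,1)$ with $$s=O\!\left(\frac{d k}{\varepsilon^{6}}\ln\!\left(\frac{1}{\varepsilon}\right)\right)\quad\text{and}\quad q=O\!\left(\frac{d}{\varepsilon^{8}}\ln\!\left(\frac{1}{\varepsilon}\right)\right),$$ where the $O(\cdot)$ hide numerical constants independent of $k$, $d$, $\varepsilon$, and $\mathcal{H}$.
   Context: Zero-measure crossings: for all $h,h'\in\mathcal{H}$ with $h\neq h'$, the set $\{x: h(x)=h'(x)\}$ has Lebesgue measure $0$. Graph dimension $d$ of $\mathcal{H}$: the VC dimension of the collection of subsets $\{\{(x,h(x)):x\in\mathbb{R}\}: h\in\mathcal{H}\}$ of $\mathbb{R}\times\mathcal{Y}$. Piecewise class: with $t_0=-\infty$, $t_k=\infty$, for $t_1\le\cdots\le t_{k-1}$ in $\mathbb{R}$ and $h_1,\dots,h_k\in\mathcal{H}$, let $f(x;\{h_i\},\{t_i\})=h_i(x)$ for the $i$ with $t_{i-1}<x\le t_i$; $\mathcal{F}_k(\mathcal{H})$ is the set of all such functions. For measurable $f,g:\mathbb{R}\to\mathcal{Y}$ and $P=\mathrm{Uniform}(0,1)$, $\mathrm{dist}(f,g)=P(x:f(x)\neq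 g(x))$ and $\mathrm{dist}(f,\mathcal{F})=\inf_{g\in\mathcal{F}}\mathrm{dist}(f,g)$. An $s$-sample $q$-query $\varepsilon$-tester for $\mathcal{F}$ under $P$ is a randomized algorithm that draws a sample $S$ of at most $s$ points i.i.d. from $P$, sequentially (adaptively) queries the value of the unknown target function $f^*$ on at most $q$ points of $S$, and outputs accept or reject such that, for every measurable $f^*$: if $f^*\in\mathcal{F}$ it accepts with probability at least $2/3$, and if $\mathrm{dist}(f^*,\mathcal{F})\ge\varepsilon$ it rejects with probability at least $2/3$.
   Formalization: Adds a measurability proviso: for measurable f, the event that some h in H agrees with f on exactly a given subset of the sample points is Lebesgue measurable. Without it the claim fails, e.g. for the constants into the reals with the trivial sigma-algebra. *)

theory Defs
  imports "HOL-Probability.Probability"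
begin

definition shatters :: "'a set set \<Rightarrow> 'a set \<Rightarrow> bool" where
  "shatters \<C> A \<longleftrightarrow> (\<forall>B. B \<subseteq> A \<longrightarrow> (\<exists>S\<in>\<C>. S \<inter> A = B))"

definition vc_dim :: "'a set set \<Rightarrow> enat" where
  "vc_dim \<C> = (SUP A\<in>{A. finite A \<and> shatters \<C> A}. enat (card A))"

definition graph_dim :: "(real \<Rightarrow> 'y) set \<Rightarrow> enat" where
  "graph_dim H = vc_dim {{(x, h x) | x. True} | h. h \<in> H}"

definition zero_measure_crossings :: "(real \<Rightarrow> 'y) set \<Rightarrow> bool" where
  "zero_measure_crossings H \<longleftrightarrow>
     (\<forall>h\<in>H. \<forall>h'\<in>H. h \<noteq> h' \<longrightarrow> {x. h x = h' x} \<in> null_sets lebesgue)"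

definition piecewise :: "nat \<Rightarrow> (real \<Rightarrow> 'y) set \<Rightarrow> (real \<Rightarrow> 'y) set" where
  "piecewise k H = {f. \<exists>(h :: nat \<Rightarrow> real \<Rightarrow> 'y) (t :: nat \<Rightarrow> ereal).
     (\<forall>i\<in>{1..k}. h i \<in> H) \<and>
     t 0 = -\<infinity> \<and> t k = \<infinity> \<and>
     (\<forall>i\<in>{1..<k}. \<bar>t i\<bar> \<noteq> \<infinity>) \<and>
     (\<forall>i\<in>{1..<k}. \<forall>j\<in>{1..<k}. i \<le> j \<longrightarrow> t i \<le> t j) \<and>
     (\<forall>x. \<forall>i\<in>{1..k}. t (i - 1) < ereal x \<and> ereal x \<le> t i \<longrightarrow> f x = h i x)}"

definition unif01 :: "real measure" where
  "unif01 = uniform_measure lborel {0<..<1}"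

text \<open>
  Probabilities are taken in the completed measure, because for a general measurable
  space \<open>Y\<close> the set where two measurable functions agree need not be Borel
  (a crossing set is only known to be Lebesgue null).
\<close>

definition fdist :: "real measure \<Rightarrow> (real \<Rightarrow> 'y) \<Rightarrow> (real \<Rightarrow> 'y) \<Rightarrow> real" where
  "fdist P f g = measure (completion P) {x \<in> space P. f x \<noteq> g x}"

definition fdist_class :: "real measure \<Rightarrow> (real \<Rightarrow> 'y) \<Rightarrow> (real \<Rightarrow> 'y) set \<Rightarrow> real" where
  "fdist_class P f \<F> = (INF g\<in>\<F>. fdist P f g)"

text \<open>
  The measurability convention under which the probabilities of the events
  ``some member of \<open>H\<close> agrees with \<open>f\<close> on exactly these sample points'' make sense.
  It holds for countable \<open>H\<close> whenever sets of agreement are measurable. It cannot simply be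
  dropped: take \<open>Y\<close> the reals with the trivial sigma-algebra and \<open>H\<close> the constant functions.
  For every deterministic candidate tester of \<open>H\<close>, transfinite recursion yields a target with finite fibres
  (hence at distance 1 from \<open>H\<close>) that is accepted with outer probability at least 2/3.
\<close>

definition trace_measurable :: "'y measure \<Rightarrow> (real \<Rightarrow> 'y) set \<Rightarrow> bool" where
  "trace_measurable Y H \<longleftrightarrow>
     (\<forall>f \<in> borel \<rightarrow>\<^sub>M Y. \<forall>n::nat. \<forall>I \<subseteq> {..<n}.
        {x \<in> space (\<Pi>\<^sub>M i\<in>{..<n}. lborel). \<exists>h\<in>H. {i \<in> {..<n}. h (x i) = f (x i)} = I}
          \<in> sets (completion (\<Pi>\<^sub>M i\<in>{..<n}. lborel)))"

text \<open>
  An adaptive querying strategy for one fixed sample and one fixed outcome of the internal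
  coins: \<open>Query i c\<close> asks for the label of the \<open>i\<close>-th sample point and continues with
  \<open>c y\<close> on answer \<open>y\<close>.
\<close>

datatype 'y strategy = Accept | Reject | Query nat "'y \<Rightarrow> 'y strategy"

primrec accepts :: "'y strategy \<Rightarrow> (nat \<Rightarrow> 'y) \<Rightarrow> bool" where
  "accepts Accept a = True"
| "accepts Reject a = False"
| "accepts (Query i c) a = accepts (c (a i)) a"

primrec queries :: "'y strategy \<Rightarrow> (nat \<Rightarrow> 'y) \<Rightarrow> nat list" where
  "queries Accept a = []"
| "queries Reject a = []"
| "queries (Query i c) a = i # queries (c (a i)) a"

text \<open>
  \<open>R\<close> is the law of the internal coins, \<open>m\<close> the number of sample points drawn, and
  \<open>A \<omega> x\<close> the strategy followed on coins \<open>\<omega>\<close> and sample \<open>x\<close>. Since nonmeasurable sets have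
  measure 0, the two probability bounds include measurability of the event in question.
\<close>

definition is_tester ::
  "'y measure \<Rightarrow> real measure \<Rightarrow> (real \<Rightarrow> 'y) set \<Rightarrow> real \<Rightarrow> nat \<Rightarrow> nat \<Rightarrow>
   real measure \<Rightarrow> nat \<Rightarrow> (real \<Rightarrow> (nat \<Rightarrow> real) \<Rightarrow> 'y strategy) \<Rightarrow> bool" where
  "is_tester Y P \<F> \<epsilon> s q R m A \<longleftrightarrow>
     prob_space R \<and> m \<le> s \<and>
     (\<forall>\<omega> x a. set (queries (A \<omega> x) a) \<subseteq> {..<m} \<and> length (queries (A \<omega> x) a) \<le> q) \<and>
     (let \<Omega> = R \<Otimes>\<^sub>M (\<Pi>\<^sub>M i\<in>{..<m}. P) in
       \<forall>f \<in> borel \<rightarrow>\<^sub>M Y.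
         (f \<in> \<F> \<longrightarrow>
            measure (completion \<Omega>) {(\<omega>, x) \<in> space \<Omega>. accepts (A \<omega> x) (\<lambda>i. f (x i))} \<ge> 2/3) \<and>
         (fdist_class P f \<F> \<ge> \<epsilon> \<longrightarrow>
            measure (completion \<Omega>) {(\<omega>, x) \<in> space \<Omega>. \<not> accepts (A \<omega> x) (\<lambda>i. f (x i))} \<ge> 2/3))"

end

theory Submission
  imports Defs
begin

text \<open>
  A window of half-width \<open>r\<close> of order \<open>\<epsilon>/k\<close> around a uniform centre meets a breakpoint of a member
  of the piecewise class with probability at most \<open>2r(k-1)\<close>. Conversely, call a centre good if some
  \<open>h\<close> in \<open>H\<close> disagrees with \<open>f\<close> on measure less than \<open>\<rho>\<close>, a small multiple of \<open>\<epsilon>r\<close>, in its window.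
  Two good centres at distance less than \<open>2r - 2\<rho>\<close> share the same \<open>h\<close>, since different members of
  \<open>H\<close> agree only on a null set. Hence each change of \<open>h\<close> along the line costs a gap of length
  \<open>2r - 2\<rho>\<close> without good centres, and if the bad centres had measure below \<open>2r(k-1)\<close> plus a constant
  times \<open>\<epsilon>\<^sup>2\<close>, then \<open>f\<close> would be close to a piecewise function with about \<open>(1 + \<epsilon>/2)k\<close> pieces;
  dropping the shortest ones leaves \<open>k\<close> pieces at distance less than \<open>\<epsilon>\<close>.

  So it suffices to estimate the measure of the bad centres up to order \<open>\<epsilon>\<^sup>2\<close>, which takes order
  \<open>1/\<epsilon>\<^sup>4\<close> windows by Hoeffding's inequality. A window is rejected if no \<open>h\<close> agrees with \<open>f\<close> on all its
  sample points. By the double sample argument for classes of finite VC dimension, a bad window is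
  rejected with high probability once it contains order \<open>d/\<epsilon> ln(1/\<epsilon>)\<close> points.
\<close>

section \<open>Shattering\<close>

lemma card_le_vc_dim: "finite A \<Longrightarrow> shatters \<C> A \<Longrightarrow> enat (card A) \<le> vc_dim \<C>"
  unfolding vc_dim_def by (intro SUP_upper) simp

lemma card_eq_card_projection_plus_fibres:
  assumes "finite F"
  shows "card F = card ((\<lambda>S. S - {a}) ` F) + card {S\<in>F. a \<notin> S \<and> insert a S \<in> F}"
proof -
  define F0 where "F0 = {S\<in>F. a \<notin> S}"
  define F1 where "F1 = (\<lambda>S. S - {a}) ` {S\<in>F. a \<in> S}"
  have F_split: "F = F0 \<union> {S\<in>F. a \<in> S}" by (auto simp: F0_def)
  have finite_parts: "finite F0" "finite F1" using assms by (simp_all add: F0_def F1_def)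
  have "card F = card F0 + card {S\<in>F. a \<in> S}"
    using assms F_split card_Un_disjoint[of F0 "{S\<in>F. a \<in> S}"] finite_parts by (auto simp: F0_def)
  also have "card {S\<in>F. a \<in> S} = card F1"
    unfolding F1_def by (rule card_image[symmetric]) (auto simp: inj_on_def)
  also have "card F0 + card F1 = card (F0 \<union> F1) + card (F0 \<inter> F1)"
    using finite_parts by (rule card_Un_Int)
  also have "F0 \<union> F1 = (\<lambda>S. S - {a}) ` F"
  proof -
    have "F0 = (\<lambda>S. S - {a}) ` F0" by (force simp: F0_def)
    then show ?thesis
      using image_Un[of "\<lambda>S. S - {a}" F0 "{S\<in>F. a \<in> S}"] F_split by (simp add: F1_def)
  qed
  also have "F0 \<inter> F1 = {S\<in>F. a \<notin> S \<and> insert a S \<in> F}"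
  proof -
    have "S \<in> F1 \<longleftrightarrow> insert a S \<in> F" if "a \<notin> S" for S
    proof
      show "S \<in> F1" if "insert a S \<in> F"
        unfolding F1_def using that \<open>a \<notin> S\<close> by (intro image_eqI[of _ _ "insert a S"]) auto
    qed (auto simp: F1_def insert_absorb)
    then show ?thesis by (auto simp: F0_def)
  qed
  finally show ?thesis .
qed

lemma shatters_projectionD:
  assumes "shatters ((\<lambda>S. S - {a}) ` F) A" "a \<notin> A"
  shows "shatters F A"
  unfolding shatters_def
proof (intro allI impI)
  fix B assume "B \<subseteq> A"
  then obtain S where "S \<in> F" "(S - {a}) \<inter> A = B"
    using assms(1) unfolding shatters_def by blast
  then show "\<exists>S\<in>F. S \<inter> A = B" using assms(2) by (intro bexI[of _ S]) auto
qed

lemma shatters_insert: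
  assumes "shatters {S\<in>F. a \<notin> S \<and> insert a S \<in> F} A" "a \<notin> A"
  shows "shatters F (insert a A)"
  unfolding shatters_def
proof (intro allI impI)
  fix B assume B_sub: "B \<subseteq> insert a A"
  then have "B - {a} \<subseteq> A" by auto
  then obtain S where S_fibre: "S \<in> F" "a \<notin> S" "insert a S \<in> F" "S \<inter> A = B - {a}"
    using assms(1) unfolding shatters_def by blast
  show "\<exists>S\<in>F. S \<inter> insert a A = B"
  proof (cases "a \<in> B")
    case True
    then show ?thesis using S_fibre B_sub by (intro bexI[of _ "insert a S"]) auto
  next
    case False
    then show ?thesis using S_fibre B_sub by (intro bexI[of _ S]) auto
  qed
qed

lemma card_le_card_shattered:
  assumes "finite X" "F \<subseteq> Pow X"
  shows "card F \<le> card {A. A \<subseteq> X \<and> shatters F A}"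
  using assms
proof (induction X arbitrary: F rule: finite_induct)
  case empty
  then consider "F = {}" | "F = {{}}" by auto
  then show ?case
  proof cases
    case 2
    then have "{A. A \<subseteq> {} \<and> shatters F A} = {{}}" by (auto simp: shatters_def)
    then show ?thesis using 2 by simp
  qed simp
next
  case (insert a X)
  define G where "G = (\<lambda>S. S - {a}) ` F"
  define G' where "G' = {S\<in>F. a \<notin> S \<and> insert a S \<in> F}"
  define \<A> where "\<A> = {A. A \<subseteq> X \<and> shatters G A}"
  define \<A>' where "\<A>' = {A. A \<subseteq> X \<and> shatters G' A}"
  have finite_families: "finite F" "finite \<A>" "finite \<A>'"
    using insert.prems insert.hyps(1) finite_subset[of F] by (auto simp: \<A>_def \<A>'_def)
  have "card F = card G + card G'"
    unfolding G_def G'_def by (rule card_eq_card_projection_plus_fibres[OF finite_families(1)])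
  also have "\<dots> \<le> card \<A> + card \<A>'"
    unfolding \<A>_def \<A>'_def using insert.prems
    by (intro add_mono insert.IH) (auto simp: G_def G'_def)
  also have "card \<A>' = card (insert a ` \<A>')"
    using insert.hyps(2) by (intro card_image[symmetric]) (auto simp: inj_on_def \<A>'_def)
  also have "card \<A> + card (insert a ` \<A>') = card (\<A> \<union> insert a ` \<A>')"
    using insert.hyps(2) finite_families by (intro card_Un_disjoint[symmetric]) (auto simp: \<A>_def)
  also have "\<dots> \<le> card {A. A \<subseteq> insert a X \<and> shatters F A}"
    using insert.hyps shatters_projectionD[of a F] shatters_insert[of F a]
    by (intro card_mono) (auto simp: \<A>_def \<A>'_def G_def G'_def)
  finally show ?case .
qed

definition traces :: "'a set set \<Rightarrow> 'i set \<Rightarrow> ('i \<Rightarrow> 'a) \<Rightarrow> 'i set set" where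
  "traces \<C> I x = (\<lambda>C. {i\<in>I. x i \<in> C}) ` \<C>"

lemma traces_subset_Pow: "traces \<C> I x \<subseteq> Pow I"
  by (auto simp: traces_def)

lemma empty_in_traces_iff: "{} \<in> traces \<C> I x \<longleftrightarrow> (\<exists>C\<in>\<C>. \<forall>i\<in>I. x i \<notin> C)"
  by (auto simp: traces_def image_iff)

lemma card_le_vc_dim_of_shatters_traces:
  assumes "finite A" "A \<subseteq> I" and traces_shatter: "shatters (traces \<C> I x) A"
  shows "enat (card A) \<le> vc_dim \<C>"
proof -
  have ex_cut: "\<exists>C\<in>\<C>. \<forall>i\<in>A. x i \<in> C \<longleftrightarrow> i \<in> B" if B_sub: "B \<subseteq> A" for B
  proof -
    obtain Z where Z_trace: "Z \<in> traces \<C> I x" "Z \<inter> A = B"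
      using traces_shatter B_sub unfolding shatters_def by blast
    then obtain C where C_member: "C \<in> \<C>" "Z = {i\<in>I. x i \<in> C}" unfolding traces_def by blast
    then have "\<forall>i\<in>A. x i \<in> C \<longleftrightarrow> i \<in> B" using Z_trace(2) assms(2) by blast
    then show ?thesis using C_member(1) by blast
  qed
  have inj_x: "inj_on x A"
  proof (rule inj_onI)
    fix i j assume ij_same: "i \<in> A" "j \<in> A" "x i = x j"
    then obtain C where "\<forall>l\<in>A. x l \<in> C \<longleftrightarrow> l \<in> {i}" using ex_cut[of "{i}"] by auto
    then show "i = j" using ij_same by (metis singletonD singletonI)
  qed
  have "shatters \<C> (x ` A)"
    unfolding shatters_def
  proof (intro allI impI)
    fix B assume "B \<subseteq> x ` A"
    moreover obtain C where "C \<in> \<C>" "\<forall>i\<in>A. x i \<in> C \<longleftrightarrow> i \<in> {i\<in>A. x i \<in> B}"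
      using ex_cut[of "{i\<in>A. x i \<in> B}"] by auto
    ultimately show "\<exists>C\<in>\<C>. C \<inter> x ` A = B" by (intro bexI[of _ C]) auto
  qed
  then show ?thesis using card_le_vc_dim[of "x ` A" \<C>] assms(1) card_image[OF inj_x] by simp
qed

lemma card_traces_le:
  assumes "finite I" and vc_dim_le: "vc_dim \<C> \<le> enat d" and members_sub_J: "\<Union>\<C> \<subseteq> J"
  shows "card (traces \<C> I x) \<le> card {A. A \<subseteq> {i\<in>I. x i \<in> J} \<and> card A \<le> d}"
proof -
  let ?W = "{i\<in>I. x i \<in> J}"
  have finite_W: "finite ?W" using assms(1) by simp
  have "card (traces \<C> I x) \<le> card {A. A \<subseteq> ?W \<and> shatters (traces \<C> I x) A}"
    using members_sub_J by (intro card_le_card_shattered[OF finite_W]) (auto simp: traces_def)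
  also have "\<dots> \<le> card {A. A \<subseteq> ?W \<and> card A \<le> d}"
  proof (intro card_mono Collect_mono impI)
    fix A assume A_shattered: "A \<subseteq> ?W \<and> shatters (traces \<C> I x) A"
    then have "finite A" "A \<subseteq> I" using finite_subset[OF _ finite_W] by auto
    then have "enat (card A) \<le> vc_dim \<C>"
      using A_shattered by (intro card_le_vc_dim_of_shatters_traces) auto
    then have "enat (card A) \<le> enat d" using vc_dim_le by (rule order_trans)
    then show "A \<subseteq> ?W \<and> card A \<le> d" using A_shattered by simp
  qed (use finite_W in simp)
  finally show ?thesis .
qed

lemma sum_choose_power_le:
  fixes p :: real
  assumes d_bounds: "0 < d" "real d \<le> real n * p"
  shows "(\<Sum>i\<le>d. real (n choose i) * p ^ i) \<le> (exp 1 * (real n * p) / real d) ^ d"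
proof -
  define t where "t = real d / (real n * p)"
  have mean_pos: "0 < real n * p" using d_bounds by linarith
  then have p_pos: "0 < p" using zero_less_mult_pos by fastforce
  have t_bounds: "0 < t" "t \<le> 1" using d_bounds mean_pos by (auto simp: t_def)
  have "t ^ d * (\<Sum>i\<le>d. real (n choose i) * p ^ i) = (\<Sum>i\<le>d. real (n choose i) * (p ^ i * t ^ d))"
    by (simp add: sum_distrib_left ac_simps)
  also have "\<dots> \<le> (\<Sum>i\<le>d. real (n choose i) * (p * t) ^ i)"
    using t_bounds p_pos
    by (intro sum_mono mult_left_mono) (auto simp: power_mult_distrib intro!: power_decreasing)
  also have "\<dots> \<le> (\<Sum>i\<le>max d n. real (n choose i) * (p * t) ^ i)"
    using t_bounds p_pos by (intro sum_mono2) auto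
  also have "\<dots> = (\<Sum>i\<le>n. real (n choose i) * (p * t) ^ i)"
    by (rule sum.mono_neutral_right) auto
  also have "\<dots> = (1 + p * t) ^ n"
    using binomial_ring[of "p * t" 1 n] by (simp add: add.commute)
  also have "\<dots> \<le> exp (p * t) ^ n"
    using t_bounds p_pos by (intro power_mono exp_ge_add_one_self) auto
  also have "\<dots> = exp 1 ^ d" using mean_pos p_pos by (auto simp: exp_of_nat_mult[symmetric] t_def)
  finally have "(\<Sum>i\<le>d. real (n choose i) * p ^ i) \<le> exp 1 ^ d / t ^ d"
    using t_bounds by (simp add: field_simps)
  then show ?thesis by (simp add: t_def power_divide power_mult_distrib)
qed

section \<open>Exchanging a sample with a ghost sample\<close>

definition swap_halves :: "nat \<Rightarrow> nat set \<Rightarrow> nat \<Rightarrow> nat" where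
  "swap_halves n \<sigma> i = (if i < n then if i \<in> \<sigma> then i + n else i
     else if i < 2 * n \<and> i - n \<in> \<sigma> then i - n else i)"

lemma swap_halves_swap_halves [simp]: "swap_halves n \<sigma> (swap_halves n \<sigma> i) = i"
  by (auto simp: swap_halves_def)

lemma swap_halves_less_iff [simp]: "swap_halves n \<sigma> i < 2 * n \<longleftrightarrow> i < 2 * n"
  by (auto simp: swap_halves_def)

lemma inj_on_swap_halves: "inj_on (swap_halves n \<sigma>) A"
  by (rule inj_on_inverseI[where g = "swap_halves n \<sigma>"]) simp

definition swap_sample :: "nat \<Rightarrow> nat set \<Rightarrow> (nat \<Rightarrow> 'a) \<Rightarrow> nat \<Rightarrow> 'a" where
  "swap_sample n \<sigma> = (\<lambda>x. \<lambda>i\<in>{..<2*n}. x (swap_halves n \<sigma> i))"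

lemma card_subsets_with_prescribed_Int_le:
  assumes "finite A" "B \<subseteq> A"
  shows "card {\<sigma>. \<sigma> \<subseteq> A \<and> \<sigma> \<inter> B = C} \<le> 2 ^ (card A - card B)"
proof -
  have "card {\<sigma>. \<sigma> \<subseteq> A \<and> \<sigma> \<inter> B = C} \<le> card (Pow (A - B))"
    using assms(1) by (intro card_inj_on_le[where f = "\<lambda>\<sigma>. \<sigma> - B"]) (auto simp: inj_on_def)
  also have "\<dots> = 2 ^ (card A - card B)"
    using assms finite_subset[OF assms(2,1)] by (simp add: card_Pow card_Diff_subset)
  finally show ?thesis .
qed

lemma card_le_card_halves:
  fixes n :: nat
  assumes "D \<subseteq> {..<2*n}"
  shows "card D \<le> card {i. i < n \<and> i \<in> D} + card {i. i < n \<and> i + n \<in> D}"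
proof -
  let ?D1 = "{i. i < n \<and> i \<in> D}" and ?D2 = "{i. i < n \<and> i + n \<in> D}"
  have "D \<subseteq> ?D1 \<union> (\<lambda>i. i + n) ` ?D2"
  proof
    fix i assume "i \<in> D"
    then have "i \<in> ?D1 \<or> i - n \<in> ?D2 \<and> i = (i - n) + n" using assms by auto
    then show "i \<in> ?D1 \<union> (\<lambda>i. i + n) ` ?D2" by blast
  qed
  then have "card D \<le> card (?D1 \<union> (\<lambda>i. i + n) ` ?D2)" by (intro card_mono) auto
  also have "\<dots> \<le> card ?D1 + card ((\<lambda>i. i + n) ` ?D2)" by (rule card_Un_le)
  also have "\<dots> \<le> card ?D1 + card ?D2" by (intro add_left_mono card_image_le) simp
  finally show ?thesis .
qed

lemma card_swaps_clearing_first_half_le: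
  assumes D_props: "D \<subseteq> {..<2*n}" "b \<le> card D"
  shows "card {\<sigma>. \<sigma> \<subseteq> {..<n} \<and> (\<forall>i<n. swap_halves n \<sigma> i \<notin> D)} * 2 ^ b \<le> 2 ^ n"
proof -
  define D1 where "D1 = {i. i < n \<and> i \<in> D}"
  define D2 where "D2 = {i. i < n \<and> i + n \<in> D}"
  let ?S = "{\<sigma>. \<sigma> \<subseteq> {..<n} \<and> (\<forall>i<n. swap_halves n \<sigma> i \<notin> D)}"
  have finite_halves: "finite D1" "finite D2" by (auto simp: D1_def D2_def)
  have halves_sub: "D1 \<union> D2 \<subseteq> {..<n}" by (auto simp: D1_def D2_def)
  have forced: "\<sigma> \<inter> (D1 \<union> D2) = D1 \<and> D1 \<inter> D2 = {}" if "\<sigma> \<in> ?S" for \<sigma>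
  proof -
    have "i \<in> D1 \<Longrightarrow> i \<in> \<sigma>" "i \<in> D2 \<Longrightarrow> i \<notin> \<sigma>" for i
      using that by (auto simp: D1_def D2_def swap_halves_def split: if_splits)
    then show ?thesis by blast
  qed
  show ?thesis
  proof (cases "?S = {}")
    case True
    then show ?thesis by (simp only: card.empty)
  next
    case False
    then have halves_disjoint: "D1 \<inter> D2 = {}" using forced by blast
    have "card D \<le> card D1 + card D2"
      unfolding D1_def D2_def by (rule card_le_card_halves[OF D_props(1)])
    also have "\<dots> = card (D1 \<union> D2)"
      using finite_halves halves_disjoint by (simp add: card_Un_disjoint)
    finally have "b \<le> card (D1 \<union> D2)" using D_props(2) by simp
    have "card ?S \<le> card {\<sigma>. \<sigma> \<subseteq> {..<n} \<and> \<sigma> \<inter> (D1 \<union> D2) = D1}"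
      using forced by (intro card_mono) auto
    also have "\<dots> \<le> 2 ^ (n - card (D1 \<union> D2))"
      using card_subsets_with_prescribed_Int_le[OF _ halves_sub] by simp
    finally have "card ?S * 2 ^ b \<le> 2 ^ (n - card (D1 \<union> D2)) * 2 ^ card (D1 \<union> D2)"
      using \<open>b \<le> card (D1 \<union> D2)\<close> by (intro mult_mono power_increasing) auto
    also have "\<dots> = 2 ^ n" using card_mono[OF _ halves_sub] by (simp add: power_add[symmetric])
    finally show ?thesis .
  qed
qed

section \<open>Completed measures\<close>

lemma
  assumes T_measurable: "T \<in> N \<rightarrow>\<^sub>M M" and T_distr: "distr N M T = M"
  shows measurable_completion_distr: "T \<in> completion N \<rightarrow>\<^sub>M completion M"
    and distr_completion_completion: "distr (completion N) (completion M) T = completion M"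
proof -
  have T_measurable_completion: "T \<in> completion N \<rightarrow>\<^sub>M M"
    using T_measurable by (rule measurable_completion)
  have T_distr_completion: "distr (completion N) M T = M"
    using T_measurable T_distr by (simp add: distr_completion)
  show "T \<in> completion N \<rightarrow>\<^sub>M completion M"
    using T_measurable_completion
    by (rule completion.measurable_completion2) (simp add: T_distr_completion)
  show "distr (completion N) (completion M) T = completion M"
    using completion.completion_distr_eq[OF T_measurable_completion]
    by (simp add: T_distr_completion)
qed

lemma measure_completion_vimage:
  assumes "T \<in> N \<rightarrow>\<^sub>M M" "distr N M T = M" "E \<in> sets (completion M)"
  shows "measure (completion N) (T -` E \<inter> space N) = measure (completion M) E"
  using measure_distr[OF measurable_completion_distr[OF assms(1,2)] assms(3)]
  by (simp add: distr_completion_completion[OF assms(1,2)])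

lemma sets_completion_vimage:
  assumes "T \<in> N \<rightarrow>\<^sub>M M" "distr N M T = M" "E \<in> sets (completion M)"
  shows "T -` E \<inter> space N \<in> sets (completion N)"
  using measurable_sets[OF measurable_completion_distr[OF assms(1,2)] assms(3)] by simp

lemma
  assumes "sets N = sets M" "absolutely_continuous M N"
  shows sets_completion_absolutely_continuous: "sets (completion M) \<subseteq> sets (completion N)"
    and absolutely_continuous_completion: "absolutely_continuous (completion M) (completion N)"
proof -
  have null_sets_subset: "null_sets M \<subseteq> null_sets N"
    using assms(2) by (simp add: absolutely_continuous_def)
  show "sets (completion M) \<subseteq> sets (completion N)"
  proof
    fix A assume "A \<in> sets (completion M)"
    then obtain S Z Z' where A_split: "A = S \<union> Z" "Z \<subseteq> Z'" and "Z' \<in> null_sets M" "S \<in> sets M"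
      by (rule sets_completionE)
    then have "Z' \<in> null_sets N" "S \<in> sets N" using null_sets_subset assms(1) by auto
    then show "A \<in> sets (completion N)" by (rule sets_completionI[OF A_split])
  qed
  show "absolutely_continuous (completion M) (completion N)"
    unfolding absolutely_continuous_def null_sets_completion_iff2 subset_iff using null_sets_subset
    by blast
qed

lemma (in pair_sigma_finite) AE_section_completion:
  assumes E_sets: "E \<in> sets (completion (M1 \<Otimes>\<^sub>M M2))"
  shows "AE x in M1. Pair x -` E \<in> sets (completion M2) \<and>
    emeasure (completion M2) (Pair x -` E) = emeasure M2 (Pair x -` main_part (M1 \<Otimes>\<^sub>M M2) E)"
proof -
  let ?A = "main_part (M1 \<Otimes>\<^sub>M M2) E"
  have A_sets: "?A \<in> sets (M1 \<Otimes>\<^sub>M M2)" using E_sets by simp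
  have "AE x in M1. AE y in M2. (x, y) \<in> ?A \<longleftrightarrow> (x, y) \<in> E"
    by (rule AE_pair[OF AE_in_main_part[OF E_sets]])
  then show ?thesis
  proof eventually_elim
    case (elim x)
    have section_A_sets: "Pair x -` ?A \<in> sets (completion M2)"
      using A_sets by (simp add: sets_Pair1)
    have AE_section_eq: "AE y in completion M2. y \<in> Pair x -` ?A \<longleftrightarrow> y \<in> Pair x -` E"
      using elim by (intro AE_completion) simp
    have "Pair x -` E \<subseteq> space (completion M2)"
      using sets.sets_into_space[OF E_sets] by (auto simp: space_pair_measure)
    with AE_section_eq section_A_sets have section_E_sets: "Pair x -` E \<in> sets (completion M2)"
      by (rule completion.in_sets_AE)
    have "emeasure (completion M2) (Pair x -` E) = emeasure (completion M2) (Pair x -` ?A)"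
      using AE_section_eq section_A_sets section_E_sets by (intro emeasure_eq_AE) auto
    also have "\<dots> = emeasure M2 (Pair x -` ?A)" using A_sets by (simp add: sets_Pair1)
    finally show ?case using section_E_sets by simp
  qed
qed

lemma (in pair_sigma_finite) emeasure_completion_pair_measure:
  assumes E_sets: "E \<in> sets (completion (M1 \<Otimes>\<^sub>M M2))"
  shows "emeasure (completion (M1 \<Otimes>\<^sub>M M2)) E = (\<integral>\<^sup>+x. emeasure (completion M2) (Pair x -` E) \<partial>M1)"
proof -
  have "emeasure (completion (M1 \<Otimes>\<^sub>M M2)) E = emeasure (M1 \<Otimes>\<^sub>M M2) (main_part (M1 \<Otimes>\<^sub>M M2) E)"
    using E_sets by simp
  also have "\<dots> = (\<integral>\<^sup>+x. emeasure M2 (Pair x -` main_part (M1 \<Otimes>\<^sub>M M2) E) \<partial>M1)"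
    using E_sets by (intro M2.emeasure_pair_measure_alt) simp
  also have "\<dots> = (\<integral>\<^sup>+x. emeasure (completion M2) (Pair x -` E) \<partial>M1)"
    using AE_section_completion[OF E_sets]
    by (intro nn_integral_cong_AE) (auto elim: eventually_mono)
  finally show ?thesis .
qed

lemma (in pair_prob_space) measure_completion_pair_le:
  assumes E_sets: "E \<in> sets (completion (M1 \<Otimes>\<^sub>M M2))" and "0 \<le> \<tau>"
    and sections_le: "\<And>x. x \<in> space M1 \<Longrightarrow> measure (completion M2) (Pair x -` E) \<le> \<tau>"
  shows "measure (completion (M1 \<Otimes>\<^sub>M M2)) E \<le> \<tau>"
proof -
  interpret C2: prob_space "completion M2" by (rule M2.prob_space_completion)
  interpret C: prob_space "completion (M1 \<Otimes>\<^sub>M M2)" by (rule prob_space_completion)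
  have "emeasure (completion (M1 \<Otimes>\<^sub>M M2)) E = (\<integral>\<^sup>+x. emeasure (completion M2) (Pair x -` E) \<partial>M1)"
    by (rule emeasure_completion_pair_measure[OF E_sets])
  also have "\<dots> \<le> (\<integral>\<^sup>+x. ennreal \<tau> \<partial>M1)"
    unfolding C2.emeasure_eq_measure by (intro nn_integral_mono ennreal_leI sections_le)
  also have "\<dots> = ennreal \<tau>" by (simp add: M1.emeasure_space_1)
  finally show ?thesis using \<open>0 \<le> \<tau>\<close> by (simp only: C.emeasure_eq_measure ennreal_le_iff)
qed

lemma (in pair_prob_space) measure_completion_pair_ge:
  assumes E_sets: "E \<in> sets (completion (M1 \<Otimes>\<^sub>M M2))" and U_sets: "U \<in> sets (completion M1)"
    and "0 \<le> \<tau>"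
    and sections_ge: "\<And>x. x \<in> U \<Longrightarrow> Pair x -` E \<in> sets (completion M2) \<Longrightarrow>
      \<tau> \<le> measure (completion M2) (Pair x -` E)"
  shows "\<tau> * measure (completion M1) U \<le> measure (completion (M1 \<Otimes>\<^sub>M M2)) E"
proof -
  interpret C1: prob_space "completion M1" by (rule M1.prob_space_completion)
  interpret C2: prob_space "completion M2" by (rule M2.prob_space_completion)
  interpret C: prob_space "completion (M1 \<Otimes>\<^sub>M M2)" by (rule prob_space_completion)
  have "ennreal (\<tau> * measure (completion M1) U) = (\<integral>\<^sup>+x. ennreal \<tau> * indicator U x \<partial>completion M1)"
    using \<open>0 \<le> \<tau>\<close>
    by (subst nn_integral_cmult_indicator[OF U_sets])
       (simp only: C1.emeasure_eq_measure ennreal_mult measure_nonneg)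
  also have "\<dots> = (\<integral>\<^sup>+x. ennreal \<tau> * indicator U x \<partial>M1)" by (rule nn_integral_completion)
  also have "\<dots> \<le> (\<integral>\<^sup>+x. emeasure (completion M2) (Pair x -` E) \<partial>M1)"
  proof (rule nn_integral_mono_AE)
    show "AE x in M1. ennreal \<tau> * indicator U x \<le> emeasure (completion M2) (Pair x -` E)"
      using AE_section_completion[OF E_sets]
    proof eventually_elim
      case (elim x)
      show ?case
      proof (cases "x \<in> U")
        case True
        then show ?thesis
          unfolding C2.emeasure_eq_measure using sections_ge elim
          by (simp only: indicator_simps mult_1_right ennreal_leI)
      qed simp
    qed
  qed
  also have "\<dots> = emeasure (completion (M1 \<Otimes>\<^sub>M M2)) E"
    by (rule emeasure_completion_pair_measure[OF E_sets, symmetric])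
  finally show ?thesis by (simp only: C.emeasure_eq_measure ennreal_le_iff measure_nonneg)
qed

lemma PiM_density:
  assumes finite_I: "finite I" and sigma_finite_M: "\<And>i. sigma_finite_measure (M i)"
    and sigma_finite_density: "\<And>i. sigma_finite_measure (density (M i) (f i))"
    and f_measurable[measurable]: "\<And>i. f i \<in> borel_measurable (M i)"
  shows "Pi\<^sub>M I (\<lambda>i. density (M i) (f i)) = density (Pi\<^sub>M I M) (\<lambda>x. \<Prod>i\<in>I. f i (x i))"
proof -
  interpret M: product_sigma_finite M using sigma_finite_M by (simp add: product_sigma_finite_def)
  interpret D: product_sigma_finite "\<lambda>i. density (M i) (f i)"
    using sigma_finite_density by (simp add: product_sigma_finite_def)
  have prod_measurable: "(\<lambda>x. \<Prod>i\<in>I. f i (x i)) \<in> borel_measurable (Pi\<^sub>M I M)" by measurable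
  show ?thesis
  proof (rule D.PiM_eqI[symmetric, OF finite_I])
    show "sets (density (Pi\<^sub>M I M) (\<lambda>x. \<Prod>i\<in>I. f i (x i))) = sets (Pi\<^sub>M I (\<lambda>i. density (M i) (f i)))"
      by (auto intro!: sets_PiM_cong)
    fix A assume "\<And>i. i \<in> I \<Longrightarrow> A i \<in> sets (density (M i) (f i))"
    then have A_sets: "\<And>i. i \<in> I \<Longrightarrow> A i \<in> sets (M i)" by simp
    have box_sets: "Pi\<^sub>E I A \<in> sets (Pi\<^sub>M I M)" using finite_I A_sets by (rule sets_PiM_I_finite)
    have "emeasure (density (Pi\<^sub>M I M) (\<lambda>x. \<Prod>i\<in>I. f i (x i))) (Pi\<^sub>E I A)
        = (\<integral>\<^sup>+x. (\<Prod>i\<in>I. f i (x i)) * indicator (Pi\<^sub>E I A) x \<partial>Pi\<^sub>M I M)"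
      using prod_measurable box_sets by (rule emeasure_density)
    also have "\<dots> = (\<integral>\<^sup>+x. (\<Prod>i\<in>I. f i (x i) * indicator (A i) (x i)) \<partial>Pi\<^sub>M I M)"
    proof (rule nn_integral_cong)
      fix x assume "x \<in> space (Pi\<^sub>M I M)"
      then have "indicator (Pi\<^sub>E I A) x = (\<Prod>i\<in>I. indicator (A i) (x i) :: ennreal)"
        using finite_I by (auto simp: indicator_def PiE_iff space_PiM)
      then show "(\<Prod>i\<in>I. f i (x i)) * indicator (Pi\<^sub>E I A) x = (\<Prod>i\<in>I. f i (x i) * indicator (A i) (x i))"
        by (simp add: prod.distrib)
    qed
    also have "\<dots> = (\<Prod>i\<in>I. \<integral>\<^sup>+x. f i x * indicator (A i) x \<partial>M i)"
      using A_sets by (intro M.product_nn_integral_prod[OF finite_I]) auto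
    also have "\<dots> = (\<Prod>i\<in>I. emeasure (density (M i) (f i)) (A i))"
      using A_sets by (intro prod.cong refl emeasure_density[symmetric]) auto
    finally show "emeasure (density (Pi\<^sub>M I M) (\<lambda>x. \<Prod>i\<in>I. f i (x i))) (Pi\<^sub>E I A)
        = (\<Prod>i\<in>I. emeasure (density (M i) (f i)) (A i))" .
  qed
qed

section \<open>Independent samples\<close>

abbreviation sample :: "'a measure \<Rightarrow> nat \<Rightarrow> (nat \<Rightarrow> 'a) measure" where
  "sample M n \<equiv> \<Pi>\<^sub>M i\<in>{..<n}. M"

lemma (in prob_space) prob_card_gt_le:
  fixes q :: nat
  assumes finite_F: "finite F" and A_events[measurable]: "\<And>m. m \<in> F \<Longrightarrow> A m \<in> events"
    and A_prob: "\<And>m. m \<in> F \<Longrightarrow> prob (A m) \<le> p" and q_pos: "0 < q"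
  shows "prob {x \<in> space M. q < card {m\<in>F. x \<in> A m}} \<le> real (card F) * p / real q"
proof -
  have card_eq_sum: "real (card {m\<in>F. x \<in> A m}) = (\<Sum>m\<in>F. indicator (A m) x)" for x
    using finite_F by (simp add: indicator_def of_bool_def[symmetric] Int_def)
  have integrable_sum: "integrable M (\<lambda>x. \<Sum>m\<in>F. indicator (A m) x :: real)"
    by (intro Bochner_Integration.integrable_sum integrable_real_indicator)
       (auto simp: emeasure_eq_measure)
  have "prob {x \<in> space M. q < card {m\<in>F. x \<in> A m}}
      \<le> prob {x \<in> space M. real q \<le> (\<Sum>m\<in>F. indicator (A m) x)}"
  proof (rule finite_measure_mono)
    show "{x \<in> space M. real q \<le> (\<Sum>m\<in>F. indicator (A m) x)} \<in> events"
      using borel_measurable_integrable[OF integrable_sum] by measurable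
  qed (auto simp flip: card_eq_sum)
  also have "\<dots> \<le> expectation (\<lambda>x. \<Sum>m\<in>F. indicator (A m) x) / real q"
    using q_pos integrable_sum
    by (intro integral_Markov_inequality_measure[where A = "{}"]) (auto intro!: AE_I2 sum_nonneg)
  also have "expectation (\<lambda>x. \<Sum>m\<in>F. indicator (A m) x) = (\<Sum>m\<in>F. prob (A m))"
    by (subst Bochner_Integration.integral_sum)
       (auto simp: emeasure_eq_measure sets.Int_space_eq2 intro!: integrable_real_indicator)
  also have "\<dots> \<le> real (card F) * p" using sum_bounded_above[of F "\<lambda>m. prob (A m)" p] A_prob by simp
  finally show ?thesis using q_pos by (simp add: divide_right_mono)
qed

lemma of_bool_card_less_le_prod:
  assumes "finite I"
  shows "of_bool (card {i\<in>I. x i \<in> A} < b) \<le> 2 ^ b * (\<Prod>i\<in>I. 1 - indicator A (x i) / 2 :: real)"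
proof -
  have "(\<Prod>i\<in>I. 1 - indicator A (x i) / 2 :: real) = (\<Prod>i\<in>I. if x i \<in> A then 1 / 2 else 1)"
    by (intro prod.cong refl) auto
  then have prod_eq: "(\<Prod>i\<in>I. 1 - indicator A (x i) / 2 :: real) = (1 / 2) ^ card {i\<in>I. x i \<in> A}"
    using assms by (simp add: prod.If_cases Int_def)
  have "(1 / 2 :: real) ^ b \<le> (1 / 2) ^ card {i\<in>I. x i \<in> A}" if "card {i\<in>I. x i \<in> A} < b"
    using that by (intro power_decreasing) auto
  then show ?thesis unfolding prod_eq by (auto simp: power_divide field_simps)
qed

context prob_space
begin

lemma prob_space_iid: "prob_space (\<Pi>\<^sub>M i\<in>I. M)"
  by (intro prob_space_PiM prob_space_axioms)

lemma prob_space_completion_iid: "prob_space (completion (\<Pi>\<^sub>M i\<in>I. M))"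
  by (rule prob_space.prob_space_completion[OF prob_space_iid])

lemma measurable_reindex:
  assumes "t ` I \<subseteq> K"
  shows "(\<lambda>x. \<lambda>i\<in>I. x (t i)) \<in> (\<Pi>\<^sub>M i\<in>K. M) \<rightarrow>\<^sub>M (\<Pi>\<^sub>M i\<in>I. M)"
  using assms by (intro measurable_restrict measurable_component_singleton) auto

lemma distr_reindex:
  assumes "inj_on t I" "t ` I \<subseteq> K"
  shows "distr (\<Pi>\<^sub>M i\<in>K. M) (\<Pi>\<^sub>M i\<in>I. M) (\<lambda>x. \<lambda>i\<in>I. x (t i)) = (\<Pi>\<^sub>M i\<in>I. M)"
  using assms by (intro distr_PiM_reindex prob_space_axioms) auto

lemma measurable_swap_sample: "swap_sample n \<sigma> \<in> sample M (2*n) \<rightarrow>\<^sub>M sample M (2*n)"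
  unfolding swap_sample_def by (intro measurable_reindex) auto

lemma distr_swap_sample: "distr (sample M (2*n)) (sample M (2*n)) (swap_sample n \<sigma>) = sample M (2*n)"
  unfolding swap_sample_def by (intro distr_reindex inj_on_swap_halves) auto

lemma distr_component: "i \<in> I \<Longrightarrow> distr (\<Pi>\<^sub>M i\<in>I. M) M (\<lambda>x. x i) = M"
  by (intro distr_PiM_component prob_space_axioms)

lemma
  assumes "E \<in> sets (completion M)" "i \<in> I"
  shows measure_completion_component:
      "measure (completion (\<Pi>\<^sub>M i\<in>I. M)) {x \<in> space (\<Pi>\<^sub>M i\<in>I. M). x i \<in> E} = measure (completion M) E"
    and sets_completion_component:
      "{x \<in> space (\<Pi>\<^sub>M i\<in>I. M). x i \<in> E} \<in> sets (completion (\<Pi>\<^sub>M i\<in>I. M))"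
proof -
  have component_measurable: "(\<lambda>x. x i) \<in> (\<Pi>\<^sub>M i\<in>I. M) \<rightarrow>\<^sub>M M"
    using assms(2) by (rule measurable_component_singleton)
  have "{x \<in> space (\<Pi>\<^sub>M i\<in>I. M). x i \<in> E} = (\<lambda>x. x i) -` E \<inter> space (\<Pi>\<^sub>M i\<in>I. M)" by auto
  then show "measure (completion (\<Pi>\<^sub>M i\<in>I. M)) {x \<in> space (\<Pi>\<^sub>M i\<in>I. M). x i \<in> E}
      = measure (completion M) E"
    and "{x \<in> space (\<Pi>\<^sub>M i\<in>I. M). x i \<in> E} \<in> sets (completion (\<Pi>\<^sub>M i\<in>I. M))"
    using measure_completion_vimage[OF component_measurable distr_component[OF assms(2)] assms(1)]
      sets_completion_vimage[OF component_measurable distr_component[OF assms(2)] assms(1)] by simp_all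
qed

lemma measure_completion_sample_Suc_le:
  assumes E_sets: "E \<in> sets (completion (sample M (Suc n)))" and bound_nonneg: "0 \<le> \<tau>"
    and sections_le: "\<And>c. c \<in> space M \<Longrightarrow>
      measure (completion (sample M n)) {x \<in> space (sample M n). x(n := c) \<in> E} \<le> \<tau>"
  shows "measure (completion (sample M (Suc n))) E \<le> \<tau>"
proof -
  let ?T = "\<lambda>(c, x::nat \<Rightarrow> 'a). x(n := c)"
  interpret Q: prob_space "sample M n" by (rule prob_space_iid)
  interpret MQ: pair_prob_space M "sample M n" ..
  have T_measurable: "?T \<in> M \<Otimes>\<^sub>M sample M n \<rightarrow>\<^sub>M sample M (Suc n)"
    unfolding lessThan_Suc by measurable
  have T_distr: "distr (M \<Otimes>\<^sub>M sample M n) (sample M (Suc n)) ?T = sample M (Suc n)"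
    unfolding lessThan_Suc by (intro distr_pair_PiM_eq_PiM prob_space_axioms)
  let ?E = "?T -` E \<inter> space (M \<Otimes>\<^sub>M sample M n)"
  have "measure (completion (M \<Otimes>\<^sub>M sample M n)) ?E \<le> \<tau>"
  proof (rule MQ.measure_completion_pair_le[OF _ bound_nonneg])
    show "?E \<in> sets (completion (M \<Otimes>\<^sub>M sample M n))"
      by (rule sets_completion_vimage[OF T_measurable T_distr E_sets])
  next
    fix c assume c_space: "c \<in> space M"
    then have "Pair c -` ?E = {x \<in> space (sample M n). x(n := c) \<in> E}"
      by (auto simp: space_pair_measure)
    then show "measure (completion (sample M n)) (Pair c -` ?E) \<le> \<tau>"
      using sections_le[OF c_space] by simp
  qed
  then show ?thesis by (simp only: measure_completion_vimage[OF T_measurable T_distr E_sets])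
qed

lemma sets_Collect_all_in [measurable]:
  assumes "S \<subseteq> I" "finite S" "A \<in> events"
  shows "{x \<in> space (\<Pi>\<^sub>M i\<in>I. M). \<forall>i\<in>S. x i \<in> A} \<in> sets (\<Pi>\<^sub>M i\<in>I. M)"
proof (rule sets.sets_Collect_finite_All)
  fix i assume "i \<in> S"
  then show "{x \<in> space (\<Pi>\<^sub>M i\<in>I. M). x i \<in> A} \<in> sets (\<Pi>\<^sub>M i\<in>I. M)"
    using assms by (intro sets_Collect_single') auto
qed (rule assms(2))

lemma nn_integral_card_small_subsets:
  assumes finite_I: "finite I" and A_event: "A \<in> events"
  shows "(\<integral>\<^sup>+x. of_nat (card {S. S \<subseteq> {i\<in>I. x i \<in> A} \<and> card S \<le> d}) \<partial>(\<Pi>\<^sub>M i\<in>I. M))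
    = ennreal (\<Sum>i\<le>d. real (card I choose i) * prob A ^ i)"
proof -
  let ?P = "\<Pi>\<^sub>M i\<in>I. M"
  let ?F = "{S. S \<subseteq> I \<and> card S \<le> d}"
  interpret P: product_prob_space "\<lambda>_. M" I by unfold_locales
  define B where "B S = {x \<in> space ?P. \<forall>i\<in>S. x i \<in> A}" for S
  have finite_F: "finite ?F" and finite_members: "S \<in> ?F \<Longrightarrow> finite S" for S
    using finite_I finite_subset by auto
  have B_sets: "B S \<in> sets ?P" if "S \<in> ?F" for S
    unfolding B_def using that finite_members[OF that] A_event by (intro sets_Collect_all_in) auto
  have "(\<integral>\<^sup>+x. of_nat (card {S. S \<subseteq> {i\<in>I. x i \<in> A} \<and> card S \<le> d}) \<partial>?P)
      = (\<integral>\<^sup>+x. (\<Sum>S\<in>?F. indicator (B S) x) \<partial>?P)"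
  proof (rule nn_integral_cong)
    fix x assume x_space: "x \<in> space ?P"
    have "{S. S \<subseteq> {i\<in>I. x i \<in> A} \<and> card S \<le> d} = ?F \<inter> {S. x \<in> B S}"
      using x_space by (auto simp: B_def)
    then show "of_nat (card {S. S \<subseteq> {i\<in>I. x i \<in> A} \<and> card S \<le> d})
        = (\<Sum>S\<in>?F. indicator (B S) x :: ennreal)"
      using finite_F by (simp add: indicator_def of_bool_def[symmetric])
  qed
  also have "\<dots> = (\<Sum>S\<in>?F. emeasure ?P (B S))"
    using B_sets by (subst nn_integral_sum) auto
  also have "\<dots> = (\<Sum>S\<in>?F. ennreal (prob A ^ card S))"
    unfolding B_def using A_event finite_members
    by (intro sum.cong refl) (simp add: P.emeasure_PiM_Collect emeasure_eq_measure ennreal_power)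
  also have "\<dots> = ennreal (\<Sum>S\<in>?F. prob A ^ card S)" by (intro sum_ennreal) auto
  also have "(\<Sum>S\<in>?F. prob A ^ card S) = (\<Sum>i\<le>d. \<Sum>S\<in>{S\<in>?F. card S = i}. prob A ^ card S)"
    using finite_F by (intro sum.group[symmetric]) auto
  also have "\<dots> = (\<Sum>i\<le>d. real (card I choose i) * prob A ^ i)"
  proof (rule sum.cong[OF refl])
    fix i assume "i \<in> {..d}"
    then have "{S\<in>?F. card S = i} = {S. S \<subseteq> I \<and> card S = i}" by auto
    then show "(\<Sum>S\<in>{S\<in>?F. card S = i}. prob A ^ card S) = real (card I choose i) * prob A ^ i"
      using n_subsets[OF finite_I, of i] by simp
  qed
  finally show ?thesis .
qed

lemma sets_Collect_count_ge [measurable]: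
  assumes "finite I" "A \<in> events"
  shows "{x \<in> space (\<Pi>\<^sub>M i\<in>I. M). b \<le> card {i\<in>I. x i \<in> A}} \<in> sets (\<Pi>\<^sub>M i\<in>I. M)"
proof -
  have card_eq_sum: "card {i\<in>I. x i \<in> A} = (\<Sum>i\<in>I. if x i \<in> A then 1 else 0)" for x
    using assms(1) by (simp add: sum.If_cases Int_def)
  show ?thesis unfolding card_eq_sum using assms(2) by measurable
qed

lemma prob_count_less_le:
  assumes finite_I: "finite I" and A_event: "A \<in> events"
  shows "measure (\<Pi>\<^sub>M i\<in>I. M) {x \<in> space (\<Pi>\<^sub>M i\<in>I. M). card {i\<in>I. x i \<in> A} < b}
    \<le> 2 ^ b * exp (- prob A * real (card I) / 2)"
proof -
  let ?P = "\<Pi>\<^sub>M i\<in>I. M"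
  let ?few = "{x \<in> space ?P. card {i\<in>I. x i \<in> A} < b}"
  interpret P: product_sigma_finite "\<lambda>_. M" by unfold_locales
  interpret PP: prob_space ?P by (rule prob_space_iid)
  define \<phi> :: "'a \<Rightarrow> real" where "\<phi> x = 1 - indicator A x / 2" for x
  have "0 \<le> 1 - prob A / 2" using prob_le_1[of A] by linarith
  have integrable_phi: "integrable M \<phi>"
    unfolding \<phi>_def using A_event by (auto simp: emeasure_eq_measure)
  have few_eq: "?few = space ?P - {x \<in> space ?P. b \<le> card {i\<in>I. x i \<in> A}}" by auto
  have few_sets: "?few \<in> sets ?P"
    unfolding few_eq using finite_I A_event by (intro sets.Diff sets_Collect_count_ge) auto
  have integrable_prod: "integrable ?P (\<lambda>x. 2 ^ b * (\<Prod>i\<in>I. \<phi> (x i)))"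
    using finite_I integrable_phi by (intro integrable_mult_right P.product_integrable_prod)
  have "measure ?P ?few = (\<integral>x. indicator ?few x \<partial>?P)" using few_sets by simp
  also have "\<dots> \<le> (\<integral>x. 2 ^ b * (\<Prod>i\<in>I. \<phi> (x i)) \<partial>?P)"
  proof (rule integral_mono[OF _ integrable_prod])
    show "integrable ?P (indicator ?few :: _ \<Rightarrow> real)"
      using few_sets by (simp add: PP.emeasure_eq_measure)
    show "indicator ?few x \<le> 2 ^ b * (\<Prod>i\<in>I. \<phi> (x i))" for x
      unfolding \<phi>_def
      by (rule order_trans[OF _ of_bool_card_less_le_prod[OF finite_I]]) (simp add: indicator_def)
  qed
  also have "\<dots> = 2 ^ b * expectation \<phi> ^ card I"
    using P.product_integral_prod[OF finite_I, of "\<lambda>_. \<phi>"] integrable_phi by simp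
  also have "expectation \<phi> = 1 - prob A / 2"
    using A_event by (simp add: \<phi>_def[abs_def] prob_space emeasure_eq_measure)
  also have "(1 - prob A / 2) ^ card I \<le> exp (- prob A / 2) ^ card I"
    using exp_ge_add_one_self[of "- prob A / 2"] \<open>0 \<le> 1 - prob A / 2\<close> by (intro power_mono) auto
  also have "exp (- prob A / 2) ^ card I = exp (- prob A * real (card I) / 2)"
    by (simp add: exp_of_nat_mult[symmetric] mult.commute)
  finally show ?thesis by simp
qed

end

section \<open>The double sample argument\<close>

definition measurable_traces :: "'a measure \<Rightarrow> 'a set set \<Rightarrow> bool" where
  "measurable_traces M \<C> \<longleftrightarrow>
    (\<forall>n Z. {x \<in> space (sample M n). Z \<in> traces \<C> {..<n} x} \<in> sets (completion (sample M n)))"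

definition unhit_samples :: "'a measure \<Rightarrow> 'a set set \<Rightarrow> nat \<Rightarrow> (nat \<Rightarrow> 'a) set" where
  "unhit_samples M \<C> n = {x \<in> space (sample M n). {} \<in> traces \<C> {..<n} x}"

definition ghost_samples :: "'a measure \<Rightarrow> 'a set set \<Rightarrow> nat \<Rightarrow> nat \<Rightarrow> (nat \<Rightarrow> 'a) set" where
  "ghost_samples M \<C> n b =
    {x \<in> space (sample M (2*n)). \<exists>Z\<in>traces \<C> {..<2*n} x. Z \<inter> {..<n} = {} \<and> b \<le> card Z}"

definition double_sample_bound :: "nat \<Rightarrow> nat \<Rightarrow> nat \<Rightarrow> real \<Rightarrow> real" where
  "double_sample_bound d n b p = 2 * ((\<Sum>i\<le>d. real (2*n choose i) * p ^ i) / 2 ^ b)"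

lemma sets_unhit_samples:
  "measurable_traces M \<C> \<Longrightarrow> unhit_samples M \<C> n \<in> sets (completion (sample M n))"
  by (simp add: measurable_traces_def unhit_samples_def)

lemma sets_ghost_samples:
  assumes "measurable_traces M \<C>"
  shows "ghost_samples M \<C> n b \<in> sets (completion (sample M (2*n)))"
proof -
  have "ghost_samples M \<C> n b = (\<Union>Z\<in>{Z\<in>Pow {..<2*n}. Z \<inter> {..<n} = {} \<and> b \<le> card Z}.
      {x \<in> space (sample M (2*n)). Z \<in> traces \<C> {..<2*n} x})"
    using traces_subset_Pow[of \<C> "{..<2*n}"] by (auto simp: ghost_samples_def)
  also have "\<dots> \<in> sets (completion (sample M (2*n)))"
    using assms by (intro sets.finite_UN) (auto simp: measurable_traces_def)
  finally show ?thesis .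
qed

lemma card_swaps_into_ghost_samples_le:
  "card {\<sigma>\<in>Pow {..<n}. swap_sample n \<sigma> x \<in> ghost_samples M \<C> n b} * 2 ^ b
    \<le> card (traces \<C> {..<2*n} x) * 2 ^ n"
proof -
  let ?S = "{\<sigma>\<in>Pow {..<n}. swap_sample n \<sigma> x \<in> ghost_samples M \<C> n b}"
  let ?clearing = "\<lambda>D. {\<sigma>. \<sigma> \<subseteq> {..<n} \<and> (\<forall>i<n. swap_halves n \<sigma> i \<notin> D)}"
  define \<D> where "\<D> = {D \<in> traces \<C> {..<2*n} x. b \<le> card D}"
  have finite_traces: "finite (traces \<C> {..<2*n} x)"
    by (rule finite_subset[OF traces_subset_Pow]) simp
  have swaps_sub: "?S \<subseteq> (\<Union>D\<in>\<D>. ?clearing D)"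
  proof
    fix \<sigma> assume sigma_swap: "\<sigma> \<in> ?S"
    then obtain C where C_member: "C \<in> \<C>"
      and first_half_clear: "{i\<in>{..<2*n}. x (swap_halves n \<sigma> i) \<in> C} \<inter> {..<n} = {}"
      and many_hits: "b \<le> card {i\<in>{..<2*n}. x (swap_halves n \<sigma> i) \<in> C}"
      by (auto simp: swap_sample_def ghost_samples_def traces_def cong: conj_cong)
    define D where "D = {i\<in>{..<2*n}. x i \<in> C}"
    have "swap_halves n \<sigma> ` D = {i\<in>{..<2*n}. x (swap_halves n \<sigma> i) \<in> C}"
      by (auto simp: D_def intro!: image_eqI[of _ _ "swap_halves n \<sigma> _"])
    then have "b \<le> card D" using many_hits card_image[OF inj_on_swap_halves, of n \<sigma> D] by simp
    then have "D \<in> \<D>" using C_member by (auto simp: \<D>_def D_def traces_def)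
    moreover have "swap_halves n \<sigma> i \<notin> D" if "i < n" for i
      using first_half_clear that by (force simp: D_def)
    ultimately show "\<sigma> \<in> (\<Union>D\<in>\<D>. ?clearing D)" using sigma_swap by blast
  qed
  have "finite (?clearing D)" for D by (rule finite_subset[of _ "Pow {..<n}"]) auto
  then have "card ?S \<le> card (\<Union>D\<in>\<D>. ?clearing D)"
    using finite_traces by (intro card_mono swaps_sub) (auto simp: \<D>_def)
  also have "\<dots> \<le> (\<Sum>D\<in>\<D>. card (?clearing D))"
    using finite_traces by (intro card_UN_le) (simp add: \<D>_def)
  finally have "card ?S * 2 ^ b \<le> (\<Sum>D\<in>\<D>. card (?clearing D) * 2 ^ b)"
    by (simp flip: sum_distrib_right)
  also have "\<dots> \<le> (\<Sum>D\<in>\<D>. 2 ^ n)"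
    by (intro sum_mono card_swaps_clearing_first_half_le) (auto simp: \<D>_def traces_def)
  also have "\<dots> \<le> card (traces \<C> {..<2*n} x) * 2 ^ n"
    using finite_traces by (auto simp: \<D>_def intro!: card_mono)
  finally show ?thesis .
qed

lemma card_swaps_into_ghost_samples_le_small_subsets:
  assumes "vc_dim \<C> \<le> enat d" "\<Union>\<C> \<subseteq> J"
  shows "card {\<sigma>\<in>Pow {..<n}. swap_sample n \<sigma> x \<in> ghost_samples M \<C> n b} * 2 ^ b
    \<le> card {S. S \<subseteq> {i\<in>{..<2*n}. x i \<in> J} \<and> card S \<le> d} * 2 ^ n"
  using card_swaps_into_ghost_samples_le
  by (rule order_trans) (intro mult_right_mono card_traces_le assms, simp_all)

lemma double_sample_bound_nonneg: "0 \<le> p \<Longrightarrow> 0 \<le> double_sample_bound d n b p"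
  unfolding double_sample_bound_def
  by (intro mult_nonneg_nonneg divide_nonneg_nonneg sum_nonneg) auto

context prob_space
begin

text \<open>
  Exchanging the \<open>i\<close>-th point of the sample with the \<open>i\<close>-th point of the ghost sample preserves the
  law, and a fixed trace of at least \<open>b\<close> points is moved out of the first half by at most a fraction
  \<open>2^-b\<close> of all exchanges.
\<close>

lemma measure_ghost_samples_le:
  assumes traces_measurable: "measurable_traces M \<C>" and vc_dim_le: "vc_dim \<C> \<le> enat d"
    and J_props: "\<Union>\<C> \<subseteq> J" "J \<in> events"
  shows "measure (completion (sample M (2*n))) (ghost_samples M \<C> n b)
    \<le> (\<Sum>i\<le>d. real (2*n choose i) * prob J ^ i) / 2 ^ b"
proof -
  let ?Q = "completion (sample M (2*n))" and ?E = "ghost_samples M \<C> n b"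
  let ?small = "\<lambda>x. {S. S \<subseteq> {i\<in>{..<2*n}. x i \<in> J} \<and> card S \<le> d}"
  let ?\<Phi> = "\<Sum>i\<le>d. real (2*n choose i) * prob J ^ i"
  define E where "E \<sigma> = swap_sample n \<sigma> -` ?E \<inter> space (sample M (2*n))" for \<sigma>
  interpret Q: prob_space ?Q by (rule prob_space_completion_iid)
  have E_swapped: "E \<sigma> \<in> sets ?Q" "measure ?Q (E \<sigma>) = measure ?Q ?E" for \<sigma>
    unfolding E_def using measurable_swap_sample distr_swap_sample
      sets_ghost_samples[OF traces_measurable]
    by (rule sets_completion_vimage measure_completion_vimage)+
  have few_swaps: "ennreal (2 ^ b / 2 ^ n) * (\<Sum>\<sigma>\<in>Pow {..<n}. indicator (E \<sigma>) x)
      \<le> of_nat (card (?small x))"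
    if "x \<in> space ?Q" for x
  proof -
    let ?S = "{\<sigma>\<in>Pow {..<n}. swap_sample n \<sigma> x \<in> ?E}"
    have "?S = Pow {..<n} \<inter> {\<sigma>. x \<in> E \<sigma>}" using that by (auto simp: E_def)
    then have count_eq: "(\<Sum>\<sigma>\<in>Pow {..<n}. indicator (E \<sigma>) x) = ennreal (real (card ?S))"
      by (simp add: indicator_def of_bool_def[symmetric] ennreal_of_nat_eq_real_of_nat)
    have "card ?S * 2 ^ b \<le> card (?small x) * 2 ^ n"
      by (rule card_swaps_into_ghost_samples_le_small_subsets[OF vc_dim_le J_props(1)])
    then have "real (card ?S * 2 ^ b) \<le> real (card (?small x) * 2 ^ n)"
      by (simp only: of_nat_le_iff)
    then have "2 ^ b / 2 ^ n * real (card ?S) \<le> real (card (?small x))" by (simp add: field_simps)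
    then show ?thesis
      unfolding count_eq
      by (simp add: ennreal_mult[symmetric] ennreal_of_nat_eq_real_of_nat ennreal_leI)
  qed
  have "ennreal (2 ^ b * measure ?Q ?E) = ennreal (2 ^ b / 2 ^ n) * (\<Sum>\<sigma>\<in>Pow {..<n}. emeasure ?Q (E \<sigma>))"
    unfolding Q.emeasure_eq_measure E_swapped(2)
    by (subst sum_ennreal) (simp_all add: card_Pow ennreal_mult[symmetric])
  also have "\<dots> = (\<integral>\<^sup>+x. ennreal (2 ^ b / 2 ^ n) * (\<Sum>\<sigma>\<in>Pow {..<n}. indicator (E \<sigma>) x) \<partial>?Q)"
    using E_swapped(1) by (simp add: nn_integral_cmult nn_integral_sum del: emeasure_completion)
  also have "\<dots> \<le> (\<integral>\<^sup>+x. of_nat (card (?small x)) \<partial>?Q)" by (intro nn_integral_mono few_swaps)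
  also have "\<dots> = ennreal ?\<Phi>"
    using nn_integral_card_small_subsets[OF _ J_props(2), of "{..<2*n}" d]
    by (simp add: nn_integral_completion)
  finally have "2 ^ b * measure ?Q ?E \<le> ?\<Phi>"
    by (subst (asm) ennreal_le_iff) (auto intro!: sum_nonneg)
  then show ?thesis by (simp add: field_simps)
qed

lemma merge_in_ghost_samples:
  assumes "C \<in> \<C>" "x \<in> space (sample M n)" "x' \<in> space (\<Pi>\<^sub>M i\<in>{n..<2*n}. M)"
    and unhit: "\<And>i. i < n \<Longrightarrow> x i \<notin> C" and hits: "b \<le> card {i\<in>{n..<2*n}. x' i \<in> C}"
  shows "merge {..<n} {n..<2*n} (x, x') \<in> ghost_samples M \<C> n b"
proof -
  let ?y = "merge {..<n} {n..<2*n} (x, x')"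
  let ?Z = "{i\<in>{..<2*n}. ?y i \<in> C}"
  have Z_eq: "?Z = {i\<in>{n..<2*n}. x' i \<in> C}"
    using unhit by (intro Collect_cong) (auto simp: merge_def)
  have halves_union: "{..<n} \<union> {n..<2*n} = {..<2*n}" by auto
  have "?y \<in> space (sample M (2*n))"
    using assms(2,3) measurable_space[OF measurable_merge[of "{..<n}" "{n..<2*n}" "\<lambda>_. M"],
      of "(x, x')"]
    by (simp add: space_pair_measure halves_union)
  moreover have "?Z \<in> traces \<C> {..<2*n} ?y" unfolding traces_def using assms(1) by (rule imageI)
  moreover have "?Z \<inter> {..<n} = {}" unfolding Z_eq by auto
  moreover have "b \<le> card ?Z" unfolding Z_eq by (rule hits)
  ultimately show ?thesis unfolding ghost_samples_def by blast
qed

lemma half_le_measure_completion_count: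
  fixes I :: "nat set"
  assumes finite_I: "finite I" and C_sets: "C \<in> sets (completion M)"
    and C_measure: "\<rho> \<le> measure (completion M) C"
    and hits_likely: "2 ^ b * exp (- \<rho> * real (card I) / 2) \<le> 1 / 2"
  shows "1 / 2 \<le> measure (completion (\<Pi>\<^sub>M i\<in>I. M)) {x \<in> space (\<Pi>\<^sub>M i\<in>I. M). b \<le> card {i\<in>I. x i \<in> C}}"
proof -
  let ?P = "\<Pi>\<^sub>M i\<in>I. M"
  let ?few = "\<lambda>A. {x \<in> space ?P. card {i\<in>I. x i \<in> A} < b}"
  let ?many = "\<lambda>A. {x \<in> space ?P. b \<le> card {i\<in>I. x i \<in> A}}"
  interpret P: prob_space ?P by (rule prob_space_iid)
  interpret PC: prob_space "completion ?P" by (rule prob_space_completion_iid)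
  define A where "A = main_part M C"
  have A_props: "A \<in> events" "A \<subseteq> C"
    unfolding A_def using C_sets main_part_null_part_Un[OF C_sets] by (simp, blast)
  have many_sets: "?many A \<in> sets ?P" using finite_I A_props(1) by (rule sets_Collect_count_ge)
  have "\<rho> \<le> prob A" using C_measure C_sets by (simp add: A_def measure_def)
  then have "2 ^ b * exp (- prob A * real (card I) / 2) \<le> 2 ^ b * exp (- \<rho> * real (card I) / 2)"
    by (simp add: mult_right_mono)
  then have "P.prob (?few A) \<le> 1 / 2"
    using prob_count_less_le[OF finite_I A_props(1), of b] hits_likely by linarith
  moreover have "P.prob (?few A) = 1 - P.prob (?many A)"
    unfolding P.prob_compl[OF many_sets, symmetric] by (rule arg_cong[where f = P.prob]) auto
  ultimately have "1 / 2 \<le> P.prob (?many A)" by linarith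
  also have "\<dots> = PC.prob (?many A)" by (rule measure_completion[OF many_sets, symmetric])
  also have "\<dots> \<le> PC.prob (?many C)"
  proof (rule PC.finite_measure_mono)
    show "?many A \<subseteq> ?many C"
    proof
      fix x assume "x \<in> ?many A"
      moreover have "card {i\<in>I. x i \<in> A} \<le> card {i\<in>I. x i \<in> C}"
        using finite_I A_props(2) by (intro card_mono) auto
      ultimately show "x \<in> ?many C" by simp
    qed
    have [measurable]: "(\<lambda>x. card {i\<in>I. x i \<in> C}) \<in> completion ?P \<rightarrow>\<^sub>M count_space UNIV"
    proof (rule measurable_card)
      show "{x \<in> space (completion ?P). i \<in> {i\<in>I. x i \<in> C}} \<in> PC.events" for i
        using sets_completion_component[OF C_sets, of i I] by (cases "i \<in> I") simp_all
    qed
    have "{x \<in> space (completion ?P). b \<le> card {i\<in>I. x i \<in> C}} \<in> PC.events" by measurable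
    then show "?many C \<in> PC.events" by simp
  qed
  finally show ?thesis .
qed

lemma measure_unhit_samples_le_ghost_samples:
  assumes traces_measurable: "measurable_traces M \<C>" and members_sets: "\<C> \<subseteq> sets (completion M)"
    and members_measure: "\<And>C. C \<in> \<C> \<Longrightarrow> \<rho> \<le> measure (completion M) C"
    and hits_likely: "2 ^ b * exp (- \<rho> * real n / 2) \<le> 1 / 2"
  shows "measure (completion (sample M n)) (unhit_samples M \<C> n)
    \<le> 2 * measure (completion (sample M (2*n))) (ghost_samples M \<C> n b)"
proof -
  let ?P1 = "sample M n" and ?P2 = "\<Pi>\<^sub>M i\<in>{n..<2*n}. M" and ?T = "merge {..<n} {n..<2*n}"
  let ?U = "unhit_samples M \<C> n"
  interpret P1: prob_space ?P1 by (rule prob_space_iid)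
  interpret P2: prob_space ?P2 by (rule prob_space_iid)
  interpret P12: pair_prob_space ?P1 ?P2 ..
  interpret C2: prob_space "completion ?P2" by (rule prob_space_completion_iid)
  interpret P: product_sigma_finite "\<lambda>_::nat. M" by unfold_locales
  have halves_union: "{..<n} \<union> {n..<2*n} = {..<2*n}" and halves_disjoint: "{..<n} \<inter> {n..<2*n} = {}"
    by auto
  have T_measurable: "?T \<in> ?P1 \<Otimes>\<^sub>M ?P2 \<rightarrow>\<^sub>M sample M (2*n)"
    using measurable_merge[of "{..<n}" "{n..<2*n}" "\<lambda>_. M"] unfolding halves_union .
  have T_distr: "distr (?P1 \<Otimes>\<^sub>M ?P2) (sample M (2*n)) ?T = sample M (2*n)"
    using P.distr_merge[OF halves_disjoint] unfolding halves_union by simp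
  define E where "E = ?T -` ghost_samples M \<C> n b \<inter> space (?P1 \<Otimes>\<^sub>M ?P2)"
  have "1 / 2 * measure (completion ?P1) (unhit_samples M \<C> n) \<le> measure (completion (?P1 \<Otimes>\<^sub>M ?P2)) E"
  proof (rule P12.measure_completion_pair_ge)
    show "E \<in> sets (completion (?P1 \<Otimes>\<^sub>M ?P2))"
      unfolding E_def
      by (intro sets_completion_vimage[OF T_measurable T_distr] sets_ghost_samples traces_measurable)
    fix x assume x_unhit: "x \<in> unhit_samples M \<C> n"
      and section_E_sets: "Pair x -` E \<in> sets (completion ?P2)"
    obtain C where C_unhit: "C \<in> \<C>" "\<And>i. i < n \<Longrightarrow> x i \<notin> C" and x_space: "x \<in> space ?P1"
      using x_unhit by (auto simp: unhit_samples_def empty_in_traces_iff)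
    have "1 / 2 \<le> C2.prob {x' \<in> space ?P2. b \<le> card {i\<in>{n..<2*n}. x' i \<in> C}}"
      using C_unhit(1) members_sets members_measure hits_likely
      by (intro half_le_measure_completion_count[where \<rho> = \<rho>]) auto
    also have "\<dots> \<le> C2.prob (Pair x -` E)"
      using merge_in_ghost_samples[OF C_unhit(1) x_space _ C_unhit(2)] x_space
      by (intro C2.finite_measure_mono[OF _ section_E_sets]) (auto simp: E_def space_pair_measure)
    finally show "1 / 2 \<le> C2.prob (Pair x -` E)" .
  qed (simp_all add: sets_unhit_samples[OF traces_measurable])
  then show ?thesis
    unfolding E_def measure_completion_vimage[OF T_measurable T_distr
      sets_ghost_samples[OF traces_measurable]]
    by simp
qed

text \<open>
  The sets are confined to \<open>J\<close>, so the bound depends on the expected number \<open>n * prob J\<close> of sample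
  points in \<open>J\<close> rather than on \<open>n\<close>.
\<close>

lemma measure_unhit_samples_le:
  assumes "measurable_traces M \<C>" "vc_dim \<C> \<le> enat d" "\<Union>\<C> \<subseteq> J" "J \<in> events" "\<C> \<subseteq> sets (completion M)"
    and "\<And>C. C \<in> \<C> \<Longrightarrow> \<rho> \<le> measure (completion M) C" "2 ^ b * exp (- \<rho> * real n / 2) \<le> 1 / 2"
  shows "measure (completion (sample M n)) (unhit_samples M \<C> n) \<le> double_sample_bound d n b (prob J)"
  unfolding double_sample_bound_def
  using measure_unhit_samples_le_ghost_samples[OF assms(1,5-7)]
    measure_ghost_samples_le[OF assms(1-4), of n b]
  by linarith

end

section \<open>Counting blocks of a sample\<close>

definition block :: "nat \<Rightarrow> nat \<Rightarrow> (nat \<Rightarrow> 'a) \<Rightarrow> nat \<Rightarrow> 'a" where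
  "block n j x = (\<lambda>i\<in>{..<n}. x (j * n + i))"

definition block_count :: "nat \<Rightarrow> nat \<Rightarrow> (nat \<Rightarrow> 'a) set \<Rightarrow> (nat \<Rightarrow> 'a) \<Rightarrow> nat" where
  "block_count n N E x = card {j. j < N \<and> block n j x \<in> E}"

lemma block_index_less:
  fixes i j n N :: nat
  assumes "i < n" "j < N"
  shows "j * n + i < N * n"
proof -
  have "j * n + i < Suc j * n" using assms(1) by simp
  also have "\<dots> \<le> N * n" using assms(2) by (intro mult_le_mono1) simp
  finally show ?thesis .
qed

lemma disjoint_family_blocks: "disjoint_family (\<lambda>j::nat. {j * n..<j * n + n})"
proof -
  have "{i * n..<i * n + n} \<inter> {j * n..<j * n + n} = {}" if "i < j" for i j
  proof -
    have "Suc i * n \<le> j * n" using that by (intro mult_le_mono1) simp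
    then show ?thesis by auto
  qed
  then show ?thesis unfolding disjoint_family_on_def by (metis Int_commute nat_neq_iff)
qed

context prob_space
begin

lemma measurable_block: "j < N \<Longrightarrow> block n j \<in> sample M (N*n) \<rightarrow>\<^sub>M sample M n"
  unfolding block_def using block_index_less by (intro measurable_reindex) auto

lemma distr_block: "j < N \<Longrightarrow> distr (sample M (N*n)) (sample M n) (block n j) = sample M n"
  unfolding block_def using block_index_less by (intro distr_reindex) (auto simp: inj_on_def)

lemma indep_vars_components:
  assumes "I \<noteq> {}"
  shows "prob_space.indep_vars (\<Pi>\<^sub>M i\<in>I. M) (\<lambda>_. M) (\<lambda>i x. x i) I"
proof -
  let ?Q = "\<Pi>\<^sub>M i\<in>I. M"
  interpret Q: prob_space ?Q by (rule prob_space_iid)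
  have "distr ?Q ?Q (\<lambda>x. \<lambda>i\<in>I. x i) = ?Q" by (intro distr_reindex) auto
  moreover have "?Q = Pi\<^sub>M I (\<lambda>i. distr ?Q M (\<lambda>x. x i))"
    by (intro PiM_cong refl distr_component[symmetric])
  ultimately show ?thesis
    using assms
    by (subst Q.indep_vars_iff_distr_eq_PiM') (auto intro: measurable_component_singleton)
qed

lemma indep_vars_blocks:
  assumes "0 < n" "0 < N"
  shows "prob_space.indep_vars (sample M (N*n)) (\<lambda>_. sample M n) (block n) {..<N}"
proof -
  let ?Q = "sample M (N*n)" and ?K = "\<lambda>j. {j * n..<j * n + n}"
  interpret Q: prob_space ?Q by (rule prob_space_iid)
  have blocks_sub: "?K j \<subseteq> {..<N*n}" if "j < N" for j
    using block_index_less[OF _ that, of _ n] by (auto simp: le_iff_add)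
  have "Q.indep_vars (\<lambda>j. \<Pi>\<^sub>M i\<in>?K j. M) (\<lambda>j x. restrict (\<lambda>i. x i) (?K j)) {..<N}"
    using assms blocks_sub disjoint_family_on_mono[OF _ disjoint_family_blocks, of "{..<N}" n]
    by (intro Q.indep_vars_restrict[OF indep_vars_components]) auto
  then have "Q.indep_vars (\<lambda>_. sample M n) (\<lambda>j x. \<lambda>i\<in>{..<n}. restrict x (?K j) (j * n + i)) {..<N}"
    by (rule Q.indep_vars_compose2) (intro measurable_reindex, auto)
  moreover have "(\<lambda>i\<in>{..<n}. restrict x (?K j) (j * n + i)) = block n j x" for j and x :: "nat \<Rightarrow> 'a"
    by (auto simp: block_def fun_eq_iff)
  ultimately show ?thesis by simp
qed

lemma hoeffding_block_count:
  assumes E_sets: "E \<in> sets (sample M n)" and pos: "0 < n" "0 < N" "0 \<le> \<delta>"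
  defines "p \<equiv> measure (sample M n) E"
  shows "measure (sample M (N*n))
        {x \<in> space (sample M (N*n)). real N * (p + \<delta>) \<le> real (block_count n N E x)}
      \<le> exp (- 2 * real N * \<delta>\<^sup>2)"
    and "measure (sample M (N*n))
        {x \<in> space (sample M (N*n)). real (block_count n N E x) \<le> real N * (p - \<delta>)}
      \<le> exp (- 2 * real N * \<delta>\<^sup>2)"
proof -
  let ?Q = "sample M (N*n)"
  interpret Q: prob_space ?Q by (rule prob_space_iid)
  define X where "X j x = (indicator E (block n j x) :: real)" for j x
  have "Q.indep_vars (\<lambda>_. borel) X {..<N}"
    unfolding X_def
    by (rule Q.indep_vars_compose2[OF indep_vars_blocks[OF pos(1,2)]])
       (rule borel_measurable_indicator[OF E_sets])
  then interpret Hoeffding_ineq ?Q "{..<N}" X "\<lambda>_. 0" "\<lambda>_. 1" "\<Sum>j<N. Q.expectation (X j)"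
    by unfold_locales (auto simp: X_def indicator_def)
  have "Q.expectation (X j) = p" if j_less: "j < N" for j
  proof -
    have "Q.expectation (X j) = (\<integral>y. indicator E y \<partial>distr ?Q (sample M n) (block n j))"
      unfolding X_def using E_sets
      by (intro integral_distr[symmetric] measurable_block[OF j_less]) auto
    also have "\<dots> = p"
      unfolding distr_block[OF j_less] using E_sets by (simp add: p_def sets.Int_space_eq2)
    finally show ?thesis .
  qed
  then have mean: "(\<Sum>j<N. Q.expectation (X j)) = real N * p" by simp
  have sum_X: "(\<Sum>j<N. X j x) = real (block_count n N E x)" for x
    by (simp add: X_def block_count_def indicator_def of_bool_def[symmetric] Int_def)
  have width_pos: "0 < (\<Sum>i<N. (1 - 0 :: real)\<^sup>2)" using pos by simp
  have deviation_nonneg: "0 \<le> real N * \<delta>" using pos by simp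
  have rate: "- 2 * (real N * \<delta>)\<^sup>2 / (\<Sum>i<N. (1 - 0)\<^sup>2) = - 2 * real N * \<delta>\<^sup>2"
    using pos by (simp add: power2_eq_square)
  show "measure ?Q {x \<in> space ?Q. real N * (p + \<delta>) \<le> real (block_count n N E x)}
      \<le> exp (- 2 * real N * \<delta>\<^sup>2)"
    using Hoeffding_ineq_ge[OF deviation_nonneg width_pos] unfolding mean rate sum_X
    by (simp add: distrib_left)
  show "measure ?Q {x \<in> space ?Q. real (block_count n N E x) \<le> real N * (p - \<delta>)}
      \<le> exp (- 2 * real N * \<delta>\<^sup>2)"
    using Hoeffding_ineq_le[OF deviation_nonneg width_pos] unfolding mean rate sum_X
    by (simp add: right_diff_distrib)
qed

lemma measurable_block_count:
  assumes "E \<in> sets (sample M n)"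
  shows "block_count n N E \<in> sample M (N*n) \<rightarrow>\<^sub>M count_space UNIV"
  unfolding block_count_def
proof (rule measurable_card)
  fix j
  show "{x \<in> space (sample M (N*n)). j \<in> {j. j < N \<and> block n j x \<in> E}} \<in> sets (sample M (N*n))"
    using measurable_sets[OF measurable_block assms, of j N]
    by (cases "j < N") (auto simp: vimage_def Int_def conj_commute)
qed

lemma
  assumes E_sets: "E \<in> sets (completion (sample M n))"
  shows sets_completion_block_count:
      "{x \<in> space (sample M (N*n)). P (block_count n N E x)} \<in> sets (completion (sample M (N*n)))"
    and measure_completion_block_count:
      "measure (completion (sample M (N*n))) {x \<in> space (sample M (N*n)). P (block_count n N E x)}
        = measure (sample M (N*n))
            {x \<in> space (sample M (N*n)). P (block_count n N (main_part (sample M n) E) x)}"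
proof -
  let ?Q = "sample M (N*n)" and ?A = "main_part (sample M n) E"
  let ?S = "{x \<in> space ?Q. P (block_count n N E x)}"
    and ?S' = "{x \<in> space ?Q. P (block_count n N ?A x)}"
  have "?S' \<in> sets ?Q"
    using measurable_sets[OF measurable_block_count[OF main_part_sets[OF E_sets]], of "{c. P c}" N]
    by (simp add: vimage_def Int_def conj_commute)
  then have S_main_sets: "?S' \<in> sets (completion ?Q)" by simp
  have "AE x in ?Q. \<forall>j\<in>{..<N}. block n j x \<in> ?A \<longleftrightarrow> block n j x \<in> E"
  proof (rule AE_finite_allI)
    fix j assume "j \<in> {..<N}"
    then have j_less: "j < N" by simp
    have "AE y in distr ?Q (sample M n) (block n j). y \<in> ?A \<longleftrightarrow> y \<in> E"
      unfolding distr_block[OF j_less] by (rule AE_in_main_part[OF E_sets])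
    then show "AE x in ?Q. block n j x \<in> ?A \<longleftrightarrow> block n j x \<in> E"
      by (rule AE_distrD[OF measurable_block[OF j_less]])
  qed simp
  then have "AE x in ?Q. x \<in> ?S' \<longleftrightarrow> x \<in> ?S"
  proof eventually_elim
    case (elim x)
    then have "{j. j < N \<and> block n j x \<in> ?A} = {j. j < N \<and> block n j x \<in> E}" by auto
    then show ?case by (simp add: block_count_def)
  qed
  then have AE_counts_eq: "AE x in completion ?Q. x \<in> ?S' \<longleftrightarrow> x \<in> ?S" by (rule AE_completion)
  show S_sets: "?S \<in> sets (completion ?Q)"
    by (rule completion.in_sets_AE[OF AE_counts_eq S_main_sets]) auto
  have "measure (completion ?Q) ?S = measure (completion ?Q) ?S'"
    using AE_counts_eq by (intro measure_eq_AE S_sets S_main_sets) auto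
  then show "measure (completion ?Q) ?S = measure ?Q ?S'" using \<open>?S' \<in> sets ?Q\<close> by simp
qed

lemma
  assumes E_sets: "E \<in> sets (completion (sample M n))" and pos: "0 < n" "0 < N" "0 \<le> \<delta>"
  shows prob_block_count_gt_le: "measure (completion (sample M n)) E \<le> \<alpha> \<Longrightarrow>
      measure (completion (sample M (N*n)))
          {x \<in> space (sample M (N*n)). real N * (\<alpha> + \<delta>) < real (block_count n N E x)}
        \<le> exp (- 2 * real N * \<delta>\<^sup>2)"
    and prob_block_count_le_le: "\<alpha> + 2 * \<delta> \<le> measure (completion (sample M n)) E \<Longrightarrow>
      measure (completion (sample M (N*n)))
          {x \<in> space (sample M (N*n)). real (block_count n N E x) \<le> real N * (\<alpha> + \<delta>)}
        \<le> exp (- 2 * real N * \<delta>\<^sup>2)"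
proof -
  let ?Q = "sample M (N*n)" and ?A = "main_part (sample M n) E"
  interpret Q: prob_space ?Q by (rule prob_space_iid)
  have A_sets: "?A \<in> sets (sample M n)" using E_sets by simp
  have A_measure: "measure (sample M n) ?A = measure (completion (sample M n)) E"
    using E_sets by (simp add: measure_def)
  note [measurable] = measurable_block_count[OF A_sets]
  show "measure (completion ?Q) {x \<in> space ?Q. real N * (\<alpha> + \<delta>) < real (block_count n N E x)}
      \<le> exp (- 2 * real N * \<delta>\<^sup>2)"
    if E_small: "measure (completion (sample M n)) E \<le> \<alpha>"
  proof -
    have "real N * (measure (sample M n) ?A + \<delta>) \<le> real N * (\<alpha> + \<delta>)"
      using E_small by (intro mult_left_mono) (simp_all add: A_measure)
    then have "measure ?Q {x \<in> space ?Q. real N * (\<alpha> + \<delta>) < real (block_count n N ?A x)}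
        \<le> measure ?Q {x \<in> space ?Q. real N * (measure (sample M n) ?A + \<delta>) \<le> real (block_count n N ?A x)}"
      by (intro Q.finite_measure_mono) auto
    also have "\<dots> \<le> exp (- 2 * real N * \<delta>\<^sup>2)" by (rule hoeffding_block_count(1)[OF A_sets pos])
    finally show ?thesis
      by (simp only: measure_completion_block_count[OF E_sets,
          where P = "\<lambda>c. real N * (\<alpha> + \<delta>) < real c"])
  qed
  show "measure (completion ?Q) {x \<in> space ?Q. real (block_count n N E x) \<le> real N * (\<alpha> + \<delta>)}
      \<le> exp (- 2 * real N * \<delta>\<^sup>2)"
    if E_large: "\<alpha> + 2 * \<delta> \<le> measure (completion (sample M n)) E"
  proof -
    have "real N * (\<alpha> + \<delta>) \<le> real N * (measure (sample M n) ?A - \<delta>)"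
      using E_large by (intro mult_left_mono) (simp_all add: A_measure)
    then have "measure ?Q {x \<in> space ?Q. real (block_count n N ?A x) \<le> real N * (\<alpha> + \<delta>)}
        \<le> measure ?Q {x \<in> space ?Q. real (block_count n N ?A x) \<le> real N * (measure (sample M n) ?A - \<delta>)}"
      by (intro Q.finite_measure_mono) auto
    also have "\<dots> \<le> exp (- 2 * real N * \<delta>\<^sup>2)" by (rule hoeffding_block_count(2)[OF A_sets pos])
    finally show ?thesis
      by (simp only: measure_completion_block_count[OF E_sets,
          where P = "\<lambda>c. real c \<le> real N * (\<alpha> + \<delta>)"])
  qed
qed

end

section \<open>The uniform distribution on the unit interval\<close>

lemma space_unif01 [simp]: "space unif01 = UNIV"
  by (simp add: unif01_def)

lemma sets_unif01 [simp, measurable_cong]: "sets unif01 = sets borel"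
  by (simp add: unif01_def)

lemma unif01_eq_density: "unif01 = density lborel (indicator {0<..<1})"
  by (simp add: unif01_def uniform_measure_def divide_ennreal_def)

lemma emeasure_unif01: "A \<in> sets borel \<Longrightarrow> emeasure unif01 A = emeasure lborel ({0<..<1} \<inter> A)"
  by (simp add: unif01_def divide_ennreal_def)

interpretation unif01: real_distribution unif01
  unfolding real_distribution_def real_distribution_axioms_def
  by (auto simp: unif01_def intro: prob_space_uniform_measure)

interpretation completion_unif01: prob_space "completion unif01"
  by (rule unif01.prob_space_completion)

lemma sets_completion_unif01_borel: "A \<in> sets borel \<Longrightarrow> A \<in> sets (completion unif01)"
  by (simp add: sets_completionI_sets)

lemma measure_unif01_greaterThanLessThan:
  assumes "0 \<le> a" "a \<le> b" "b \<le> 1"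
  shows "measure unif01 {a<..<b} = b - a"
proof -
  have "{0<..<1} \<inter> {a<..<b} = {a<..<b}" using assms by auto
  then show ?thesis using assms by (simp add: measure_def emeasure_unif01)
qed

lemma measure_unif01_le:
  assumes A_sets: "A \<in> sets borel" and "A \<inter> {0<..<1} \<subseteq> {a..b}" "a \<le> b"
  shows "measure unif01 A \<le> b - a"
proof -
  have "emeasure unif01 A \<le> emeasure lborel {a..b}"
    unfolding emeasure_unif01[OF A_sets] using assms by (intro emeasure_mono) auto
  then have "ennreal (measure unif01 A) \<le> ennreal (b - a)"
    using assms by (simp add: unif01.emeasure_eq_measure)
  then show ?thesis using assms by (simp add: ennreal_le_iff)
qed

lemma measure_unif01_near_boundary_le:
  assumes "0 \<le> r"
  shows "measure unif01 ({..<r} \<union> {1-r<..}) \<le> 2 * r"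
proof -
  have "measure unif01 {..<r} \<le> r - 0" using assms by (intro measure_unif01_le) auto
  moreover have "measure unif01 {1-r<..} \<le> 1 - (1 - r)"
    using assms by (intro measure_unif01_le) auto
  moreover have "measure unif01 ({..<r} \<union> {1-r<..}) \<le> measure unif01 {..<r} + measure unif01 {1-r<..}"
    by (intro measure_Un_le) auto
  ultimately show ?thesis by linarith
qed

lemma absolutely_continuous_lborel_unif01: "absolutely_continuous lborel unif01"
  unfolding unif01_eq_density by (rule absolutely_continuousI_density) simp

lemma null_sets_completion_unif01:
  assumes "N \<in> null_sets lebesgue"
  shows "N \<in> null_sets (completion unif01)"
proof -
  have "sets unif01 = sets lborel" by simp
  from absolutely_continuous_completion[OF this absolutely_continuous_lborel_unif01]
  show ?thesis using assms by (simp only: absolutely_continuous_def subset_eq)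
qed

section \<open>Distance and outer distance\<close>

text \<open>
  A non-measurable disagreement set has measure 0, so \<open>fdist\<close> does not satisfy the triangle
  inequality. Covering the disagreement set by a measurable set restores it.
\<close>

definition differ_le :: "'a measure \<Rightarrow> real \<Rightarrow> ('a \<Rightarrow> 'b) \<Rightarrow> ('a \<Rightarrow> 'b) \<Rightarrow> bool" where
  "differ_le M \<delta> f g \<longleftrightarrow>
    (\<exists>D\<in>sets (completion M). {x \<in> space M. f x \<noteq> g x} \<subseteq> D \<and> measure (completion M) D \<le> \<delta>)"

lemma differ_le_refl: "0 \<le> \<delta> \<Longrightarrow> differ_le M \<delta> f f"
  unfolding differ_le_def by (intro bexI[of _ "{}"]) auto

lemma differ_le_mono: "differ_le M \<delta> f g \<Longrightarrow> \<delta> \<le> \<delta>' \<Longrightarrow> differ_le M \<delta>' f g"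
  unfolding differ_le_def by (meson order_trans)

lemma differ_le_trans:
  assumes "differ_le M \<delta> f g" "differ_le M \<delta>' g h"
  shows "differ_le M (\<delta> + \<delta>') f h"
proof -
  obtain D D' where D_cover: "D \<in> sets (completion M)" "{x \<in> space M. f x \<noteq> g x} \<subseteq> D"
    "measure (completion M) D \<le> \<delta>"
    and D'_cover: "D' \<in> sets (completion M)" "{x \<in> space M. g x \<noteq> h x} \<subseteq> D'"
      "measure (completion M) D' \<le> \<delta>'"
    using assms unfolding differ_le_def by blast
  have "measure (completion M) (D \<union> D') \<le> \<delta> + \<delta>'"
    using measure_Un_le[OF D_cover(1) D'_cover(1)] D_cover(3) D'_cover(3) by linarith
  moreover have "{x \<in> space M. f x \<noteq> h x} \<subseteq> D \<union> D'" using D_cover(2) D'_cover(2) by fastforce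
  ultimately show ?thesis unfolding differ_le_def using D_cover(1) D'_cover(1) by blast
qed

lemma fdist_le_of_differ_le:
  assumes "prob_space P" "differ_le P \<delta> f g"
  shows "fdist P f g \<le> \<delta>"
proof -
  interpret C: prob_space "completion P" using assms(1) by (rule prob_space.prob_space_completion)
  obtain D where D_cover: "D \<in> sets (completion P)" "{x \<in> space P. f x \<noteq> g x} \<subseteq> D"
    "measure (completion P) D \<le> \<delta>"
    using assms(2) unfolding differ_le_def by blast
  then show ?thesis
    unfolding fdist_def
    by (cases "{x \<in> space P. f x \<noteq> g x} \<in> sets (completion P)")
       (auto simp: measure_notin_sets intro: order_trans[OF C.finite_measure_mono]
         order_trans[OF measure_nonneg])
qed

lemma fdist_class_le: "g \<in> \<F> \<Longrightarrow> fdist_class P f \<F> \<le> fdist P f g"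
  unfolding fdist_class_def by (intro cINF_lower bdd_belowI2[where m = 0]) (auto simp: fdist_def)

lemma sets_disagreement_of_far:
  assumes "0 < \<epsilon>" "\<epsilon> \<le> fdist_class P f \<F>" "h \<in> \<F>"
  shows "{x \<in> space P. f x \<noteq> h x} \<in> sets (completion P)"
proof (rule ccontr)
  assume "\<not> ?thesis"
  then have "fdist P f h = 0" by (simp add: fdist_def measure_notin_sets)
  then show False using assms fdist_class_le[OF assms(3), of P f] by simp
qed

section \<open>Piecewise functions\<close>

lemma piecewise_0: "piecewise 0 H = {}"
  by (auto simp: piecewise_def)

lemma piecewise_1: "piecewise (Suc 0) H = H"
proof (intro set_eqI iffI)
  fix f assume "f \<in> piecewise (Suc 0) H"
  then obtain h :: "nat \<Rightarrow> real \<Rightarrow> 'a" where "h (Suc 0) \<in> H" "\<forall>x. f x = h (Suc 0) x"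
    unfolding piecewise_def by auto
  moreover from this have "f = h (Suc 0)" by auto
  ultimately show "f \<in> H" by simp
next
  fix f assume "f \<in> H"
  then show "f \<in> piecewise (Suc 0) H"
    unfolding piecewise_def
    by (auto intro!: exI[of _ "\<lambda>_. f"] exI[of _ "\<lambda>i. if i = 0 then -\<infinity> else \<infinity>"])
qed

lemma piecewise_cons:
  assumes n_pos: "0 < n" and g_piecewise: "g \<in> piecewise n H" and h_in_H: "h \<in> H"
  shows "(\<lambda>x. if x \<le> c then h x else g x) \<in> piecewise (Suc n) H"
proof -
  from g_piecewise obtain u t where u_in_H: "\<forall>i\<in>{1..n}. u i \<in> H"
    and t_breakpoints: "t 0 = -\<infinity>" "t n = \<infinity>" "\<forall>i\<in>{1..<n}. \<bar>t i\<bar> \<noteq> \<infinity>"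
      "\<forall>i\<in>{1..<n}. \<forall>j\<in>{1..<n}. i \<le> j \<longrightarrow> t i \<le> t j"
    and g_eq_u: "\<forall>x. \<forall>i\<in>{1..n}. t (i - 1) < ereal x \<and> ereal x \<le> t i \<longrightarrow> g x = u i x"
    unfolding piecewise_def by blast
  define u' where "u' i = (if i = 1 then h else u (i - 1))" for i
  define t' where "t' i = (case i of 0 \<Rightarrow> -\<infinity> | Suc j \<Rightarrow> max (ereal c) (t j))" for i
  have "u' i \<in> H" if "i \<in> {1..Suc n}" for i
  proof (cases "i = 1")
    case False
    then have "i - 1 \<in> {1..n}" using that by auto
    then show ?thesis using u_in_H False by (simp add: u'_def)
  qed (simp add: u'_def h_in_H)
  moreover have "t' 0 = -\<infinity>" "t' (Suc n) = \<infinity>" using t_breakpoints by (auto simp: t'_def max_def)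
  moreover have "\<bar>t' i\<bar> \<noteq> \<infinity>" if i_range: "i \<in> {1..<Suc n}" for i
  proof -
    obtain j where j_pred: "i = Suc j" "j < n" using i_range by (cases i) auto
    then show ?thesis
      using t_breakpoints(1) t_breakpoints(3)[rule_format, of j]
      by (cases "j = 0") (auto simp: t'_def max_def)
  qed
  moreover have "t' i \<le> t' j" if ij_range: "i \<in> {1..<Suc n}" "j \<in> {1..<Suc n}" "i \<le> j" for i j
  proof -
    obtain i' j' where "i = Suc i'" "j = Suc j'" "i' \<le> j'" "j' < n"
      using ij_range by (cases i; cases j) auto
    then show ?thesis
      using t_breakpoints(1) t_breakpoints(4)[rule_format, of i' j']
      by (cases "i' = 0") (auto simp: t'_def intro: max.coboundedI2)
  qed
  moreover have "(if x \<le> c then h x else g x) = u' i x"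
    if i_range: "i \<in> {1..Suc n}" and x_piece: "t' (i - 1) < ereal x \<and> ereal x \<le> t' i" for i x
  proof (cases "i = 1")
    case True
    then show ?thesis using x_piece t_breakpoints(1) by (auto simp: t'_def u'_def)
  next
    case False
    then obtain j where j_pred: "i = Suc (Suc j)" "Suc j \<in> {1..n}"
      using i_range by (cases i; cases "i - 1") auto
    then have "c < x" "t j < ereal x" "ereal x \<le> t (Suc j)"
      using x_piece by (auto simp: t'_def le_max_iff_disj)
    then show ?thesis using g_eq_u[rule_format, of "Suc j" x] j_pred by (simp add: u'_def)
  qed
  ultimately show ?thesis
    unfolding piecewise_def by (intro CollectI exI[of _ u'] exI[of _ t'] conjI ballI allI impI)
qed

lemma piecewise_SucE:
  assumes f_piecewise: "f \<in> piecewise (Suc n) H" and n_pos: "0 < n"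
  obtains c h g where "h \<in> H" "g \<in> piecewise n H" "f = (\<lambda>x. if x \<le> c then h x else g x)"
proof -
  from f_piecewise obtain u t where u_in_H: "\<forall>i\<in>{1..Suc n}. u i \<in> H"
    and t_breakpoints: "t 0 = -\<infinity>" "t (Suc n) = \<infinity>" "\<forall>i\<in>{1..<Suc n}. \<bar>t i\<bar> \<noteq> \<infinity>"
      "\<forall>i\<in>{1..<Suc n}. \<forall>j\<in>{1..<Suc n}. i \<le> j \<longrightarrow> t i \<le> t j"
    and f_eq_u: "\<forall>x. \<forall>i\<in>{1..Suc n}. t (i - 1) < ereal x \<and> ereal x \<le> t i \<longrightarrow> f x = u i x"
    unfolding piecewise_def by blast
  define c where "c = real_of_ereal (t 1)"
  have t_1_eq: "t 1 = ereal c"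
    using t_breakpoints(3)[rule_format, of 1] n_pos by (simp add: c_def ereal_real')
  define g where "g x = (if x \<le> c then u 2 x else f x)" for x
  define t' where "t' i = (if i = 0 then -\<infinity> else t (Suc i))" for i
  have "g x = u (Suc i) x" if i_range: "i \<in> {1..n}"
    and x_piece: "t' (i - 1) < ereal x \<and> ereal x \<le> t' i" for i x
  proof (cases "x \<le> c")
    case True
    have "i = 1"
    proof (rule ccontr)
      assume "i \<noteq> 1"
      then have "t 1 \<le> t i" "t i < ereal x"
        using t_breakpoints(4)[rule_format, of 1 i] i_range x_piece by (auto simp: t'_def)
      then have "ereal c < ereal x" unfolding t_1_eq[symmetric] by (rule order_le_less_trans)
      then show False using True by simp
    qed
    then show ?thesis using True by (simp add: g_def numeral_2_eq_2)
  next
    case False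
    have "t i < ereal x" "ereal x \<le> t (Suc i)"
      using False t_1_eq i_range x_piece by (cases "i = 1"; auto simp: t'_def)+
    then show ?thesis using False f_eq_u[rule_format, of "Suc i" x] i_range by (simp add: g_def)
  qed
  then have "g \<in> piecewise n H"
    unfolding piecewise_def using u_in_H t_breakpoints n_pos
    by (intro CollectI exI[of _ "\<lambda>i. u (Suc i)"] exI[of _ t'] conjI ballI allI impI) (auto simp: t'_def)
  moreover have "f x = u 1 x" if "x \<le> c" for x
    using f_eq_u[rule_format, of 1 x] t_breakpoints(1) t_1_eq that by simp
  then have "f = (\<lambda>x. if x \<le> c then u 1 x else g x)" by (auto simp: g_def)
  moreover have "u 1 \<in> H" using u_in_H by simp
  ultimately show ?thesis using that by blast
qed

lemma piecewise_induct [consumes 1, case_names single cons]: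
  assumes "f \<in> piecewise k H"
    and "\<And>h. h \<in> H \<Longrightarrow> P 1 h"
    and "\<And>n c h g. 0 < n \<Longrightarrow> h \<in> H \<Longrightarrow> g \<in> piecewise n H \<Longrightarrow> P n g
        \<Longrightarrow> P (Suc n) (\<lambda>x. if x \<le> c then h x else g x)"
  shows "P k f"
  using assms(1)
proof (induction k arbitrary: f)
  case 0
  then show ?case by (simp add: piecewise_0)
next
  case (Suc n)
  show ?case
  proof (cases "n = 0")
    case True
    then show ?thesis using Suc.prems assms(2)[of f] by (simp add: piecewise_1)
  next
    case False
    then obtain c h g where "h \<in> H" "g \<in> piecewise n H" "f = (\<lambda>x. if x \<le> c then h x else g x)"
      using piecewise_SucE[OF Suc.prems] by blast
    then show ?thesis using False Suc.IH assms(3) by simp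
  qed
qed

lemma subset_piecewise: "0 < k \<Longrightarrow> H \<subseteq> piecewise k H"
proof (induction k)
  case (Suc n)
  show ?case
  proof (cases "n = 0")
    case False
    then have "(\<lambda>x. if x \<le> 0 then h x else h x) \<in> piecewise (Suc n) H" if "h \<in> H" for h
      using that Suc.IH by (intro piecewise_cons) auto
    then show ?thesis by (simp add: subset_iff)
  qed (simp add: piecewise_1)
qed simp

lemma sets_disagreement_of_far_piecewise:
  assumes "0 < \<epsilon>" "\<epsilon> \<le> fdist_class P f (piecewise k H)" "0 < k" "h \<in> H"
  shows "{x \<in> space P. f x \<noteq> h x} \<in> sets (completion P)"
  using sets_disagreement_of_far[OF assms(1,2)] subset_piecewise[OF assms(3)] assms(4) by blast

lemma piecewise_breakpoints:
  assumes "f \<in> piecewise k H"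
  shows "\<exists>S. finite S \<and> card S < k \<and>
    (\<forall>c r. (\<forall>s\<in>S. r \<le> \<bar>s - c\<bar>) \<longrightarrow> (\<exists>h\<in>H. \<forall>x. \<bar>x - c\<bar> < r \<longrightarrow> f x = h x))"
  using assms
proof (induction rule: piecewise_induct)
  case (single h)
  then show ?case by (intro exI[of _ "{}"]) auto
next
  case (cons n b h g)
  then obtain S where S_breakpoints: "finite S" "card S < n"
    "\<forall>c r. (\<forall>s\<in>S. r \<le> \<bar>s - c\<bar>) \<longrightarrow> (\<exists>h\<in>H. \<forall>x. \<bar>x - c\<bar> < r \<longrightarrow> g x = h x)" by blast
  have "\<exists>h'\<in>H. \<forall>x. \<bar>x - c\<bar> < r \<longrightarrow> (if x \<le> b then h x else g x) = h' x"
    if breakpoints_far: "\<forall>s\<in>insert b S. r \<le> \<bar>s - c\<bar>" for c r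
  proof (cases "c \<le> b")
    case True
    then have "x \<le> b" if "\<bar>x - c\<bar> < r" for x using breakpoints_far that by auto
    then show ?thesis using \<open>h \<in> H\<close> by (intro bexI[of _ h]) auto
  next
    case False
    have "\<not> x \<le> b" if "\<bar>x - c\<bar> < r" for x using False breakpoints_far that by auto
    moreover obtain h' where "h' \<in> H" "\<forall>x. \<bar>x - c\<bar> < r \<longrightarrow> g x = h' x"
      using S_breakpoints(3) breakpoints_far by blast
    ultimately show ?thesis by (intro bexI[of _ h']) simp_all
  qed
  then show ?case
    using S_breakpoints(1,2) by (intro exI[of _ "insert b S"]) (auto simp: card_insert_if)
qed

lemma piecewise_remove_piece:
  assumes "g \<in> piecewise k H" and "k = Suc n" "0 < n"
  shows "\<exists>D. disjoint_family_on D {..n} \<and>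
    (\<forall>p\<le>n. D p \<in> sets borel \<and> (\<exists>g'\<in>piecewise n H. {x. g x \<noteq> g' x} \<subseteq> D p))"
  using assms
proof (induction arbitrary: n rule: piecewise_induct)
  case (cons m c h g)
  then have m_eq: "m = n" by simp
  show ?case
  proof (cases "n = 1")
    case True
    then have "g \<in> piecewise n H" "h \<in> piecewise n H" using cons m_eq by (simp_all add: piecewise_1)
    then show ?thesis
      using True by (intro exI[of _ "\<lambda>p. if p = 0 then {..c} else {c<..}"])
        (auto simp: disjoint_family_on_def intro: bexI[of _ g] bexI[of _ h])
  next
    case False
    then obtain n' where n_eq: "n = Suc n'" "0 < n'" using cons.prems by (cases n) auto
    obtain D where D_disjoint: "disjoint_family_on D {..n'}"
      and D_pieces: "\<And>p. p \<le> n' \<Longrightarrow> D p \<in> sets borel \<and> (\<exists>g'\<in>piecewise n' H. {x. g x \<noteq> g' x} \<subseteq> D p)"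
      using cons.IH[of n'] m_eq n_eq by blast
    define E where "E p = (case p of 0 \<Rightarrow> {..c} | Suc p' \<Rightarrow> D p' \<inter> {c<..})" for p
    have "disjoint_family_on E {..n}"
      using D_disjoint by (fastforce simp: disjoint_family_on_def E_def n_eq split: nat.splits)
    moreover have "E p \<in> sets borel \<and> (\<exists>g'\<in>piecewise n H. {x. (if x \<le> c then h x else g x) \<noteq> g' x} \<subseteq> E p)"
      if p_le: "p \<le> n" for p
    proof (cases p)
      case 0
      then show ?thesis using cons.hyps m_eq by (auto simp: E_def intro!: bexI[of _ g])
    next
      case (Suc p')
      then obtain g' where g_approx: "D p' \<in> sets borel" "g' \<in> piecewise n' H" "{x. g x \<noteq> g' x} \<subseteq> D p'"
        using D_pieces[of p'] p_le n_eq by auto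
      let ?g' = "\<lambda>x. if x \<le> c then h x else g' x"
      have "{x. (if x \<le> c then h x else g x) \<noteq> ?g' x} \<subseteq> {x. g x \<noteq> g' x} \<inter> {c<..}" by auto
      then have "{x. (if x \<le> c then h x else g x) \<noteq> ?g' x} \<subseteq> E p"
        using g_approx(3) Suc by (auto simp: E_def)
      moreover have "?g' \<in> piecewise n H"
        unfolding n_eq(1) by (rule piecewise_cons[OF n_eq(2) g_approx(2) cons.hyps(2)])
      moreover have "E p \<in> sets borel" using g_approx(1) Suc by (simp add: E_def)
      ultimately show ?thesis by (intro conjI bexI)
    qed
    ultimately show ?thesis by blast
  qed
qed simp

lemma (in prob_space) ex_prob_le_inverse_card:
  assumes "finite I" "I \<noteq> {}" "disjoint_family_on D I" "\<And>i. i \<in> I \<Longrightarrow> D i \<in> events"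
  shows "\<exists>i\<in>I. prob (D i) \<le> 1 / real (card I)"
proof (rule ccontr)
  assume "\<not> ?thesis"
  then have "(\<Sum>i\<in>I. 1 / real (card I)) < (\<Sum>i\<in>I. prob (D i))"
    using assms by (intro sum_strict_mono) (auto simp: not_le)
  also have "\<dots> = prob (\<Union>i\<in>I. D i)"
    using assms by (intro finite_measure_finite_Union[symmetric]) auto
  also have "\<dots> \<le> 1" by simp
  finally show False using assms by (simp add: card_gt_0_iff)
qed

lemma (in real_distribution) piecewise_Suc_approx:
  assumes "0 < n" "g \<in> piecewise (Suc n) H"
  shows "\<exists>g'\<in>piecewise n H. differ_le M (1 / Suc n) g g'"
proof -
  obtain D where D_disjoint: "disjoint_family_on D {..n}"
    and D_pieces: "\<And>p. p \<le> n \<Longrightarrow> D p \<in> sets borel \<and> (\<exists>g'\<in>piecewise n H. {x. g x \<noteq> g' x} \<subseteq> D p)"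
    using piecewise_remove_piece[OF assms(2) refl assms(1)] by blast
  obtain p where p_small: "p \<le> n" "prob (D p) \<le> 1 / Suc n"
    using ex_prob_le_inverse_card[OF _ _ D_disjoint] D_pieces by auto
  obtain g' where "g' \<in> piecewise n H" "{x. g x \<noteq> g' x} \<subseteq> D p"
    using D_pieces[OF p_small(1)] by blast
  moreover have "D p \<in> events" using D_pieces[OF p_small(1)] by simp
  ultimately show ?thesis
    using p_small(2) unfolding differ_le_def by (auto intro!: bexI[of _ g'] bexI[of _ "D p"])
qed

lemma (in real_distribution) piecewise_approx:
  assumes k_pos: "0 < k" and "k \<le> n" "g \<in> piecewise n H"
  shows "\<exists>g'\<in>piecewise k H. differ_le M ((real n - real k) / real k) g g'"
  using assms(2,3)
proof (induction n arbitrary: g rule: dec_induct)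
  case base
  then show ?case by (intro bexI[of _ g]) (auto intro: differ_le_refl)
next
  case (step n)
  obtain g1 where g1_approx: "g1 \<in> piecewise n H" "differ_le M (1 / Suc n) g g1"
    using piecewise_Suc_approx[OF _ step.prems] k_pos step.hyps by auto
  obtain g2 where g2_approx: "g2 \<in> piecewise k H" "differ_le M ((real n - real k) / real k) g1 g2"
    using step.IH[OF g1_approx(1)] by blast
  have "1 / Suc n \<le> 1 / real k" using k_pos step.hyps by (intro divide_left_mono) auto
  then have "1 / Suc n + (real n - real k) / real k \<le> (real (Suc n) - real k) / real k"
    by (simp add: diff_divide_distrib add_divide_distrib)
  then show ?case
    using g2_approx(1) differ_le_trans[OF g1_approx(2) g2_approx(2)] differ_le_mono by blast
qed

text \<open>
  Here \<open>c\<close> is the infimum of the points of \<open>G\<close> at which \<open>u\<close> differs from an earlier value.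
\<close>

lemma first_change_after_gap:
  fixes u :: "real \<Rightarrow> 'b"
  assumes G_sub: "G \<subseteq> {a..}" and const: "\<And>x y. x \<in> G \<Longrightarrow> y \<in> G \<Longrightarrow> \<bar>x - y\<bar> < w \<Longrightarrow> u x = u y"
    and change: "x0 \<in> G" "y0 \<in> G" "u x0 \<noteq> u y0"
  obtains c z where "a + w \<le> c" "c \<le> z" "z \<in> G" "G \<inter> {c - w<..<c} = {}"
    "\<And>x y. x \<in> G \<inter> {..<c} \<Longrightarrow> y \<in> G \<inter> {..<c} \<Longrightarrow> u x = u y"
proof -
  define B where "B = {y\<in>G. \<exists>x\<in>G. x < y \<and> u x \<noteq> u y}"
  define c where "c = Inf B"
  have "(x0 < y0 \<longrightarrow> y0 \<in> B) \<and> (y0 < x0 \<longrightarrow> x0 \<in> B)" using change by (auto simp: B_def)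
  then obtain z where z_in_B: "z \<in> B" using change by (metis linorder_less_linear)
  then have B_nonempty: "B \<noteq> {}" by blast
  have B_bdd: "bdd_below B" using G_sub by (auto simp: B_def bdd_below_def)
  have "a + w \<le> y" if y_B: "y \<in> B" for y
  proof -
    obtain x where "x \<in> G" "x < y" "u x \<noteq> u y" "y \<in> G" using y_B by (auto simp: B_def)
    then have "w \<le> y - x" using const[of x y] by force
    then show ?thesis using G_sub \<open>x \<in> G\<close> by force
  qed
  then have c_late: "a + w \<le> c" unfolding c_def by (intro cInf_greatest B_nonempty)
  have before: "u x = u y" if "x \<in> G \<inter> {..<c}" "y \<in> G \<inter> {..<c}" for x y
  proof -
    have "x \<notin> B" "y \<notin> B" using that cInf_lower[OF _ B_bdd] by (force simp: c_def)+
    then show ?thesis using that by (cases x y rule: linorder_cases) (auto simp: B_def)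
  qed
  have "y \<notin> G" if y_in_gap: "c - w < y" "y < c" for y
  proof
    assume y_in_G: "y \<in> G"
    have "Inf B < y + w" using y_in_gap by (simp add: c_def)
    then obtain v where v_near: "v \<in> B" "v < y + w"
      using cInf_less_iff[OF B_nonempty B_bdd] by blast
    then obtain x where x_differs: "x \<in> G" "x < v" "u x \<noteq> u v" "v \<in> G" by (auto simp: B_def)
    have "c \<le> v" unfolding c_def by (rule cInf_lower[OF v_near(1) B_bdd])
    then have "u y = u v" using const[OF y_in_G x_differs(4)] v_near(2) y_in_gap by auto
    moreover have "u x = u y"
    proof (cases "x < c")
      case True
      then show ?thesis using before[of x y] x_differs(1) y_in_G y_in_gap by simp
    next
      case False
      then show ?thesis using const[OF x_differs(1) y_in_G] x_differs(2) v_near(2) y_in_gap by auto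
    qed
    ultimately show False using x_differs(3) by simp
  qed
  then have gap: "G \<inter> {c - w<..<c} = {}" by force
  have "c \<le> z" "z \<in> G" using z_in_B cInf_lower[OF z_in_B B_bdd] by (simp_all add: B_def c_def)
  then show ?thesis by (rule that[OF c_late _ _ gap before])
qed

lemma measure_lborel_Diff_gap_le:
  fixes a b c w :: real
  assumes "G \<in> sets borel" "G \<inter> {c - w<..<c} = {}" "a + w \<le> c" "c \<le> b" "0 \<le> w"
  shows "measure lborel ({c..b} - G) + w \<le> measure lborel ({a..b} - G)"
proof -
  have "{a..b} \<in> fmeasurable lborel" by (rule fmeasurableI) (simp_all add: emeasure_lborel_Icc_eq)
  then have fmeasurable_parts: "A \<in> fmeasurable lborel" if "A \<in> sets borel" "A \<subseteq> {a..b}" for A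
    using fmeasurableI2[of "{a..b}" lborel A] that by simp
  have parts_sub: "{c..b} - G \<subseteq> {a..b}" "{c - w<..<c} \<subseteq> {a..b}" using assms(3-5) by auto
  have "measure lborel ({c..b} - G) + w = measure lborel ({c..b} - G) + measure lborel {c - w<..<c}"
    using assms(5) by simp
  also have "\<dots> = measure lborel (({c..b} - G) \<union> {c - w<..<c})"
    using assms(1) parts_sub by (intro measure_Un_AE[symmetric] fmeasurable_parts) auto
  also have "\<dots> \<le> measure lborel ({a..b} - G)"
    using assms(1,2) parts_sub by (intro measure_mono_fmeasurable fmeasurable_parts) auto
  finally show ?thesis .
qed

lemma ex_common_value:
  assumes "H \<noteq> {}" "\<And>x. x \<in> G \<Longrightarrow> u x \<in> H" "\<And>x y. x \<in> G \<Longrightarrow> y \<in> G \<Longrightarrow> u x = u y"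
  shows "\<exists>h\<in>H. \<forall>x\<in>G. u x = h"
proof (cases "G = {}")
  case False
  then obtain z where "z \<in> G" by blast
  then have "u z \<in> H" "\<forall>x\<in>G. u x = u z" using assms(2,3) by blast+
  then show ?thesis by blast
qed (use assms(1) in auto)

lemma ex_piecewise_of_locally_constant:
  fixes u :: "real \<Rightarrow> real \<Rightarrow> 'y"
  assumes H_nonempty: "H \<noteq> {}" and w_pos: "0 < w"
  shows "\<lbrakk>G \<in> sets borel; G \<subseteq> {a..b}; \<And>x. x \<in> G \<Longrightarrow> u x \<in> H;
      \<And>x y. x \<in> G \<Longrightarrow> y \<in> G \<Longrightarrow> \<bar>x - y\<bar> < w \<Longrightarrow> u x = u y;
      measure lborel ({a..b} - G) < real n * w\<rbrakk>
    \<Longrightarrow> \<exists>g\<in>piecewise n H. \<forall>x\<in>G. g x = u x x"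
proof (induction n arbitrary: a G)
  case 0
  have "\<not> measure lborel ({a..b} - G) < real 0 * w" by simp
  then show ?case using 0(5) by (rule notE)
next
  case (Suc n)
  note G_sets = Suc.prems(1) and G_sub = Suc.prems(2) and u_in_H = Suc.prems(3)
    and locally_const = Suc.prems(4)
  show ?case
  proof (cases "\<forall>x\<in>G. \<forall>y\<in>G. u x = u y")
    case True
    have "\<exists>h\<in>H. \<forall>x\<in>G. u x = h"
      by (rule ex_common_value) (use H_nonempty u_in_H True in blast)+
    then obtain h where "h \<in> H" "\<forall>x\<in>G. u x = h" by blast
    then show ?thesis using subset_piecewise[of "Suc n" H] by (intro bexI[of _ h]) auto
  next
    case False
    then obtain x0 y0 where "x0 \<in> G" "y0 \<in> G" "u x0 \<noteq> u y0" by blast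
    moreover have "G \<subseteq> {a..}" using G_sub by auto
    ultimately obtain c z where c_bounds: "a + w \<le> c" "c \<le> z" "z \<in> G" and gap: "G \<inter> {c - w<..<c} = {}"
      and before: "\<And>x y. x \<in> G \<inter> {..<c} \<Longrightarrow> y \<in> G \<inter> {..<c} \<Longrightarrow> u x = u y"
      using first_change_after_gap[of G a w u x0 y0] locally_const by blast
    have "measure lborel ({c..b} - G) + w < real (Suc n) * w"
      using measure_lborel_Diff_gap_le[OF G_sets gap c_bounds(1), of b] Suc.prems(5) c_bounds(2,3)
        G_sub w_pos
      by auto
    then have rest_small: "measure lborel ({c..b} - G) < real n * w" by (simp add: algebra_simps)
    then have n_pos: "0 < n" using measure_nonneg[of lborel "{c..b} - G"] by (cases "n = 0") auto
    have "\<exists>g\<in>piecewise n H. \<forall>x\<in>G \<inter> {c..}. g x = u x x"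
    proof (rule Suc.IH)
      show "G \<inter> {c..} \<in> sets borel" using G_sets by simp
      show "G \<inter> {c..} \<subseteq> {c..b}" using G_sub by auto
      have "{c..b} - G \<inter> {c..} = {c..b} - G" by auto
      then show "measure lborel ({c..b} - G \<inter> {c..}) < real n * w" using rest_small by simp
    qed (use u_in_H locally_const in blast)+
    then obtain g where g_rest: "g \<in> piecewise n H" "\<forall>x\<in>G \<inter> {c..}. g x = u x x" by blast
    have "\<exists>h\<in>H. \<forall>x\<in>G \<inter> {..<c}. u x = h"
      by (rule ex_common_value[OF H_nonempty _ before]) (use u_in_H in auto)
    then obtain h where h_before: "h \<in> H" "\<forall>x\<in>G \<inter> {..<c}. u x = h" by blast
    have "(if x \<le> c - w / 2 then h x else g x) = u x x" if "x \<in> G" for x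
      using that g_rest(2) h_before(2) gap w_pos by (cases "x < c") auto
    then show ?thesis
      by (intro bexI[OF _ piecewise_cons[OF n_pos g_rest(1) h_before(1), of "c - w / 2"]]) blast
  qed
qed

section \<open>Disagreement sets\<close>

definition disagreement :: "('a \<Rightarrow> 'y) \<Rightarrow> 'a set \<Rightarrow> ('a \<Rightarrow> 'y) \<Rightarrow> 'a set" where
  "disagreement f J h = {x\<in>J. f x \<noteq> h x}"

lemma disagreement_eq_Int: "disagreement f J h = {x. f x \<noteq> h x} \<inter> J"
  by (auto simp: disagreement_def)

lemma vc_dim_disagreement_le: "vc_dim (disagreement f J ` H) \<le> graph_dim H"
proof -
  let ?\<G> = "{{(x, h x) | x. True} | h. h \<in> H}" and ?g = "\<lambda>x. (x, f x)"
  have "enat (card A) \<le> graph_dim H" if A_shattered: "finite A" "shatters (disagreement f J ` H) A"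
    for A
  proof -
    have ex_cut: "\<exists>h\<in>H. disagreement f J h \<inter> A = B" if B_sub: "B \<subseteq> A" for B
      using A_shattered(2) B_sub unfolding shatters_def by blast
    have A_sub_J: "A \<subseteq> J"
    proof -
      obtain h where "disagreement f J h \<inter> A = A" using ex_cut[OF subset_refl] by blast
      then show ?thesis unfolding disagreement_def by blast
    qed
    have "shatters ?\<G> (?g ` A)"
      unfolding shatters_def
    proof (intro allI impI)
      fix B assume B_sub: "B \<subseteq> ?g ` A"
      obtain h where h_cut: "h \<in> H" "disagreement f J h \<inter> A = {x\<in>A. ?g x \<notin> B}"
        using ex_cut[of "{x\<in>A. ?g x \<notin> B}"] by auto
      have "f x = h x \<longleftrightarrow> ?g x \<in> B" if "x \<in> A" for x
      proof -
        have "f x \<noteq> h x \<longleftrightarrow> x \<in> disagreement f J h \<inter> A"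
          using that A_sub_J by (auto simp: disagreement_def)
        then show ?thesis unfolding h_cut(2) using that by blast
      qed
      then have "{(x, h x) | x. True} \<inter> ?g ` A = B" using B_sub by force
      then show "\<exists>S\<in>?\<G>. S \<inter> ?g ` A = B" using h_cut(1) by blast
    qed
    then have "enat (card (?g ` A)) \<le> graph_dim H"
      unfolding graph_dim_def using A_shattered(1) by (intro card_le_vc_dim) simp_all
    then show ?thesis by (simp add: card_image inj_on_def)
  qed
  then show ?thesis unfolding vc_dim_def by (intro SUP_least) auto
qed

lemma absolutely_continuous_PiM_lborel_unif01:
  assumes "finite I"
  shows "absolutely_continuous (\<Pi>\<^sub>M i\<in>I. lborel) (\<Pi>\<^sub>M i\<in>I. unif01)"
proof -
  have "(\<Pi>\<^sub>M i\<in>I. unif01) = density (\<Pi>\<^sub>M i\<in>I. lborel) (\<lambda>x. \<Prod>i\<in>I. indicator {0<..<1} (x i))"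
    using unif01.sigma_finite_measure_axioms unfolding unif01_eq_density
    by (intro PiM_density assms lborel.sigma_finite_measure_axioms) simp_all
  then show ?thesis by (simp add: absolutely_continuousI_density)
qed

lemma sets_completion_agreement_event:
  assumes traces_measurable: "trace_measurable Y H" and f_measurable: "f \<in> borel \<rightarrow>\<^sub>M Y"
    and Phi_sets: "\<And>Z. Z \<subseteq> {..<n} \<Longrightarrow> {x \<in> space (sample unif01 n). \<Phi> Z x} \<in> sets (sample unif01 n)"
  shows "{x \<in> space (sample unif01 n). \<exists>h\<in>H. \<Phi> {i\<in>{..<n}. h (x i) = f (x i)} x}
    \<in> sets (completion (sample unif01 n))"
proof -
  let ?agree = "\<lambda>Z. {x \<in> space (sample lborel n). \<exists>h\<in>H. {i\<in>{..<n}. h (x i) = f (x i)} = Z}"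
  have "sets (completion (sample lborel n)) \<subseteq> sets (completion (sample unif01 n))"
    using absolutely_continuous_PiM_lborel_unif01[of "{..<n}"]
    by (intro sets_completion_absolutely_continuous) (auto intro!: sets_PiM_cong)
  moreover have "?agree Z \<in> sets (completion (sample lborel n))" if "Z \<subseteq> {..<n}" for Z
    using traces_measurable f_measurable that unfolding trace_measurable_def by blast
  ultimately have "?agree Z \<inter> {x \<in> space (sample unif01 n). \<Phi> Z x}
      \<in> sets (completion (sample unif01 n))"
    if "Z \<subseteq> {..<n}" for Z
    using that Phi_sets by (intro sets.Int) (auto intro: sets_completionI_sets)
  then have "(\<Union>Z\<in>Pow {..<n}. ?agree Z \<inter> {x \<in> space (sample unif01 n). \<Phi> Z x})
      \<in> sets (completion (sample unif01 n))"
    by (intro sets.finite_UN) auto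
  also have "(\<Union>Z\<in>Pow {..<n}. ?agree Z \<inter> {x \<in> space (sample unif01 n). \<Phi> Z x})
      = {x \<in> space (sample unif01 n). \<exists>h\<in>H. \<Phi> {i\<in>{..<n}. h (x i) = f (x i)} x}"
    by (rule set_eqI) (simp add: space_PiM, blast)
  finally show ?thesis .
qed

lemma measurable_traces_disagreement:
  assumes "trace_measurable Y H" "f \<in> borel \<rightarrow>\<^sub>M Y" and J_sets: "J \<in> sets borel"
  shows "measurable_traces unif01 (disagreement f J ` H)"
  unfolding measurable_traces_def
proof (intro allI)
  fix n Z
  let ?Q = "sample unif01 n"
  have "{x \<in> space ?Q. Z \<in> traces (disagreement f J ` H) {..<n} x}
      = {x \<in> space ?Q. \<exists>h\<in>H. Z = {i\<in>{..<n}. x i \<in> J \<and> i \<notin> {i\<in>{..<n}. h (x i) = f (x i)}}}"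
    by (auto simp: traces_def disagreement_def image_iff eq_commute)
  also have "\<dots> \<in> sets (completion ?Q)"
  proof (rule sets_completion_agreement_event[OF assms(1,2)])
    fix V
    have "{x \<in> space ?Q. Z = {i\<in>{..<n}. x i \<in> J \<and> i \<notin> V}}
        = {x \<in> space ?Q. \<forall>i\<in>{..<n}. i \<in> Z \<longleftrightarrow> x i \<in> J \<and> i \<notin> V} \<inter> {x. Z \<subseteq> {..<n}}"
      by auto
    also have "\<dots> \<in> sets ?Q" using J_sets by (cases "Z \<subseteq> {..<n}") (auto, measurable)
    finally show "{x \<in> space ?Q. Z = {i\<in>{..<n}. x i \<in> J \<and> i \<notin> V}} \<in> sets ?Q" .
  qed
  finally show "{x \<in> space ?Q. Z \<in> traces (disagreement f J ` H) {..<n} x} \<in> sets (completion ?Q)" .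
qed

section \<open>Bad centres\<close>

definition window_error :: "(real \<Rightarrow> 'y) \<Rightarrow> real \<Rightarrow> real \<Rightarrow> (real \<Rightarrow> 'y) \<Rightarrow> real" where
  "window_error f r c h = measure (completion unif01) (disagreement f {c-r<..<c+r} h)"

definition bad_centres :: "(real \<Rightarrow> 'y) set \<Rightarrow> (real \<Rightarrow> 'y) \<Rightarrow> real \<Rightarrow> real \<Rightarrow> real set" where
  "bad_centres H f r \<rho> = {c \<in> {r..1-r}. \<forall>h\<in>H. \<rho> \<le> window_error f r c h}"

lemma abs_diff_less_of_same_cell:
  fixes x y r :: real
  assumes "0 \<le> x" "0 \<le> y" "0 < r" "nat \<lfloor>x / r\<rfloor> = nat \<lfloor>y / r\<rfloor>"
  shows "\<bar>x - y\<bar> < r"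
proof -
  have "\<lfloor>x / r\<rfloor> = \<lfloor>y / r\<rfloor>" using assms by (simp add: eq_nat_nat_iff)
  then have "\<bar>x / r - y / r\<bar> < 1"
    using floor_correct[of "x / r"] floor_correct[of "y / r"] by linarith
  then show ?thesis using assms(3) by (simp add: diff_divide_distrib[symmetric] abs_divide)
qed

lemma ex_finite_net:
  fixes G :: "real set" and r :: real
  assumes G_sub: "G \<subseteq> {0..<1}" and r_pos: "0 < r"
  shows "\<exists>Z. finite Z \<and> Z \<subseteq> G \<and> real (card Z) \<le> 1 / r + 1 \<and> (\<forall>x\<in>G. \<exists>z\<in>Z. \<bar>x - z\<bar> < r)"
proof -
  define K where "K = nat \<lceil>1 / r\<rceil>"
  define cell where "cell x = nat \<lfloor>x / r\<rfloor>" for x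
  define z where "z i = (SOME x. x \<in> G \<and> cell x = i)" for i
  have K_bounds: "1 / r \<le> real K" "real K \<le> 1 / r + 1" using r_pos by (simp_all add: K_def)
  have z_in_cell: "z (cell x) \<in> G \<and> cell (z (cell x)) = cell x" if "x \<in> G" for x
    unfolding z_def by (rule someI[of _ x]) (simp add: that)
  have "cell x < K" if "x \<in> G" for x
  proof -
    have "x / r < 1 / r" using that G_sub r_pos by (intro divide_strict_right_mono) auto
    then have "x / r < real K" using K_bounds(1) by linarith
    moreover have "0 \<le> x" using that G_sub by auto
    ultimately show ?thesis using r_pos by (simp add: cell_def nat_less_iff floor_less_iff)
  qed
  then have cells: "cell ` G \<subseteq> {..<K}" by auto
  then have finite_cells: "finite (cell ` G)" by (rule finite_subset) simp
  have "card (z ` cell ` G) \<le> K"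
    using card_image_le[OF finite_cells, of z] card_mono[OF finite_lessThan cells] by simp
  then have "real (card (z ` cell ` G)) \<le> 1 / r + 1" using K_bounds(2) by linarith
  moreover have "\<bar>x - z (cell x)\<bar> < r" if "x \<in> G" for x
    using that z_in_cell[OF that] G_sub r_pos
    by (intro abs_diff_less_of_same_cell) (auto simp: cell_def)
  moreover have "z ` cell ` G \<subseteq> G" using z_in_cell by auto
  ultimately show ?thesis using finite_cells by (intro exI[of _ "z ` cell ` G"]) auto
qed

context
  fixes H :: "(real \<Rightarrow> 'y) set" and f :: "real \<Rightarrow> 'y"
  assumes sets_disagreement: "\<And>h. h \<in> H \<Longrightarrow> {x. f x \<noteq> h x} \<in> sets (completion unif01)"
begin

lemma sets_disagreement_window: "h \<in> H \<Longrightarrow> J \<in> sets borel \<Longrightarrow> disagreement f J h \<in> sets (completion unif01)"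
  unfolding disagreement_eq_Int by (intro sets.Int sets_disagreement sets_completion_unif01_borel)

lemma window_error_shift_le:
  assumes h_in_H: "h \<in> H"
  shows "window_error f r c' h \<le> window_error f r c h + \<bar>c' - c\<bar>"
proof -
  let ?\<mu> = "measure (completion unif01)"
  let ?new = "{c'-r<..<c'+r} - {c-r<..<c+r}"
  have new_sets: "?new \<in> sets (completion unif01)" by (rule sets_completion_unif01_borel) simp
  have "window_error f r c' h \<le> ?\<mu> (disagreement f {c-r<..<c+r} h \<union> ?new)"
    unfolding window_error_def
  proof (rule completion_unif01.finite_measure_mono)
    show "disagreement f {c'-r<..<c'+r} h \<subseteq> disagreement f {c-r<..<c+r} h \<union> ?new"
      by (auto simp: disagreement_def)
  qed (intro sets.Un sets_disagreement_window[OF h_in_H] new_sets, simp)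
  also have "\<dots> \<le> window_error f r c h + ?\<mu> ?new"
    unfolding window_error_def using sets_disagreement_window[OF h_in_H] new_sets
    by (intro measure_Un_le) auto
  also have "?\<mu> ?new = measure unif01 ?new" by simp
  also have "\<dots> \<le> \<bar>c' - c\<bar>"
  proof (cases "c' \<le> c")
    case True
    then show ?thesis by (intro order_trans[OF measure_unif01_le[of _ "c' - r" "c - r"]]) auto
  next
    case False
    then show ?thesis by (intro order_trans[OF measure_unif01_le[of _ "c + r" "c' + r"]]) auto
  qed
  finally show ?thesis by simp
qed

lemma open_window_error_less:
  assumes "h \<in> H"
  shows "open {c. window_error f r c h < \<rho>}"
  unfolding open_dist
proof (intro ballI)
  fix c assume "c \<in> {c. window_error f r c h < \<rho>}"
  moreover have "window_error f r c' h < \<rho>" if "dist c' c < \<rho> - window_error f r c h" for c'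
    using window_error_shift_le[OF assms, of r c' c] that by (simp add: dist_real_def)
  ultimately show "\<exists>e>0. \<forall>c'. dist c' c < e \<longrightarrow> c' \<in> {c. window_error f r c h < \<rho>}"
    by (intro exI[of _ "\<rho> - window_error f r c h"]) auto
qed

lemma sets_bad_centres: "bad_centres H f r \<rho> \<in> sets borel"
proof -
  have "bad_centres H f r \<rho> = {r..1-r} - (\<Union>h\<in>H. {c. window_error f r c h < \<rho>})"
    by (auto simp: bad_centres_def not_less)
  moreover have "open (\<Union>h\<in>H. {c. window_error f r c h < \<rho>})"
    by (intro open_UN ballI open_window_error_less)
  ultimately show ?thesis by simp
qed

lemma close_centres_same_function:
  assumes crossings_null: "zero_measure_crossings H" and h_in_H: "h \<in> H" "h' \<in> H"
    and errors_less: "window_error f r c h < \<rho>" "window_error f r c' h' < \<rho>"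
    and centres_close: "c \<in> {r..1-r}" "c' \<in> {r..1-r}" "\<bar>c - c'\<bar> < 2 * r - 2 * \<rho>"
  shows "h = h'"
proof (rule ccontr)
  let ?U = "completion unif01"
  let ?N = "{x. h x = h' x}"
  let ?A = "disagreement f {c-r<..<c+r} h" and ?B = "disagreement f {c'-r<..<c'+r} h'"
  assume "h \<noteq> h'"
  then have crossing_null: "?N \<in> null_sets ?U"
    using crossings_null h_in_H
    by (intro null_sets_completion_unif01) (auto simp: zero_measure_crossings_def)
  have tolerance_pos: "0 < \<rho>"
    using errors_less(1) measure_nonneg[of ?U ?A] unfolding window_error_def by linarith
  define a where "a = max c c' - r"
  define b where "b = min c c' + r"
  have overlap_bounds: "0 \<le> a" "a \<le> b" "b \<le> 1" "2 * \<rho> < b - a"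
    using centres_close tolerance_pos by (auto simp: a_def b_def max_def min_def)
  have errors_sets: "?A \<in> sets ?U" "?B \<in> sets ?U"
    using h_in_H by (simp_all add: sets_disagreement_window)
  have "2 * \<rho> < measure ?U {a<..<b}"
    using overlap_bounds measure_unif01_greaterThanLessThan[of a b] by simp
  also have "\<dots> \<le> measure ?U (?A \<union> ?B \<union> ?N)"
  proof (rule completion_unif01.finite_measure_mono)
    show "{a<..<b} \<subseteq> ?A \<union> ?B \<union> ?N" unfolding disagreement_def a_def b_def by auto
  qed (intro sets.Un errors_sets null_setsD2[OF crossing_null])
  also have "\<dots> = measure ?U (?A \<union> ?B)"
    using errors_sets crossing_null by (intro measure_Un_null_set sets.Un)
  also have "\<dots> \<le> measure ?U ?A + measure ?U ?B" using errors_sets by (rule measure_Un_le)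
  finally show False using errors_less by (simp add: window_error_def)
qed

lemma measure_local_disagreement_le:
  fixes u :: "real \<Rightarrow> real \<Rightarrow> 'y"
  assumes G_sub: "G \<subseteq> {0..<1}" and r_pos: "0 < r"
    and u_close: "\<And>x. x \<in> G \<Longrightarrow> u x \<in> H" "\<And>x. x \<in> G \<Longrightarrow> window_error f r x (u x) \<le> \<rho>"
    and locally_const: "\<And>x y. x \<in> G \<Longrightarrow> y \<in> G \<Longrightarrow> \<bar>x - y\<bar> < r \<Longrightarrow> u x = u y" and tolerance_nonneg: "0 \<le> \<rho>"
  shows "\<exists>D\<in>sets (completion unif01). {x\<in>G. f x \<noteq> u x x} \<subseteq> D \<and>
    measure (completion unif01) D \<le> (1 / r + 1) * \<rho>"
proof -
  obtain Z where Z_net: "finite Z" "Z \<subseteq> G" "real (card Z) \<le> 1 / r + 1"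
    and Z_close: "\<And>x. x \<in> G \<Longrightarrow> \<exists>z\<in>Z. \<bar>x - z\<bar> < r"
    using ex_finite_net[OF G_sub r_pos] by blast
  define E where "E z = disagreement f {z - r<..<z + r} (u z)" for z
  have E_small: "E z \<in> sets (completion unif01)" "measure (completion unif01) (E z) \<le> \<rho>" if "z \<in> Z" for z
    using that Z_net(2) u_close
    by (auto simp: E_def sets_disagreement_window window_error_def[symmetric])
  have "\<exists>z\<in>Z. x \<in> E z" if x_disagrees: "x \<in> G" "f x \<noteq> u x x" for x
  proof -
    obtain z where z_close: "z \<in> Z" "\<bar>x - z\<bar> < r" using Z_close[OF x_disagrees(1)] by blast
    then have "u x = u z" using locally_const x_disagrees(1) Z_net(2) by blast
    then have "x \<in> E z" using x_disagrees(2) z_close(2) by (auto simp: E_def disagreement_def)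
    then show ?thesis using z_close(1) by blast
  qed
  then have disagreement_sub: "{x\<in>G. f x \<noteq> u x x} \<subseteq> (\<Union>z\<in>Z. E z)" by auto
  have "measure (completion unif01) (\<Union>z\<in>Z. E z) \<le> (\<Sum>z\<in>Z. measure (completion unif01) (E z))"
    using E_small(1) Z_net(1) by (intro measure_UNION_le) auto
  also have "\<dots> \<le> real (card Z) * \<rho>" using sum_bounded_above[of Z] E_small(2) by metis
  also have "\<dots> \<le> (1 / r + 1) * \<rho>" using Z_net(3) tolerance_nonneg by (intro mult_right_mono)
  finally have "measure (completion unif01) (\<Union>z\<in>Z. E z) \<le> (1 / r + 1) * \<rho>" .
  moreover have "(\<Union>z\<in>Z. E z) \<in> sets (completion unif01)"
    using Z_net(1) E_small(1) by (rule sets.finite_UN)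
  ultimately show ?thesis using disagreement_sub by blast
qed

lemma ex_piecewise_of_good_centres:
  assumes H_nonempty: "H \<noteq> {}" and crossings_null: "zero_measure_crossings H"
    and r_pos: "0 < r" and tolerance_le: "2 * \<rho> \<le> r"
    and bad_small: "measure unif01 (bad_centres H f r \<rho>) < real n * (2 * r - 2 * \<rho>)"
  defines "G \<equiv> {r..1-r} - bad_centres H f r \<rho>"
  shows "\<exists>g\<in>piecewise n H. \<exists>u. (\<forall>x\<in>G. u x \<in> H \<and> window_error f r x (u x) < \<rho> \<and> g x = u x x) \<and>
    (\<forall>x\<in>G. \<forall>y\<in>G. \<bar>x - y\<bar> < r \<longrightarrow> u x = u y)"
proof -
  let ?bad = "bad_centres H f r \<rho>"
  define u where "u c = (SOME h. h \<in> H \<and> window_error f r c h < \<rho>)" for c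
  have G_props: "G \<in> sets borel" "G \<subseteq> {r..1-r}" using sets_bad_centres by (auto simp: G_def)
  have u_close: "u c \<in> H \<and> window_error f r c (u c) < \<rho>" if "c \<in> G" for c
  proof -
    have "\<exists>h. h \<in> H \<and> window_error f r c h < \<rho>"
      using that by (auto simp: G_def bad_centres_def not_le)
    then show ?thesis unfolding u_def by (rule someI_ex)
  qed
  have locally_const: "u x = u y" if "x \<in> G" "y \<in> G" "\<bar>x - y\<bar> < 2 * r - 2 * \<rho>" for x y
    using close_centres_same_function[OF crossings_null] u_close that G_props(2) by blast
  have "?bad \<subseteq> {0<..<1}" using r_pos by (auto simp: bad_centres_def)
  then have "measure lborel ?bad = measure unif01 ?bad"
    using sets_bad_centres by (simp add: measure_def emeasure_unif01 Int_absorb1)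
  moreover have "{r..1-r} - G = ?bad" by (auto simp: G_def bad_centres_def)
  ultimately have complement_small: "measure lborel ({r..1-r} - G) < real n * (2 * r - 2 * \<rho>)"
    using bad_small by simp
  have "0 < 2 * r - 2 * \<rho>" using r_pos tolerance_le by simp
  then have "\<exists>g\<in>piecewise n H. \<forall>x\<in>G. g x = u x x"
    by (rule ex_piecewise_of_locally_constant[OF H_nonempty _ G_props _ locally_const
        complement_small]) (use u_close in blast)
  then obtain g where "g \<in> piecewise n H" "\<forall>x\<in>G. g x = u x x" by blast
  moreover have "u x = u y" if "x \<in> G" "y \<in> G" "\<bar>x - y\<bar> < r" for x y
    by (rule locally_const[OF that(1,2)]) (use that(3) tolerance_le in linarith)
  ultimately show ?thesis using u_close by (intro bexI[of _ g] exI[of _ u]) blast+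
qed

lemma ex_piecewise_differ_le:
  assumes H_nonempty: "H \<noteq> {}" and crossings_null: "zero_measure_crossings H"
    and r_pos: "0 < r" and tolerance_bounds: "0 < \<rho>" "2 * \<rho> \<le> r"
    and bad_small: "measure unif01 (bad_centres H f r \<rho>) < real n * (2 * r - 2 * \<rho>)"
  shows "\<exists>g\<in>piecewise n H.
    differ_le unif01 (2 * r + measure unif01 (bad_centres H f r \<rho>) + (1 / r + 1) * \<rho>) f g"
proof -
  let ?U = "completion unif01" and ?bad = "bad_centres H f r \<rho>"
  define G where "G = {r..1-r} - ?bad"
  obtain g u where g_piecewise: "g \<in> piecewise n H"
    and u_close: "\<forall>x\<in>G. u x \<in> H \<and> window_error f r x (u x) < \<rho> \<and> g x = u x x"
    and locally_const: "\<forall>x\<in>G. \<forall>y\<in>G. \<bar>x - y\<bar> < r \<longrightarrow> u x = u y"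
    using ex_piecewise_of_good_centres[OF H_nonempty crossings_null r_pos tolerance_bounds(2)
      bad_small] unfolding G_def
    by blast
  have "\<exists>D\<in>sets ?U. {x\<in>G. f x \<noteq> u x x} \<subseteq> D \<and> measure ?U D \<le> (1 / r + 1) * \<rho>"
  proof (rule measure_local_disagreement_le[where u = u])
    show "G \<subseteq> {0..<1}" using r_pos by (auto simp: G_def)
  qed (use u_close locally_const r_pos tolerance_bounds(1) less_imp_le in blast)+
  then obtain D where D_cover: "D \<in> sets ?U" "{x\<in>G. f x \<noteq> u x x} \<subseteq> D" "measure ?U D \<le> (1 / r + 1) * \<rho>"
    by blast
  have outside_small: "measure unif01 ({..<r} \<union> {1-r<..} \<union> ?bad) \<le> 2 * r + measure unif01 ?bad"
    using measure_Un_le[of "{..<r} \<union> {1-r<..}" unif01 ?bad] measure_unif01_near_boundary_le[of r]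
      sets_bad_centres r_pos by simp
  have outside_sets: "{..<r} \<union> {1-r<..} \<union> ?bad \<in> sets ?U"
    using sets_bad_centres by (intro sets_completion_unif01_borel) auto
  have "measure ?U ({..<r} \<union> {1-r<..} \<union> ?bad \<union> D) \<le> 2 * r + measure unif01 ?bad + (1 / r + 1) * \<rho>"
    using measure_Un_le[OF outside_sets D_cover(1)] outside_small D_cover(3) sets_bad_centres
    by simp
  moreover have "{x. f x \<noteq> g x} \<subseteq> {..<r} \<union> {1-r<..} \<union> ?bad \<union> D"
  proof
    fix x assume x_differs: "x \<in> {x. f x \<noteq> g x}"
    show "x \<in> {..<r} \<union> {1-r<..} \<union> ?bad \<union> D"
    proof (cases "x \<in> G")
      case True
      then have "f x \<noteq> u x x" using x_differs u_close by simp
      then show ?thesis using True D_cover(2) by blast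
    qed (auto simp: G_def)
  qed
  ultimately have "differ_le unif01 (2 * r + measure unif01 ?bad + (1 / r + 1) * \<rho>) f g"
    unfolding differ_le_def by (intro bexI[OF _ sets.Un[OF outside_sets D_cover(1)]]) simp
  then show ?thesis using g_piecewise by blast
qed

end

lemma ex_piece_count:
  fixes k :: nat and \<epsilon> r \<rho> \<mu> :: real
  assumes k_pos: "0 < k" and eps_bounds: "0 < \<epsilon>" "\<epsilon> \<le> 1" and r_eq: "r = \<epsilon> / (32 * real k)"
    and rho_eq: "\<rho> = \<epsilon> * r / 8"
    and mu_bounds: "0 \<le> \<mu>" "\<mu> < 2 * r * (real k - 1) + \<epsilon>\<^sup>2 / 64"
  shows "\<exists>n\<ge>k. \<mu> < real n * (2 * r - 2 * \<rho>) \<and> (real n - real k) / real k \<le> \<epsilon> / 2"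
proof -
  define w where "w = 2 * r - 2 * \<rho>"
  define v where "v = real k - 1 + real k * \<epsilon> / 2"
  define n where "n = max k (nat \<lfloor>\<mu> / w\<rfloor> + 1)"
  have r_pos: "0 < r" using k_pos eps_bounds by (simp add: r_eq)
  have w_eq: "w = 2 * r * (1 - \<epsilon> / 8)" by (simp add: w_def rho_eq algebra_simps)
  have w_pos: "0 < w" using r_pos eps_bounds by (simp add: w_eq)
  have "2 * r * (real k - 1) + \<epsilon>\<^sup>2 / 64 = 2 * r * (real k - 1 + real k * \<epsilon> / 4)"
    using k_pos by (simp add: r_eq field_simps power2_eq_square)
  also have "real k - 1 + real k * \<epsilon> / 4 \<le> v * (1 - \<epsilon> / 8)"
  proof -
    define y where "y = real k * \<epsilon>"
    have y_bounds: "0 \<le> y" "\<epsilon> * y \<le> y" using eps_bounds by (auto simp: y_def mult_left_le_one_le)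
    have "v * (1 - \<epsilon> / 8) = real k - 1 + y / 2 - y / 8 + \<epsilon> / 8 - \<epsilon> * y / 16"
      by (simp add: v_def y_def algebra_simps)
    then show ?thesis using y_bounds eps_bounds by (simp add: y_def[symmetric])
  qed
  finally have "\<mu> < v * w" using mu_bounds(2) r_pos by (simp add: w_eq algebra_simps)
  then have "\<mu> / w < v" using w_pos by (simp add: field_simps)
  moreover have "real (nat \<lfloor>\<mu> / w\<rfloor>) \<le> \<mu> / w" using mu_bounds(1) w_pos by simp
  ultimately have "real n - real k \<le> real k * \<epsilon> / 2"
    using eps_bounds by (auto simp: n_def v_def max_def)
  then have "(real n - real k) / real k \<le> \<epsilon> / 2" using k_pos by (simp add: field_simps)
  moreover have "\<mu> / w < real n" by (simp add: n_def) linarith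
  then have "\<mu> < real n * w" using w_pos by (simp add: field_simps)
  ultimately show ?thesis by (intro exI[of _ n]) (auto simp: n_def w_def)
qed

lemma measure_bad_centres_ge_of_far:
  fixes k :: nat
  assumes H_nonempty: "H \<noteq> {}" and crossings_null: "zero_measure_crossings H" and k_pos: "0 < k"
    and eps_bounds: "0 < \<epsilon>" "\<epsilon> \<le> 1"
    and far: "\<epsilon> \<le> fdist_class unif01 f (piecewise k H)"
    and r_eq: "r = \<epsilon> / (32 * real k)" and rho_eq: "\<rho> = \<epsilon> * r / 8"
  shows "2 * r * (real k - 1) + \<epsilon>\<^sup>2 / 64 \<le> measure unif01 (bad_centres H f r \<rho>)"
proof (rule ccontr)
  let ?\<mu> = "measure unif01 (bad_centres H f r \<rho>)"
  assume few: "\<not> ?thesis"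
  have r_bounds: "0 < r" "32 * (real k * r) = \<epsilon>" using k_pos eps_bounds by (simp_all add: r_eq)
  have r_le: "32 * r \<le> \<epsilon>" using k_pos eps_bounds by (simp add: r_eq field_simps)
  have rho_bounds: "0 < \<rho>" "2 * \<rho> \<le> r" using r_bounds eps_bounds by (simp_all add: rho_eq)
  have disagreement_sets: "{x. f x \<noteq> h x} \<in> sets (completion unif01)" if "h \<in> H" for h
    using sets_disagreement_of_far_piecewise[OF eps_bounds(1) far k_pos that] by simp
  obtain n where n_pieces: "k \<le> n" "?\<mu> < real n * (2 * r - 2 * \<rho>)" "(real n - real k) / real k \<le> \<epsilon> / 2"
    using ex_piece_count[OF k_pos eps_bounds r_eq rho_eq, of ?\<mu>] few by auto
  obtain g where g_approx: "g \<in> piecewise n H" "differ_le unif01 (2 * r + ?\<mu> + (1 / r + 1) * \<rho>) f g"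
    using ex_piecewise_differ_le[OF disagreement_sets H_nonempty crossings_null r_bounds(1)
      rho_bounds n_pieces(2)]
    by blast
  obtain g' where k_pieces: "g' \<in> piecewise k H" "differ_le unif01 ((real n - real k) / real k) g g'"
    using unif01.piecewise_approx[OF k_pos n_pieces(1) g_approx(1)] by blast
  have "\<epsilon> \<le> fdist unif01 f g'" using far fdist_class_le[OF k_pieces(1)] by (rule order_trans)
  also have "\<dots> \<le> 2 * r + ?\<mu> + (1 / r + 1) * \<rho> + (real n - real k) / real k"
    by (intro fdist_le_of_differ_le differ_le_trans[OF g_approx(2) k_pieces(2)]
        unif01.prob_space_axioms)
  also have "(1 / r + 1) * \<rho> \<le> \<epsilon> / 8 + \<epsilon> / 8 * (1 / 32)"
  proof -
    have "(1 / r + 1) * \<rho> = \<epsilon> / 8 + \<epsilon> / 8 * r" using r_bounds by (simp add: rho_eq field_simps)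
    also have "\<dots> \<le> \<epsilon> / 8 + \<epsilon> / 8 * (1 / 32)"
      using r_le eps_bounds by (intro add_left_mono mult_left_mono) auto
    finally show ?thesis .
  qed
  also have "?\<mu> \<le> \<epsilon> / 16 + \<epsilon> / 64"
  proof -
    have "2 * r * (real k - 1) \<le> \<epsilon> / 16" using r_bounds by (simp add: algebra_simps)
    moreover have "\<epsilon>\<^sup>2 \<le> \<epsilon>" using eps_bounds by (simp add: power2_eq_square mult_left_le)
    ultimately show ?thesis using few by linarith
  qed
  finally show False using r_le n_pieces(3) eps_bounds by linarith
qed

section \<open>Rejection of a block\<close>

definition window_fits :: "(real \<Rightarrow> 'y) set \<Rightarrow> real \<Rightarrow> nat \<Rightarrow> real \<Rightarrow> (nat \<Rightarrow> real) \<Rightarrow> (nat \<Rightarrow> 'y) \<Rightarrow> bool" where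
  "window_fits H r m c x a \<longleftrightarrow> (\<exists>h\<in>H. \<forall>i<m. \<bar>x i - c\<bar> < r \<longrightarrow> h (x i) = a i)"

text \<open>A block consists of \<open>m\<close> sample points followed by the centre of its window, at index \<open>m\<close>.\<close>

definition block_rejects :: "(real \<Rightarrow> 'y) set \<Rightarrow> real \<Rightarrow> nat \<Rightarrow> (nat \<Rightarrow> real) \<Rightarrow> (nat \<Rightarrow> 'y) \<Rightarrow> bool" where
  "block_rejects H r m y a \<longleftrightarrow> y m \<in> {r..1-r} \<and> \<not> window_fits H r m (y m) y a"

definition reject_event :: "(real \<Rightarrow> 'y) set \<Rightarrow> (real \<Rightarrow> 'y) \<Rightarrow> real \<Rightarrow> nat \<Rightarrow> (nat \<Rightarrow> real) set" where
  "reject_event H f r m = {y \<in> space (sample unif01 (Suc m)). block_rejects H r m y (\<lambda>i. f (y i))}"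

lemma sets_window_fits_event:
  assumes "trace_measurable Y H" "f \<in> borel \<rightarrow>\<^sub>M Y"
  shows "{y \<in> space (sample unif01 (Suc m)). window_fits H r m (y m) y (\<lambda>i. f (y i))}
    \<in> sets (completion (sample unif01 (Suc m)))"
proof -
  let ?Q = "sample unif01 (Suc m)"
  have "{y \<in> space ?Q. window_fits H r m (y m) y (\<lambda>i. f (y i))}
      = {y \<in> space ?Q. \<exists>h\<in>H. \<forall>i\<in>{..<m}. \<bar>y i - y m\<bar> < r \<longrightarrow> i \<in> {i\<in>{..<Suc m}. h (y i) = f (y i)}}"
    by (auto simp: window_fits_def)
  also have "\<dots> \<in> sets (completion ?Q)"
  proof (rule sets_completion_agreement_event[OF assms])
    fix Z :: "nat set"
    have component_measurable: "(\<lambda>y. y i) \<in> borel_measurable ?Q" if "i < Suc m" for i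
      using measurable_component_singleton[of i "{..<Suc m}" "\<lambda>_. unif01"] that by simp
    show "{y \<in> space ?Q. \<forall>i\<in>{..<m}. \<bar>y i - y m\<bar> < r \<longrightarrow> i \<in> Z} \<in> sets ?Q"
    proof (rule sets.sets_Collect_finite_All)
      fix i assume "i \<in> {..<m}"
      then have [measurable]: "(\<lambda>y. y i) \<in> borel_measurable ?Q" "(\<lambda>y. y m) \<in> borel_measurable ?Q"
        using component_measurable by auto
      show "{y \<in> space ?Q. \<bar>y i - y m\<bar> < r \<longrightarrow> i \<in> Z} \<in> sets ?Q" by measurable
    qed simp
  qed
  finally show ?thesis .
qed

lemma sets_reject_event:
  assumes "trace_measurable Y H" "f \<in> borel \<rightarrow>\<^sub>M Y"
  shows "reject_event H f r m \<in> sets (completion (sample unif01 (Suc m)))"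
proof -
  let ?Q = "sample unif01 (Suc m)"
  have "reject_event H f r m = {y \<in> space ?Q. y m \<in> {r..1-r}} -
      {y \<in> space ?Q. window_fits H r m (y m) y (\<lambda>i. f (y i))}"
    by (auto simp: reject_event_def block_rejects_def)
  moreover have "{y \<in> space ?Q. y m \<in> {r..1-r}} \<in> sets (completion ?Q)"
    by (intro unif01.sets_completion_component sets_completion_unif01_borel) auto
  ultimately show ?thesis using sets_window_fits_event[OF assms] by (simp only: sets.Diff)
qed

lemma measure_reject_event_le:
  assumes f_piecewise: "f \<in> piecewise k H" and r_nonneg: "0 \<le> r"
  shows "measure (completion (sample unif01 (Suc m))) (reject_event H f r m) \<le> 2 * r * (real k - 1)"
proof -
  let ?Q = "sample unif01 (Suc m)"
  interpret Q: prob_space "completion ?Q" by (rule unif01.prob_space_completion_iid)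
  obtain S where S_breakpoints: "finite S" "card S < k"
    and single_piece: "\<And>c r. \<forall>s\<in>S. r \<le> \<bar>s - c\<bar> \<Longrightarrow> \<exists>h\<in>H. \<forall>x. \<bar>x - c\<bar> < r \<longrightarrow> f x = h x"
    using piecewise_breakpoints[OF f_piecewise] by blast
  define C where "C = (\<Union>s\<in>S. {s - r<..<s + r})"
  have C_borel: "C \<in> sets borel" unfolding C_def by (intro borel_open open_UN) auto
  then have C_sets: "C \<in> sets (completion unif01)" by (rule sets_completion_unif01_borel)
  have "reject_event H f r m \<subseteq> {y \<in> space ?Q. y m \<in> C}"
  proof
    fix y assume y_rejected: "y \<in> reject_event H f r m"
    have "y m \<in> C"
    proof (rule ccontr)
      assume "y m \<notin> C"
      then have "\<forall>s\<in>S. r \<le> \<bar>s - y m\<bar>" by (force simp: C_def)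
      then obtain h where "h \<in> H" "\<forall>x. \<bar>x - y m\<bar> < r \<longrightarrow> f x = h x" using single_piece by blast
      then show False
        using y_rejected by (auto simp: reject_event_def block_rejects_def window_fits_def)
    qed
    then show "y \<in> {y \<in> space ?Q. y m \<in> C}" using y_rejected by (simp add: reject_event_def)
  qed
  then have "measure (completion ?Q) (reject_event H f r m)
      \<le> measure (completion ?Q) {y \<in> space ?Q. y m \<in> C}"
    by (intro Q.finite_measure_mono unif01.sets_completion_component C_sets) auto
  also have "\<dots> = measure unif01 C"
    using unif01.measure_completion_component[OF C_sets, of m "{..<Suc m}"] C_borel by simp
  also have "\<dots> \<le> (\<Sum>s\<in>S. measure unif01 {s - r<..<s + r})"
    unfolding C_def using S_breakpoints(1) by (intro measure_UNION_le) auto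
  also have "\<dots> \<le> (\<Sum>s\<in>S. 2 * r)"
  proof (rule sum_mono)
    fix s
    have "measure unif01 {s - r<..<s + r} \<le> (s + r) - (s - r)"
      using r_nonneg by (intro measure_unif01_le) auto
    then show "measure unif01 {s - r<..<s + r} \<le> 2 * r" by simp
  qed
  also have "\<dots> \<le> 2 * r * (real k - 1)"
    using S_breakpoints(2) r_nonneg
    by (simp add: mult.commute mult_left_mono of_nat_diff[symmetric])
  finally show ?thesis .
qed

context
  fixes Y :: "'y measure" and H :: "(real \<Rightarrow> 'y) set" and f :: "real \<Rightarrow> 'y"
    and d m b :: nat and r \<rho> :: real
  assumes traces_measurable: "trace_measurable Y H" and f_measurable: "f \<in> borel \<rightarrow>\<^sub>M Y"
    and graph_dim_le: "graph_dim H \<le> enat d"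
    and disagreement_sets: "\<And>h. h \<in> H \<Longrightarrow> {x. f x \<noteq> h x} \<in> sets (completion unif01)"
    and r_nonneg: "0 \<le> r" and hits_likely: "2 ^ b * exp (- \<rho> * real m / 2) \<le> 1 / 2"
begin

lemma measure_window_fits_le:
  assumes c_bad: "c \<in> bad_centres H f r \<rho>"
  shows "measure (completion (sample unif01 m))
      {x \<in> space (sample unif01 m). window_fits H r m c x (\<lambda>i. f (x i))}
    \<le> double_sample_bound d m b (2 * r)"
proof -
  let ?J = "{c-r<..<c+r}"
  let ?\<C> = "disagreement f ?J ` H"
  have "{x \<in> space (sample unif01 m). window_fits H r m c x (\<lambda>i. f (x i))} = unhit_samples unif01 ?\<C> m"
  proof -
    have "(\<bar>x - c\<bar> < r \<longrightarrow> h x = f x) \<longleftrightarrow> x \<notin> disagreement f ?J h" for x h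
      by (auto simp: disagreement_def)
    then show ?thesis by (simp add: window_fits_def unhit_samples_def empty_in_traces_iff Ball_def)
  qed
  moreover have "measure (completion (sample unif01 m)) (unhit_samples unif01 ?\<C> m)
      \<le> double_sample_bound d m b (measure unif01 ?J)"
  proof (rule unif01.measure_unhit_samples_le[OF _ _ _ _ _ _ hits_likely])
    show "measurable_traces unif01 ?\<C>"
      using traces_measurable f_measurable by (rule measurable_traces_disagreement) simp
    show "vc_dim ?\<C> \<le> enat d" using vc_dim_disagreement_le graph_dim_le by (rule order_trans)
    show "\<Union>?\<C> \<subseteq> ?J" by (auto simp: disagreement_def)
    show "?\<C> \<subseteq> sets (completion unif01)"
      using sets_disagreement_window[OF disagreement_sets] by auto
    show "\<rho> \<le> measure (completion unif01) C" if "C \<in> ?\<C>" for C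
      using c_bad that by (auto simp: bad_centres_def window_error_def)
  qed simp
  moreover have "measure unif01 ?J = 2 * r"
    using c_bad r_nonneg by (subst measure_unif01_greaterThanLessThan) (auto simp: bad_centres_def)
  ultimately show ?thesis by simp
qed

definition missed_bad_centre :: "(nat \<Rightarrow> real) set" where
  "missed_bad_centre = {y \<in> space (sample unif01 (Suc m)). y m \<in> bad_centres H f r \<rho>} \<inter>
    {y \<in> space (sample unif01 (Suc m)). window_fits H r m (y m) y (\<lambda>i. f (y i))}"

lemma
  shows sets_bad_centre_event:
      "{y \<in> space (sample unif01 (Suc m)). y m \<in> bad_centres H f r \<rho>}
          \<in> sets (completion (sample unif01 (Suc m)))"
    and measure_bad_centre_event:
      "measure (completion (sample unif01 (Suc m)))
          {y \<in> space (sample unif01 (Suc m)). y m \<in> bad_centres H f r \<rho>}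
        = measure unif01 (bad_centres H f r \<rho>)"
proof -
  have bad_borel: "bad_centres H f r \<rho> \<in> sets borel"
    by (rule sets_bad_centres[OF disagreement_sets])
  then have bad_sets: "bad_centres H f r \<rho> \<in> sets (completion unif01)"
    by (rule sets_completion_unif01_borel)
  show "{y \<in> space (sample unif01 (Suc m)). y m \<in> bad_centres H f r \<rho>}
      \<in> sets (completion (sample unif01 (Suc m)))"
    using bad_sets by (rule unif01.sets_completion_component) simp
  show "measure (completion (sample unif01 (Suc m)))
      {y \<in> space (sample unif01 (Suc m)). y m \<in> bad_centres H f r \<rho>}
      = measure unif01 (bad_centres H f r \<rho>)"
    using unif01.measure_completion_component[OF bad_sets, of m "{..<Suc m}"] bad_borel by simp
qed

lemma sets_missed_bad_centre: "missed_bad_centre \<in> sets (completion (sample unif01 (Suc m)))"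
  unfolding missed_bad_centre_def
  by (rule sets.Int[OF sets_bad_centre_event sets_window_fits_event[OF traces_measurable f_measurable]])

lemma measure_missed_bad_centre_le:
  "measure (completion (sample unif01 (Suc m))) missed_bad_centre \<le> double_sample_bound d m b (2 * r)"
proof (rule unif01.measure_completion_sample_Suc_le[OF sets_missed_bad_centre])
  show bound_nonneg: "0 \<le> double_sample_bound d m b (2 * r)"
    using r_nonneg by (intro double_sample_bound_nonneg) simp
  fix c
  let ?S = "{x \<in> space (sample unif01 m). x(m := c) \<in> missed_bad_centre}"
  show "measure (completion (sample unif01 m)) ?S \<le> double_sample_bound d m b (2 * r)"
  proof (cases "c \<in> bad_centres H f r \<rho>")
    case True
    have "x(m := c) \<in> space (sample unif01 (Suc m))" if "x \<in> space (sample unif01 m)" for x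
      using that by (auto simp: space_PiM PiE_iff extensional_def)
    then have "?S = {x \<in> space (sample unif01 m). window_fits H r m c x (\<lambda>i. f (x i))}"
      using True
      by (intro Collect_cong conj_cong refl) (simp add: missed_bad_centre_def window_fits_def)
    then show ?thesis using measure_window_fits_le[OF True] by simp
  next
    case False
    then have "?S = {}" by (simp add: missed_bad_centre_def)
    then show ?thesis using bound_nonneg by (simp only: measure_empty)
  qed
qed

lemma measure_reject_event_ge:
  "measure unif01 (bad_centres H f r \<rho>) - double_sample_bound d m b (2 * r)
    \<le> measure (completion (sample unif01 (Suc m))) (reject_event H f r m)"
proof -
  let ?Q = "sample unif01 (Suc m)"
  interpret Q: prob_space "completion ?Q" by (rule unif01.prob_space_completion_iid)
  have reject_sets: "reject_event H f r m \<in> Q.events"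
    by (rule sets_reject_event[OF traces_measurable f_measurable])
  have "measure unif01 (bad_centres H f r \<rho>) = Q.prob {y \<in> space ?Q. y m \<in> bad_centres H f r \<rho>}"
    by (rule measure_bad_centre_event[symmetric])
  also have "\<dots> \<le> Q.prob (reject_event H f r m \<union> missed_bad_centre)"
  proof (rule Q.finite_measure_mono)
    have "c \<in> {r..1-r}" if "c \<in> bad_centres H f r \<rho>" for c
      using that unfolding bad_centres_def by blast
    then show "{y \<in> space ?Q. y m \<in> bad_centres H f r \<rho>} \<subseteq> reject_event H f r m \<union> missed_bad_centre"
      unfolding reject_event_def block_rejects_def missed_bad_centre_def by blast
  qed (intro sets.Un reject_sets sets_missed_bad_centre)
  also have "\<dots> \<le> Q.prob (reject_event H f r m) + Q.prob missed_bad_centre"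
    using reject_sets sets_missed_bad_centre by (rule measure_Un_le)
  finally show ?thesis using measure_missed_bad_centre_le by linarith
qed

end

section \<open>The block tester\<close>

primrec ask :: "nat list \<Rightarrow> ((nat \<Rightarrow> 'y) \<Rightarrow> bool) \<Rightarrow> (nat \<Rightarrow> 'y) \<Rightarrow> 'y strategy" where
  "ask [] D a = (if D a then Accept else Reject)"
| "ask (i # is) D a = Query i (\<lambda>y. ask is D (a(i := y)))"

lemma queries_ask: "queries (ask is D a0) a = is"
  by (induction "is" arbitrary: a0) auto

lemma accepts_ask: "accepts (ask is D a0) a = D (\<lambda>i. if i \<in> set is then a i else a0 i)"
proof (induction "is" arbitrary: a0)
  case (Cons i "is")
  have "(\<lambda>j. if j \<in> set is then a j else (a0(i := a i)) j)
      = (\<lambda>j. if j \<in> set (i # is) then a j else a0 j)"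
    by auto
  then show ?case using Cons.IH by simp
qed simp

definition centre :: "nat \<Rightarrow> nat \<Rightarrow> nat" where
  "centre m i = (i div Suc m) * Suc m + m"

definition window_indices :: "nat \<Rightarrow> nat \<Rightarrow> real \<Rightarrow> (nat \<Rightarrow> real) \<Rightarrow> nat list" where
  "window_indices N m r x = filter (\<lambda>i. i mod Suc m < m \<and> \<bar>x i - x (centre m i)\<bar> < r) [0..<N * Suc m]"

text \<open>
  The query budget \<open>q\<close> will exceed the expected number of points in all windows by a factor 10, so
  the first branch is rarely taken.
\<close>

definition block_tester ::
    "(real \<Rightarrow> 'y) set \<Rightarrow> nat \<Rightarrow> nat \<Rightarrow> real \<Rightarrow> real \<Rightarrow> nat \<Rightarrow> (nat \<Rightarrow> real) \<Rightarrow> 'y strategy" where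
  "block_tester H N m r \<theta> q x =
    (if q < length (window_indices N m r x) then Accept
     else ask (window_indices N m r x)
       (\<lambda>a. real (card {j. j < N \<and> block_rejects H r m (block (Suc m) j x) (block (Suc m) j a)}) \<le> \<theta>)
       (\<lambda>_. undefined))"

lemma queries_block_tester:
  "set (queries (block_tester H N m r \<theta> q x) a) \<subseteq> {..<N * Suc m}"
  "length (queries (block_tester H N m r \<theta> q x) a) \<le> q"
  by (auto simp: block_tester_def queries_ask window_indices_def)

lemma block_rejects_cong:
  assumes "\<And>i. i < m \<Longrightarrow> \<bar>y i - y m\<bar> < r \<Longrightarrow> a i = a' i"
  shows "block_rejects H r m y a = block_rejects H r m y a'"
proof -
  have "(\<forall>i<m. \<bar>y i - y m\<bar> < r \<longrightarrow> h (y i) = a i) \<longleftrightarrow> (\<forall>i<m. \<bar>y i - y m\<bar> < r \<longrightarrow> h (y i) = a' i)" for h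
    using assms by auto
  then show ?thesis by (simp add: block_rejects_def window_fits_def)
qed

lemma block_index_in_window_indices:
  assumes "i < m" "j < N" "\<bar>block (Suc m) j x i - block (Suc m) j x m\<bar> < r"
  shows "j * Suc m + i \<in> set (window_indices N m r x)"
proof -
  have "(j * Suc m + i) mod Suc m = i" "centre m (j * Suc m + i) = j * Suc m + m"
    using assms(1)
    by (simp_all only: centre_def mod_mult_self3 div_mult_self3 mod_less div_less less_Suc_eq) simp_all
  moreover have "j * Suc m + i < N * Suc m" using assms(1,2) by (intro block_index_less) auto
  ultimately show ?thesis using assms(1,3) by (simp add: window_indices_def block_def)
qed

lemma accepts_block_tester:
  "accepts (block_tester H N m r \<theta> q x) (\<lambda>i. f (x i)) \<longleftrightarrow>
    q < length (window_indices N m r x) \<or> real (block_count (Suc m) N (reject_event H f r m) x) \<le> \<theta>"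
proof -
  let ?a = "\<lambda>i. if i \<in> set (window_indices N m r x) then f (x i) else undefined"
  have "block_rejects H r m (block (Suc m) j x) (block (Suc m) j ?a)
      \<longleftrightarrow> block (Suc m) j x \<in> reject_event H f r m"
    if j_less: "j < N" for j
  proof -
    have "block_rejects H r m (block (Suc m) j x) (block (Suc m) j ?a)
        = block_rejects H r m (block (Suc m) j x) (\<lambda>i. f (block (Suc m) j x i))"
    proof (rule block_rejects_cong)
      fix i assume i_in_window: "i < m" "\<bar>block (Suc m) j x i - block (Suc m) j x m\<bar> < r"
      show "block (Suc m) j ?a i = f (block (Suc m) j x i)"
        using block_index_in_window_indices[OF i_in_window(1) j_less i_in_window(2)] i_in_window(1)
        by (simp add: block_def)
    qed
    then show ?thesis by (simp add: reject_event_def space_PiM block_def)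
  qed
  then have "{j. j < N \<and> block_rejects H r m (block (Suc m) j x) (block (Suc m) j ?a)}
      = {j. j < N \<and> block (Suc m) j x \<in> reject_event H f r m}" by blast
  then show ?thesis
    by (cases "q < length (window_indices N m r x)")
       (simp_all add: block_tester_def accepts_ask block_count_def)
qed

lemma
  fixes I :: "nat set"
  assumes "i \<in> I" "j \<in> I" "i \<noteq> j" and r_nonneg: "0 \<le> r"
  shows sets_completion_close_pair:
      "{x \<in> space (\<Pi>\<^sub>M i\<in>I. unif01). \<bar>x i - x j\<bar> < r} \<in> sets (completion (\<Pi>\<^sub>M i\<in>I. unif01))"
    and measure_completion_close_pair_le:
      "measure (completion (\<Pi>\<^sub>M i\<in>I. unif01)) {x \<in> space (\<Pi>\<^sub>M i\<in>I. unif01). \<bar>x i - x j\<bar> < r} \<le> 2 * r"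
proof -
  let ?P = "\<Pi>\<^sub>M i\<in>I. unif01" and ?Q = "sample unif01 (Suc (Suc 0))"
  define t where "t l = (if l = 0 then j else i)" for l :: nat
  let ?T = "\<lambda>x. \<lambda>l\<in>{..<Suc (Suc 0)}. x (t l)"
  let ?E = "{y \<in> space ?Q. \<bar>y (Suc 0) - y 0\<bar> < r}"
  have T_measurable: "?T \<in> ?P \<rightarrow>\<^sub>M ?Q"
    using assms(1,2) by (intro unif01.measurable_reindex) (auto simp: t_def)
  have T_distr: "distr ?P ?Q ?T = ?Q"
    using assms(1-3) by (intro unif01.distr_reindex) (auto simp: t_def inj_on_def less_Suc_eq)
  have [measurable]: "(\<lambda>y. y 0) \<in> borel_measurable ?Q" "(\<lambda>y. y (Suc 0)) \<in> borel_measurable ?Q"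
    using measurable_component_singleton[of _ "{..<Suc (Suc 0)}" "\<lambda>_. unif01"] by simp_all
  have "?E \<in> sets ?Q" by measurable
  then have E_sets: "?E \<in> sets (completion ?Q)" by (rule sets_completionI_sets)
  have close_eq_vimage: "{x \<in> space ?P. \<bar>x i - x j\<bar> < r} = ?T -` ?E \<inter> space ?P"
    using assms(1,2) by (auto simp: t_def space_PiM)
  show "{x \<in> space ?P. \<bar>x i - x j\<bar> < r} \<in> sets (completion ?P)"
    unfolding close_eq_vimage by (rule sets_completion_vimage[OF T_measurable T_distr E_sets])
  have "measure (completion ?Q) ?E \<le> 2 * r"
  proof (rule unif01.measure_completion_sample_Suc_le[OF E_sets])
    fix c
    let ?C = "{c-r<..<c+r}"
    have C_sets: "?C \<in> sets (completion unif01)" by (rule sets_completion_unif01_borel) simp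
    have "{x \<in> space (sample unif01 (Suc 0)). x(Suc 0 := c) \<in> ?E}
        = {x \<in> space (sample unif01 (Suc 0)). x 0 \<in> ?C}"
      by (auto simp: space_PiM PiE_iff extensional_def)
    then have "measure (completion (sample unif01 (Suc 0)))
          {x \<in> space (sample unif01 (Suc 0)). x(Suc 0 := c) \<in> ?E}
        = measure unif01 ?C"
      using unif01.measure_completion_component[OF C_sets, of 0 "{..<Suc 0}"] by simp
    also have "\<dots> \<le> (c + r) - (c - r)" using r_nonneg by (intro measure_unif01_le) auto
    finally show "measure (completion (sample unif01 (Suc 0)))
          {x \<in> space (sample unif01 (Suc 0)). x(Suc 0 := c) \<in> ?E}
        \<le> 2 * r" by simp
  qed (use r_nonneg in simp)
  then show "measure (completion ?P) {x \<in> space ?P. \<bar>x i - x j\<bar> < r} \<le> 2 * r"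
    unfolding close_eq_vimage
    by (simp only: measure_completion_vimage[OF T_measurable T_distr E_sets])
qed

lemma
  fixes N m q :: nat and r :: real
  assumes r_nonneg: "0 \<le> r" and q_pos: "0 < q"
  defines "many \<equiv> {x \<in> space (sample unif01 (N * Suc m)). q < length (window_indices N m r x)}"
  shows sets_completion_many_window_indices: "many \<in> sets (completion (sample unif01 (N * Suc m)))"
    and measure_completion_many_window_indices_le:
      "measure (completion (sample unif01 (N * Suc m))) many \<le> real (N * Suc m) * (2 * r) / real q"
proof -
  let ?Q = "sample unif01 (N * Suc m)"
  interpret Q: prob_space "completion ?Q" by (rule unif01.prob_space_completion_iid)
  define F where "F = {i\<in>{..<N * Suc m}. i mod Suc m < m}"
  define A where "A i = {x \<in> space ?Q. \<bar>x i - x (centre m i)\<bar> < r}" for i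
  have F_props: "finite F" "card F \<le> N * Suc m"
    using card_mono[of "{..<N * Suc m}" F] by (auto simp: F_def)
  have A_events: "A i \<in> Q.events" "Q.prob (A i) \<le> 2 * r" if "i \<in> F" for i
  proof -
    have "i div Suc m < N" using that by (simp add: F_def less_mult_imp_div_less)
    then have "centre m i < N * Suc m"
      using block_index_less[of m "Suc m"] by (simp add: centre_def)
    moreover have "centre m i mod Suc m = m" by (simp only: centre_def mod_mult_self3) simp
    then have "i \<noteq> centre m i" using that by (auto simp: F_def)
    ultimately show "A i \<in> Q.events" "Q.prob (A i) \<le> 2 * r"
      unfolding A_def using that r_nonneg
      by (intro sets_completion_close_pair measure_completion_close_pair_le; simp add: F_def)+
  qed
  have "length (window_indices N m r x) = card {i\<in>F. x \<in> A i}" if "x \<in> space ?Q" for x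
  proof -
    have "distinct (window_indices N m r x)" by (simp add: window_indices_def)
    then have "length (window_indices N m r x) = card (set (window_indices N m r x))"
      by (rule distinct_card[symmetric])
    also have "set (window_indices N m r x) = {i\<in>F. x \<in> A i}"
      using that by (auto simp: window_indices_def F_def A_def)
    finally show ?thesis .
  qed
  then have many_eq: "many = {x \<in> space (completion ?Q). q < card {i\<in>F. x \<in> A i}}"
    by (auto simp: many_def)
  have [measurable]: "(\<lambda>x. card {i\<in>F. x \<in> A i}) \<in> completion ?Q \<rightarrow>\<^sub>M count_space UNIV"
  proof (rule measurable_card)
    show "{x \<in> space (completion ?Q). i \<in> {i\<in>F. x \<in> A i}} \<in> Q.events" for i
      using A_events(1)[of i] sets.sets_into_space[OF A_events(1), of i]
      by (cases "i \<in> F") (auto simp: Int_absorb1 Collect_conj_eq)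
  qed
  show "many \<in> Q.events" unfolding many_eq by measurable
  have "Q.prob many \<le> real (card F) * (2 * r) / real q"
    unfolding many_eq using F_props(1) A_events q_pos by (rule Q.prob_card_gt_le)
  also have "\<dots> \<le> real (N * Suc m) * (2 * r) / real q"
    using F_props(2) r_nonneg by (intro divide_right_mono mult_right_mono of_nat_mono) auto
  finally show "Q.prob many \<le> real (N * Suc m) * (2 * r) / real q" .
qed

lemma measure_completion_pair_snd:
  assumes prob_space_R: "prob_space R" and prob_space_Q: "prob_space Q"
    and P_sets: "{x \<in> space Q. P x} \<in> sets (completion Q)"
  shows "measure (completion (R \<Otimes>\<^sub>M Q)) {(\<omega>, x) \<in> space (R \<Otimes>\<^sub>M Q). P x}
      = measure (completion Q) {x \<in> space Q. P x}"
proof -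
  interpret R: prob_space R by (rule prob_space_R)
  interpret Q: prob_space Q by (rule prob_space_Q)
  have "distr (R \<Otimes>\<^sub>M Q) Q snd = Q"
  proof (rule measure_eqI)
    fix A assume "A \<in> sets (distr (R \<Otimes>\<^sub>M Q) Q snd)"
    then have A_sets: "A \<in> sets Q" by simp
    have "snd -` A \<inter> space (R \<Otimes>\<^sub>M Q) = space R \<times> A"
      using sets.sets_into_space[OF A_sets] by (auto simp: space_pair_measure)
    then show "emeasure (distr (R \<Otimes>\<^sub>M Q) Q snd) A = emeasure Q A"
      using A_sets by (simp add: emeasure_distr Q.emeasure_pair_measure_Times R.emeasure_space_1)
  qed simp
  moreover have "{(\<omega>, x) \<in> space (R \<Otimes>\<^sub>M Q). P x} = snd -` {x \<in> space Q. P x} \<inter> space (R \<Otimes>\<^sub>M Q)"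
    by (auto simp: space_pair_measure)
  ultimately show ?thesis using measure_completion_vimage[OF measurable_snd _ P_sets] by simp
qed

context
  fixes Y :: "'y measure" and H :: "(real \<Rightarrow> 'y) set" and N m q :: nat and r \<alpha> \<delta> :: real
  assumes traces_measurable: "trace_measurable Y H" and r_nonneg: "0 \<le> r"
    and N_large: "0 < N" "exp (- 2 * real N * \<delta>\<^sup>2) \<le> 1 / 5" and delta_nonneg: "0 \<le> \<delta>"
    and q_large: "0 < q" "20 * (real N * real (Suc m) * r) \<le> real q"
begin

abbreviation tester :: "(nat \<Rightarrow> real) \<Rightarrow> 'y strategy" where
  "tester \<equiv> block_tester H N m r (real N * (\<alpha> + \<delta>)) q"

abbreviation accept_event :: "(real \<Rightarrow> 'y) \<Rightarrow> (nat \<Rightarrow> real) set" where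
  "accept_event f \<equiv> {x \<in> space (sample unif01 (N * Suc m)). accepts (tester x) (\<lambda>i. f (x i))}"

abbreviation few_rejections :: "(real \<Rightarrow> 'y) \<Rightarrow> (nat \<Rightarrow> real) set" where
  "few_rejections f \<equiv> {x \<in> space (sample unif01 (N * Suc m)).
     real (block_count (Suc m) N (reject_event H f r m) x) \<le> real N * (\<alpha> + \<delta>)}"

interpretation Q: prob_space "sample unif01 (N * Suc m)" by (rule unif01.prob_space_iid)

interpretation C: prob_space "completion (sample unif01 (N * Suc m))"
  by (rule unif01.prob_space_completion_iid)

lemma accept_event_eq:
  "accept_event f = {x \<in> space (sample unif01 (N * Suc m)). q < length (window_indices N m r x)}
      \<union> few_rejections f"
  by (auto simp: accepts_block_tester)

lemma sets_few_rejections: "f \<in> borel \<rightarrow>\<^sub>M Y \<Longrightarrow> few_rejections f \<in> C.events"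
  by (rule unif01.sets_completion_block_count[OF sets_reject_event[OF traces_measurable],
      where P = "\<lambda>c. real c \<le> real N * (\<alpha> + \<delta>)"])

lemma sets_accept_event: "f \<in> borel \<rightarrow>\<^sub>M Y \<Longrightarrow> accept_event f \<in> C.events"
  unfolding accept_event_eq using sets_completion_many_window_indices[OF r_nonneg q_large(1)]
    sets_few_rejections
  by (rule sets.Un)

lemma prob_accept_event_ge:
  assumes f_measurable: "f \<in> borel \<rightarrow>\<^sub>M Y"
    and small: "measure (completion (sample unif01 (Suc m))) (reject_event H f r m) \<le> \<alpha>"
  shows "2 / 3 \<le> C.prob (accept_event f)"
proof -
  have "C.prob {x \<in> space (sample unif01 (N * Suc m)).
      real N * (\<alpha> + \<delta>) < real (block_count (Suc m) N (reject_event H f r m) x)} \<le> 1 / 5"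
    using unif01.prob_block_count_gt_le[OF sets_reject_event[OF traces_measurable f_measurable] _
      N_large(1) delta_nonneg small] N_large(2)
    by simp
  moreover have many_rejections_eq: "space (completion (sample unif01 (N * Suc m))) - few_rejections f
      = {x \<in> space (sample unif01 (N * Suc m)).
         real N * (\<alpha> + \<delta>) < real (block_count (Suc m) N (reject_event H f r m) x)}"
    by auto
  ultimately have "4 / 5 \<le> C.prob (few_rejections f)"
    using C.prob_compl[OF sets_few_rejections[OF f_measurable]] unfolding many_rejections_eq
    by linarith
  also have "\<dots> \<le> C.prob (accept_event f)"
  proof (rule C.finite_measure_mono[OF _ sets_accept_event[OF f_measurable]])
    show "few_rejections f \<subseteq> accept_event f" unfolding accept_event_eq by (rule Un_upper2)
  qed
  finally show ?thesis by simp
qed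

lemma prob_accept_event_le:
  assumes f_measurable: "f \<in> borel \<rightarrow>\<^sub>M Y"
    and large: "\<alpha> + 2 * \<delta> \<le> measure (completion (sample unif01 (Suc m))) (reject_event H f r m)"
  shows "C.prob (accept_event f) \<le> 1 / 3"
proof -
  let ?many = "{x \<in> space (sample unif01 (N * Suc m)). q < length (window_indices N m r x)}"
  have "C.prob ?many \<le> real (N * Suc m) * (2 * r) / real q"
    by (rule measure_completion_many_window_indices_le[OF r_nonneg q_large(1)])
  also have "\<dots> \<le> 1 / 10" using q_large by (simp add: field_simps)
  finally have "C.prob ?many \<le> 1 / 10" .
  moreover have "C.prob (few_rejections f) \<le> 1 / 5"
    using unif01.prob_block_count_le_le[OF sets_reject_event[OF traces_measurable f_measurable] _
      N_large(1) delta_nonneg large] N_large(2)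
    by simp
  moreover have "C.prob (accept_event f) \<le> C.prob ?many + C.prob (few_rejections f)"
    unfolding accept_event_eq using sets_completion_many_window_indices[OF r_nonneg q_large(1)]
      sets_few_rejections[OF f_measurable]
    by (rule measure_Un_le)
  ultimately show ?thesis by linarith
qed

lemma is_tester_block_tester:
  assumes accept: "\<And>f. f \<in> \<F> \<Longrightarrow> measure (completion (sample unif01 (Suc m))) (reject_event H f r m) \<le> \<alpha>"
    and reject: "\<And>f. f \<in> borel \<rightarrow>\<^sub>M Y \<Longrightarrow> \<epsilon> \<le> fdist_class unif01 f \<F> \<Longrightarrow>
      \<alpha> + 2 * \<delta> \<le> measure (completion (sample unif01 (Suc m))) (reject_event H f r m)"
  shows "is_tester Y unif01 \<F> \<epsilon> (N * Suc m) q unif01 (N * Suc m) (\<lambda>\<omega>. tester)"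
  unfolding is_tester_def Let_def
proof (intro conjI allI ballI impI)
  show "prob_space unif01" by (rule unif01.prob_space_axioms)
  show "set (queries (tester x) a) \<subseteq> {..<N * Suc m}" "length (queries (tester x) a) \<le> q" for x a
    by (rule queries_block_tester)+
next
  fix f :: "real \<Rightarrow> 'y" assume f_measurable: "f \<in> borel \<rightarrow>\<^sub>M Y"
  let ?R = "unif01 \<Otimes>\<^sub>M sample unif01 (N * Suc m)"
  note lift = measure_completion_pair_snd[OF unif01.prob_space_axioms Q.prob_space_axioms]
  show "2 / 3 \<le> measure (completion ?R) {(\<omega>, x) \<in> space ?R. accepts (tester x) (\<lambda>i. f (x i))}"
    if "f \<in> \<F>"
    unfolding lift[OF sets_accept_event[OF f_measurable]]
    by (rule prob_accept_event_ge[OF f_measurable accept[OF that]])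
  have reject_eq: "{x \<in> space (sample unif01 (N * Suc m)). \<not> accepts (tester x) (\<lambda>i. f (x i))}
      = space (completion (sample unif01 (N * Suc m))) - accept_event f" by auto
  have reject_sets: "{x \<in> space (sample unif01 (N * Suc m)). \<not> accepts (tester x) (\<lambda>i. f (x i))}
      \<in> C.events"
    unfolding reject_eq by (rule sets.compl_sets[OF sets_accept_event[OF f_measurable]])
  show "2 / 3 \<le> measure (completion ?R) {(\<omega>, x) \<in> space ?R. \<not> accepts (tester x) (\<lambda>i. f (x i))}"
    if "\<epsilon> \<le> fdist_class unif01 f \<F>"
    unfolding lift[OF reject_sets] unfolding reject_eq
      C.prob_compl[OF sets_accept_event[OF f_measurable]]
    using prob_accept_event_le[OF f_measurable reject[OF f_measurable that]] by simp
qed simp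

end

section \<open>Choice of the parameters\<close>

lemma nat_ceiling_bounds:
  assumes "0 \<le> (x::real)"
  shows "x \<le> real (nat \<lceil>x\<rceil>)" "real (nat \<lceil>x\<rceil>) \<le> x + 1"
  using assms by (simp_all add: of_nat_nat)

locale tester_parameters =
  fixes d k :: nat and \<epsilon> :: real
  assumes d_pos: "0 < d" and k_pos: "0 < k" and eps_bounds: "0 < \<epsilon>" "\<epsilon> < 1 / 2"
begin

definition radius :: real where "radius = \<epsilon> / (32 * real k)"

definition tolerance :: real where "tolerance = \<epsilon> * radius / 8"

definition ghost_hits :: nat where "ghost_hits = nat \<lceil>64 * (real d * ln (1 / \<epsilon>))\<rceil>"

definition block_points :: nat where "block_points = nat \<lceil>4 * real ghost_hits / tolerance\<rceil>"

definition blocks :: nat where "blocks = nat \<lceil>2 ^ 17 / \<epsilon> ^ 4\<rceil>"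

definition query_budget :: nat where
  "query_budget = nat \<lceil>20 * (real blocks * real (Suc block_points) * radius)\<rceil>"

definition margin :: real where "margin = \<epsilon>\<^sup>2 / 256"

lemma ln_inverse_ge: "1 / 2 \<le> ln (1 / \<epsilon>)"
proof -
  have "ln (1 / 2 :: real) \<le> - 1 / 2" using ln_le_minus_one[of "1 / 2 :: real"] by simp
  moreover have "ln \<epsilon> \<le> ln (1 / 2)" using eps_bounds by simp
  ultimately show ?thesis using eps_bounds by (simp add: ln_div)
qed

lemma radius_pos: "0 < radius" and tolerance_pos: "0 < tolerance"
  using k_pos eps_bounds by (simp_all add: radius_def tolerance_def)

lemma radius_le: "radius \<le> 1 / 64"
proof -
  have "\<epsilon> / (32 * real k) \<le> (1 / 2) / 32" using k_pos eps_bounds by (intro frac_le) auto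
  then show ?thesis by (simp add: radius_def)
qed

lemma ghost_hits_bounds:
  "64 * (real d * ln (1 / \<epsilon>)) \<le> real ghost_hits" "real ghost_hits \<le> 66 * (real d * ln (1 / \<epsilon>))"
proof -
  let ?x = "real d * ln (1 / \<epsilon>)"
  have "1 * (1 / 2) \<le> ?x" using d_pos ln_inverse_ge by (intro mult_mono) auto
  then have "0 \<le> 64 * ?x" "64 * ?x + 1 \<le> 66 * ?x" by linarith+
  then show "64 * ?x \<le> real ghost_hits" "real ghost_hits \<le> 66 * ?x"
    unfolding ghost_hits_def using nat_ceiling_bounds[of "64 * ?x"] by linarith+
qed

lemma ghost_hits_ge: "32 * d \<le> ghost_hits"
proof -
  have "real d * (1 / 2) \<le> real d * ln (1 / \<epsilon>)" using ln_inverse_ge by (intro mult_left_mono) auto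
  then show ?thesis using ghost_hits_bounds(1) by linarith
qed

lemma block_points_bounds:
  "4 * real ghost_hits / tolerance \<le> real block_points"
  "real block_points \<le> 4 * real ghost_hits / tolerance + 1"
  using nat_ceiling_bounds[of "4 * real ghost_hits / tolerance"] tolerance_pos
  by (simp_all add: block_points_def)

lemma ghost_hits_likely: "2 ^ ghost_hits * exp (- tolerance * real block_points / 2) \<le> 1 / 2"
proof -
  have some_hits: "1 \<le> ghost_hits" using ghost_hits_ge d_pos by simp
  have "4 * real ghost_hits \<le> tolerance * real block_points"
    using block_points_bounds(1) tolerance_pos by (simp add: field_simps)
  then have "exp (- tolerance * real block_points / 2) \<le> exp (real ghost_hits * - 2)" by simp
  also have "\<dots> = exp (- 2) ^ ghost_hits" by (rule exp_of_nat_mult)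
  finally have "2 ^ ghost_hits * exp (- tolerance * real block_points / 2)
      \<le> (2 * exp (- 2)) ^ ghost_hits"
    by (simp add: power_mult_distrib)
  also have "\<dots> \<le> (1 / 2) ^ ghost_hits"
  proof (rule power_mono)
    have "2 ^ 2 \<le> exp (1::real) ^ 2" using exp_ge_add_one_self[of 1] by (intro power_mono) auto
    then have "4 \<le> exp (2::real)" by (simp add: exp_of_nat_mult[symmetric])
    then show "2 * exp (- 2) \<le> (1 / 2 :: real)" by (simp add: exp_minus field_simps)
  qed simp
  also have "\<dots> \<le> (1 / 2) ^ 1" using some_hits by (intro power_decreasing) auto
  finally show ?thesis by simp
qed

lemma expected_window_points_bounds:
  "real d \<le> real (2 * block_points) * (2 * radius)"
  "real (2 * block_points) * (2 * radius) / real d \<le> 2 ^ 14 * (1 / \<epsilon>)\<^sup>2"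
proof -
  let ?b = "real ghost_hits" and ?m = "real block_points"
  have scale_eq: "4 * radius * (4 * ?b / tolerance) = 128 * (?b / \<epsilon>)"
    using radius_pos by (simp add: tolerance_def)
  have ghost_hits_large: "real d \<le> ?b" "1 \<le> ?b" using ghost_hits_ge d_pos by linarith+
  have ghost_hits_le: "?b \<le> ?b / \<epsilon>" using eps_bounds ghost_hits_large by (simp add: field_simps)
  have "real d \<le> 128 * (?b / \<epsilon>)" using ghost_hits_large ghost_hits_le by linarith
  also have "\<dots> \<le> 4 * radius * ?m"
    unfolding scale_eq[symmetric] using block_points_bounds(1) radius_pos
    by (intro mult_left_mono) auto
  finally show "real d \<le> real (2 * block_points) * (2 * radius)" by (simp add: ac_simps)
  have "4 * radius * ?m \<le> 4 * radius * (4 * ?b / tolerance + 1)"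
    using block_points_bounds(2) radius_pos by (intro mult_left_mono) auto
  also have "\<dots> = 128 * (?b / \<epsilon>) + 4 * radius" using scale_eq by (simp add: distrib_left)
  also have "\<dots> \<le> 129 * (?b / \<epsilon>)" using radius_le ghost_hits_large ghost_hits_le by linarith
  also have "\<dots> \<le> 129 * (66 * (real d * ln (1 / \<epsilon>)) / \<epsilon>)"
    using ghost_hits_bounds(2) eps_bounds by (intro mult_left_mono divide_right_mono) auto
  also have "\<dots> \<le> 129 * (66 * (real d * (1 / \<epsilon>)) / \<epsilon>)"
    using ln_le_minus_one[of "1 / \<epsilon>"] eps_bounds by (intro mult_left_mono divide_right_mono) auto
  also have "\<dots> \<le> 2 ^ 14 * (1 / \<epsilon>)\<^sup>2 * real d"
    using eps_bounds by (simp add: power2_eq_square divide_right_mono)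
  finally show "real (2 * block_points) * (2 * radius) / real d \<le> 2 ^ 14 * (1 / \<epsilon>)\<^sup>2"
    using d_pos by (simp add: field_simps)
qed

lemma double_sample_bound_le_margin:
  "double_sample_bound d block_points ghost_hits (2 * radius) \<le> margin"
proof -
  let ?L = "1 / \<epsilon>"
  have L_ge_2: "2 \<le> ?L" using eps_bounds by (simp add: field_simps)
  have L_pos: "0 < ?L ^ n" for n using eps_bounds by simp
  have "(\<Sum>i\<le>d. real (2 * block_points choose i) * (2 * radius) ^ i)
      \<le> (exp 1 * (real (2 * block_points) * (2 * radius)) / real d) ^ d"
    by (rule sum_choose_power_le[OF d_pos expected_window_points_bounds(1)])
  also have "\<dots> \<le> (?L ^ 18) ^ d"
  proof (rule power_mono)
    have "exp 1 * (real (2 * block_points) * (2 * radius) / real d) \<le> 2 ^ 2 * (2 ^ 14 * ?L\<^sup>2)"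
      using exp_le expected_window_points_bounds(2) radius_pos by (intro mult_mono) auto
    also have "\<dots> = 2 ^ 16 * ?L\<^sup>2" by simp
    also have "\<dots> \<le> ?L ^ 16 * ?L\<^sup>2" using L_ge_2 by (intro mult_right_mono power_mono) auto
    also have "\<dots> = ?L ^ 18" by (simp only: power_add[symmetric]) simp
    finally show "exp 1 * (real (2 * block_points) * (2 * radius)) / real d \<le> ?L ^ 18" by simp
  qed (use radius_pos in simp)
  finally have growth: "(\<Sum>i\<le>d. real (2 * block_points choose i) * (2 * radius) ^ i) \<le> ?L ^ (18 * d)"
    by (simp add: power_mult)
  have shrink: "?L ^ (32 * d) \<le> 2 ^ ghost_hits"
  proof -
    have "?L ^ (32 * d) = exp (32 * real d * ln ?L)"
      using eps_bounds exp_of_nat_mult[of "32 * d" "ln ?L"] by (simp add: exp_ln)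
    also have "\<dots> \<le> exp (real ghost_hits * (1 / 2))" using ghost_hits_bounds(1) by simp
    also have "\<dots> = exp (1 / 2) ^ ghost_hits" by (rule exp_of_nat_mult)
    also have "\<dots> \<le> 2 ^ ghost_hits"
      using exp_bound_half[of "1 / 2 :: real"] by (intro power_mono) auto
    finally show ?thesis .
  qed
  have "double_sample_bound d block_points ghost_hits (2 * radius)
      \<le> 2 * (?L ^ (18 * d) / ?L ^ (32 * d))"
    unfolding double_sample_bound_def
    by (intro mult_left_mono frac_le growth shrink L_pos less_imp_le[OF L_pos]) simp
  also have "\<dots> = 2 * \<epsilon> ^ (14 * d)"
    using eps_bounds power_add[of \<epsilon> "18 * d" "14 * d"] by (simp add: power_divide)
  also have "\<dots> \<le> 2 * \<epsilon> ^ 14" using eps_bounds d_pos by (intro mult_left_mono power_decreasing) auto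
  also have "\<dots> = 2 * \<epsilon> ^ 12 * \<epsilon>\<^sup>2" by (simp only: mult.assoc power_add[symmetric]) simp
  also have "\<dots> \<le> 2 * (1 / 2) ^ 12 * \<epsilon>\<^sup>2" using eps_bounds by (intro mult_mono power_mono) auto
  also have "\<dots> \<le> margin" by (simp add: margin_def power_divide)
  finally show ?thesis .
qed

lemma blocks_bounds: "2 ^ 17 / \<epsilon> ^ 4 \<le> real blocks" "real blocks \<le> 2 ^ 18 / \<epsilon> ^ 4"
proof -
  have "1 \<le> 1 / \<epsilon> ^ 4" using eps_bounds by (simp add: power_le_one)
  then have "1 * 1 \<le> 2 ^ 17 * (1 / \<epsilon> ^ 4)" by (intro mult_mono) auto
  moreover have "2 ^ 18 / \<epsilon> ^ 4 = 2 ^ 17 / \<epsilon> ^ 4 + 2 ^ 17 * (1 / \<epsilon> ^ 4)" by simp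
  ultimately have "2 ^ 17 / \<epsilon> ^ 4 + 1 \<le> 2 ^ 18 / \<epsilon> ^ 4" by linarith
  moreover have "0 \<le> 2 ^ 17 / \<epsilon> ^ 4" using eps_bounds by simp
  ultimately show "2 ^ 17 / \<epsilon> ^ 4 \<le> real blocks" "real blocks \<le> 2 ^ 18 / \<epsilon> ^ 4"
    unfolding blocks_def using nat_ceiling_bounds[of "2 ^ 17 / \<epsilon> ^ 4"] by linarith+
qed

lemma blocks_deviation: "exp (- 2 * real blocks * margin\<^sup>2) \<le> 1 / 5"
proof -
  have "4 = 2 * (2 ^ 17 / \<epsilon> ^ 4) * margin\<^sup>2"
    using eps_bounds by (simp add: margin_def power2_eq_square power4_eq_xxxx)
  also have "\<dots> \<le> 2 * real blocks * margin\<^sup>2"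
    using blocks_bounds(1) by (intro mult_right_mono mult_left_mono) auto
  finally have "exp (- 2 * real blocks * margin\<^sup>2) \<le> exp (- 4)" by simp
  also have "\<dots> \<le> 1 / 5" using exp_ge_add_one_self[of 4] by (simp add: exp_minus field_simps)
  finally show ?thesis .
qed

lemma sample_size_le:
  "real (blocks * Suc block_points) \<le> 2 ^ 35 * (real d * real k / \<epsilon> ^ 6 * ln (1 / \<epsilon>))"
proof -
  let ?c = "real d * real k * ln (1 / \<epsilon>) / \<epsilon>\<^sup>2"
  have "4 * real ghost_hits / tolerance = 1024 * real k * real ghost_hits / \<epsilon>\<^sup>2"
    using k_pos eps_bounds by (simp add: tolerance_def radius_def power2_eq_square)
  also have "\<dots> \<le> 1024 * real k * (66 * (real d * ln (1 / \<epsilon>))) / \<epsilon>\<^sup>2"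
    using ghost_hits_bounds(2) by (intro divide_right_mono mult_left_mono) auto
  finally have "4 * real ghost_hits / tolerance \<le> 67584 * ?c" by (simp add: ac_simps)
  moreover have "1 \<le> 2 * ?c"
  proof -
    have "1 * 1 * (1 / 2) / 1 \<le> ?c"
      using d_pos k_pos eps_bounds ln_inverse_ge
      by (intro frac_le mult_mono) (auto simp: power_le_one)
    then show ?thesis by linarith
  qed
  ultimately have "real (Suc block_points) \<le> 67588 * ?c" "0 \<le> ?c"
    unfolding of_nat_Suc using block_points_bounds(2) by linarith+
  then have "real (Suc block_points) \<le> 2 ^ 17 * ?c" by simp
  then have "real blocks * real (Suc block_points) \<le> 2 ^ 18 / \<epsilon> ^ 4 * (2 ^ 17 * ?c)"
    using blocks_bounds(2) eps_bounds by (intro mult_mono) auto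
  also have "\<dots> = 2 ^ 35 * (real d * real k / (\<epsilon> ^ 4 * \<epsilon>\<^sup>2) * ln (1 / \<epsilon>))" by simp
  also have "\<epsilon> ^ 4 * \<epsilon>\<^sup>2 = \<epsilon> ^ 6" by (simp only: power_add[symmetric]) simp
  finally show ?thesis by (simp only: of_nat_mult)
qed

lemma query_budget_bounds:
  "20 * (real blocks * real (Suc block_points) * radius) \<le> real query_budget"
  "real query_budget \<le> 2 ^ 35 * (real d / \<epsilon> ^ 8 * ln (1 / \<epsilon>))"
proof -
  let ?c = "real d / \<epsilon> ^ 8 * ln (1 / \<epsilon>)"
  have nonneg: "0 \<le> 20 * (real blocks * real (Suc block_points) * radius)" using radius_pos by simp
  show "20 * (real blocks * real (Suc block_points) * radius) \<le> real query_budget"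
    unfolding query_budget_def using nonneg by (rule nat_ceiling_bounds(1))
  have "real blocks * real (Suc block_points) * radius
      \<le> 2 ^ 35 * (real d * real k / \<epsilon> ^ 6 * ln (1 / \<epsilon>)) * radius"
    using sample_size_le[unfolded of_nat_mult] less_imp_le[OF radius_pos] by (rule mult_right_mono)
  also have "\<dots> = 2 ^ 30 * (real d * ln (1 / \<epsilon>)) * (\<epsilon> / \<epsilon> ^ 6)"
    using k_pos by (simp add: radius_def)
  also have "\<dots> \<le> 2 ^ 30 * (real d * ln (1 / \<epsilon>)) * (1 / \<epsilon> ^ 8)"
  proof (rule mult_left_mono)
    have "\<epsilon> / \<epsilon> ^ 6 \<le> 1 / \<epsilon> ^ 6" using eps_bounds by (intro divide_right_mono) auto
    also have "\<dots> \<le> 1 / \<epsilon> ^ 8" using eps_bounds by (intro divide_left_mono power_decreasing) auto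
    finally show "\<epsilon> / \<epsilon> ^ 6 \<le> 1 / \<epsilon> ^ 8" .
  qed (use ln_inverse_ge in simp)
  also have "\<dots> = 2 ^ 30 * ?c" by simp
  finally have "real blocks * real (Suc block_points) * radius \<le> 2 ^ 30 * ?c" .
  moreover have "1 \<le> 2 * ?c"
  proof -
    have "1 / 1 * (1 / 2) \<le> ?c"
      using d_pos eps_bounds ln_inverse_ge by (intro frac_le mult_mono) (auto simp: power_le_one)
    then show ?thesis by linarith
  qed
  ultimately show "real query_budget \<le> 2 ^ 35 * ?c"
    using nat_ceiling_bounds(2)[OF nonneg] by (simp add: query_budget_def)
qed

lemma query_budget_pos: "0 < query_budget"
proof -
  have "0 < 2 ^ 17 / \<epsilon> ^ 4" using eps_bounds by simp
  then have "0 < real blocks" using blocks_bounds(1) by linarith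
  then have "0 < 20 * (real blocks * real (Suc block_points) * radius)" using radius_pos by simp
  then show ?thesis using query_budget_bounds(1) by linarith
qed

lemma is_tester_piecewise:
  assumes H_nonempty: "H \<noteq> {}" and traces_measurable: "trace_measurable Y H"
    and crossings_null: "zero_measure_crossings H"
    and graph_dim_eq: "graph_dim H = enat d"
  shows "is_tester Y unif01 (piecewise k H) \<epsilon> (blocks * Suc block_points) query_budget unif01
    (blocks * Suc block_points)
    (\<lambda>\<omega>. block_tester H blocks block_points radius
      (real blocks * (2 * radius * (real k - 1) + margin)) query_budget)"
proof (rule is_tester_block_tester[OF traces_measurable less_imp_le[OF radius_pos] _ blocks_deviation
      _ query_budget_pos query_budget_bounds(1)])
  show "measure (completion (sample unif01 (Suc block_points))) (reject_event H f radius block_points)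
      \<le> 2 * radius * (real k - 1)" if "f \<in> piecewise k H" for f
    using measure_reject_event_le[OF that] radius_pos by simp
  show "2 * radius * (real k - 1) + 2 * margin
      \<le> measure (completion (sample unif01 (Suc block_points))) (reject_event H f radius block_points)"
    if f_measurable: "f \<in> borel \<rightarrow>\<^sub>M Y" and far: "\<epsilon> \<le> fdist_class unif01 f (piecewise k H)" for f
  proof -
    have disagreement_sets: "{x. f x \<noteq> h x} \<in> sets (completion unif01)" if "h \<in> H" for h
      using sets_disagreement_of_far_piecewise[OF eps_bounds(1) far k_pos that] by simp
    have "graph_dim H \<le> enat d" using graph_dim_eq by simp
    note measure_reject_event_ge[OF traces_measurable f_measurable this disagreement_sets
      less_imp_le[OF radius_pos] ghost_hits_likely]
    moreover have "2 * radius * (real k - 1) + \<epsilon>\<^sup>2 / 64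
        \<le> measure unif01 (bad_centres H f radius tolerance)"
      using eps_bounds
      by (intro measure_bad_centres_ge_of_far[OF H_nonempty crossings_null k_pos _ _ far radius_def
          tolerance_def]) auto
    moreover have "\<epsilon>\<^sup>2 / 64 = 4 * margin" "0 \<le> margin" by (simp_all add: margin_def)
    ultimately show ?thesis using double_sample_bound_le_margin by linarith
  qed
  show "0 < blocks" using query_budget_pos by (cases "blocks = 0") (auto simp: query_budget_def)
  show "0 \<le> margin" by (simp add: margin_def)
qed

end

theorem theorem1:
  "\<exists>C > (0::real). \<forall>(Y :: 'y measure) (H :: (real \<Rightarrow> 'y) set) (d::nat) (k::nat) (\<epsilon>::real).
     space Y \<noteq> {} \<longrightarrow> H \<noteq> {} \<longrightarrow> H \<subseteq> borel \<rightarrow>\<^sub>M Y \<longrightarrow> trace_measurable Y H \<longrightarrow>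
     zero_measure_crossings H \<longrightarrow> graph_dim H = enat d \<longrightarrow> 0 < d \<longrightarrow> 0 < k \<longrightarrow>
     0 < \<epsilon> \<longrightarrow> \<epsilon> < 1/2 \<longrightarrow>
     (\<exists>s q. real s \<le> C * (real d * real k / \<epsilon>^6 * ln (1/\<epsilon>)) \<and>
            real q \<le> C * (real d / \<epsilon>^8 * ln (1/\<epsilon>)) \<and>
            (\<exists>R m A. is_tester Y unif01 (piecewise k H) \<epsilon> s q R m A))"
proof (intro exI[of _ "2 ^ 35 :: real"] conjI allI impI)
  fix Y :: "'y measure" and H :: "(real \<Rightarrow> 'y) set" and d k :: nat and \<epsilon> :: real
  assume class_props: "H \<noteq> {}" "trace_measurable Y H" "zero_measure_crossings H" "graph_dim H = enat d"
    and parameter_bounds: "0 < d" "0 < k" "0 < \<epsilon>" "\<epsilon> < 1/2"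
  interpret tester_parameters d k \<epsilon> by unfold_locales (fact parameter_bounds)+
  show "\<exists>s q. real s \<le> 2 ^ 35 * (real d * real k / \<epsilon>^6 * ln (1/\<epsilon>)) \<and>
      real q \<le> 2 ^ 35 * (real d / \<epsilon>^8 * ln (1/\<epsilon>)) \<and>
      (\<exists>R m A. is_tester Y unif01 (piecewise k H) \<epsilon> s q R m A)"
    using sample_size_le query_budget_bounds(2) is_tester_piecewise[OF class_props] by blast
qed simp

end
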